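(* Suppose $\mathcal{S}_{\rm sel}$ and the finite index set $J$ are fixed while $|\mathcal{S}_{\rm neut}|\to\infty$, and take $n\to\infty$ with $n\mu^{\chi,\psi}(j)\to\theta^{\chi,\psi}(j)\in[0,\infty)$ and $|\mathcal{S}(j)|/|\mathcal{S}_{\rm neut}|\to q(j)$ for all $j\in J$ and $\chi\ne\psi$ in $\mathcal{N}$. Then $$\frac{1}{|\mathcal{S}|}\sum_{i\in\mathcal{S}}\delta_{B_i^{n,\mu}}\longrightarrow\sum_{j\in J}q(j)\Lambda(j)$$ in probability, in the space of probability measures on $\mathbb{N}_0$ with the weak topology, where $\Lambda(j)$ is the generalised Luria–Delbrück distribution with parameters $$\Big(\alpha(u')-\beta(u'),\ \alpha(u'),\ \beta(u'),\ \frac{2\alpha(u')}{\alpha(u')-\beta(u')}\sum_{\psi\in\mathcal{N}\setminus\{u(j)\}}\theta^{u(j),\psi}(j)\Big).$$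
   Context: Generalised model. $\mathcal{N}=\{A,C,G,T\}$; $\mathcal{S}$ is a finite set of sites partitioned as $\mathcal{S}=\mathcal{S}_{\rm neut}\cup\mathcal{S}_{\rm sel}$ with $\mathcal{S}_{\rm sel}\ne\emptyset$; $\mathcal{G}=\mathcal{N}^{\mathcal{S}}$; for $v\in\mathcal{G}$, $v'=(v_i)_{i\in\mathcal{S}_{\rm sel}}$. $\alpha,\beta:\mathcal{N}^{\mathcal{S}_{\rm sel}}\to[0,\infty)$. Starting from one cell with genome $u$, $\alpha(u')>\beta(u')$, a cell with genome $v$ divides at rate $\alpha(v')$ and dies at rate $\beta(v')$, independently (multitype Markov branching process). At a division of a cell of genome $v$, conditionally on $v$ the daughters' entries $V_i^{(r)}$ ($i\in\mathcal{S}$, $r\in\{1,2\}$) are independent with $\mathbb{P}[V_i^{(r)}=\psi\mid v]=\mu_i^{v_i,\psi}$ (probabilities summing to 1 over $\psi$). $\sigma_n$ = first time there are $n$ cells; $B_i^{n,\mu}$ = number of cells at $\sigma_n$ whose nucleotide at site $i$ differs from $u_i$, conditioned on $\{\sigma_n<\infty\}$. The neutral sites are partitioned $\mathcal{S}_{\rm neut}=\bigcup_{j\in J}\mathcal{S}(j)$ ($J$ finite) such that on each $\mathcal{S}(j)$ the mutation probabilities and initial nucleotides are constant: $\mu_i^{\chi,\psi}=\mu^{\chi,\psi}(j)$ and $u_i=u(j)$ for $i\in\mathcal{S}(j)$. Generalised Luria–Delbrück distribution with parameters $(\lambda,a,b,c)$: the law of $\sum_{k=1}^K Y_k(\xi_k)$,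 $(\xi_k)$ i.i.d. exponential with mean $\lambda^{-1}$, $(Y_k)$ i.i.d. birth–death processes with birth rate $a$, death rate $b$, $Y_k(0)=1$, $K\sim$ Poisson$(c)$, all independent.
   Formalization: Adds that at each selected site i also nμ_i^{χ,ψ} converges to a finite limit for χ≠ψ; with unrestricted mutation at selected sites the claim fails (e.g. if every division turns the selected site into a type with other rates). *)

theory Defs
  imports "HOL-Probability.Probability"
begin

datatype nuc = NA | NC | NG | NT

type_synonym genome = "nat \<Rightarrow> nuc"

definition sel_part :: "nat set \<Rightarrow> genome \<Rightarrow> genome" where
  "sel_part Ssel v = (\<lambda>i. if i \<in> Ssel then v i else NA)"

definition total_rate :: "(genome \<Rightarrow> real) \<Rightarrow> (genome \<Rightarrow> real) \<Rightarrow> nat set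
    \<Rightarrow> genome multiset \<Rightarrow> real" where
  "total_rate \<alpha> \<beta> Ssel M = (\<Sum>v\<in>#M. \<alpha> (sel_part Ssel v) + \<beta> (sel_part Ssel v))"

definition daughter :: "nat set \<Rightarrow> (nat \<Rightarrow> nuc \<Rightarrow> nuc pmf) \<Rightarrow> genome \<Rightarrow> genome pmf" where
  "daughter S \<mu> v = Pi_pmf S NA (\<lambda>i. \<mu> i (v i))"

text \<open>One step of the embedded jump chain of the multitype branching process:
  the event (cell v divides / dies) is chosen with probability proportional to its rate.\<close>
definition bp_step :: "(genome \<Rightarrow> real) \<Rightarrow> (genome \<Rightarrow> real) \<Rightarrow> nat set \<Rightarrow> nat set
    \<Rightarrow> (nat \<Rightarrow> nuc \<Rightarrow> nuc pmf) \<Rightarrow> genome multiset \<Rightarrow> genome multiset pmf" where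
  "bp_step \<alpha> \<beta> Ssel S \<mu> M =
     do {
       (v, d) \<leftarrow> embed_pmf (\<lambda>(v, d). real (count M v) *
                   (if d then \<alpha> (sel_part Ssel v) else \<beta> (sel_part Ssel v)) / total_rate \<alpha> \<beta> Ssel M);
       if d then do {
         d1 \<leftarrow> daughter S \<mu> v;
         d2 \<leftarrow> daughter S \<mu> v;
         return_pmf (M - {#v#} + {#d1, d2#})
       } else return_pmf (M - {#v#})
     }"

text \<open>Sub-probability law of the population at sigma_n (first time there are n cells);
  the missing mass is P[sigma_n = infinity].\<close>
partial_function (spmf) bp_hit :: "(genome \<Rightarrow> real) \<Rightarrow> (genome \<Rightarrow> real) \<Rightarrow> nat set \<Rightarrow> nat set
    \<Rightarrow> (nat \<Rightarrow> nuc \<Rightarrow> nuc pmf) \<Rightarrow> nat \<Rightarrow> genome multiset \<Rightarrow> genome multiset spmf" where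
  "bp_hit \<alpha> \<beta> Ssel S \<mu> n M =
     (if size M = n then return_spmf M
      else if size M = 0 \<or> total_rate \<alpha> \<beta> Ssel M = 0 then return_pmf None
      else bind_spmf (spmf_of_pmf (bp_step \<alpha> \<beta> Ssel S \<mu> M)) (bp_hit \<alpha> \<beta> Ssel S \<mu> n))"

definition bp_cond_prob :: "(genome \<Rightarrow> real) \<Rightarrow> (genome \<Rightarrow> real) \<Rightarrow> nat set \<Rightarrow> nat set
    \<Rightarrow> (nat \<Rightarrow> nuc \<Rightarrow> nuc pmf) \<Rightarrow> nat \<Rightarrow> genome \<Rightarrow> genome multiset set \<Rightarrow> real" where
  "bp_cond_prob \<alpha> \<beta> Ssel S \<mu> n u E =
     measure (measure_spmf (bp_hit \<alpha> \<beta> Ssel S \<mu> n {#u#})) E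
       / weight_spmf (bp_hit \<alpha> \<beta> Ssel S \<mu> n {#u#})"

definition B_count :: "genome \<Rightarrow> genome multiset \<Rightarrow> nat \<Rightarrow> nat" where
  "B_count u M i = size (filter_mset (\<lambda>v. v i \<noteq> u i) M)"

definition emp_meas :: "nat set \<Rightarrow> genome \<Rightarrow> genome multiset \<Rightarrow> nat \<Rightarrow> real" where
  "emp_meas S u M k = real (card {i \<in> S. B_count u M i = k}) / real (card S)"

text \<open>Birth-death process with birth rate a, death rate b, Y(0) = 1, constructed from
  randomness w k = (E_k, U_k) (E_k ~ Exp(1), U_k ~ Unif[0,1], i.i.d.): holding time in state y
  is E_k / (y (a+b)), the jump is a birth iff U_k < a/(a+b).\<close>
fun bd_chain :: "real \<Rightarrow> real \<Rightarrow> (nat \<Rightarrow> real \<times> real) \<Rightarrow> nat \<Rightarrow> nat" where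
  "bd_chain a b w 0 = 1"
| "bd_chain a b w (Suc k) =
     (if bd_chain a b w k = 0 \<or> a + b = 0 then bd_chain a b w k
      else if snd (w k) < a / (a + b) then bd_chain a b w k + 1 else bd_chain a b w k - 1)"

fun bd_jump_time :: "real \<Rightarrow> real \<Rightarrow> (nat \<Rightarrow> real \<times> real) \<Rightarrow> nat \<Rightarrow> real" where
  "bd_jump_time a b w 0 = 0"
| "bd_jump_time a b w (Suc k) =
     bd_jump_time a b w k + fst (w k) / (real (bd_chain a b w k) * (a + b))"

text \<open>Value Y(t): the state after the last jump at or before time t (absorbing states never jump).\<close>
definition bd_value :: "real \<Rightarrow> real \<Rightarrow> (nat \<Rightarrow> real \<times> real) \<Rightarrow> real \<Rightarrow> nat" where
  "bd_value a b w t = bd_chain a b w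
     (LEAST k. bd_chain a b w k = 0 \<or> a + b = 0 \<or> t < bd_jump_time a b w (Suc k))"

definition exp_meas :: "real \<Rightarrow> real measure" where
  "exp_meas l = density lborel (exponential_density l)"

definition bd_rand_space :: "(nat \<Rightarrow> real \<times> real) measure" where
  "bd_rand_space = PiM UNIV (\<lambda>_. exp_meas 1 \<Otimes>\<^sub>M uniform_measure lborel {0..1})"

definition poisson_or_zero :: "real \<Rightarrow> nat pmf" where
  "poisson_or_zero c = (if c > 0 then poisson_pmf c else return_pmf 0)"

text \<open>Probability space carrying K ~ Poisson(c), and i.i.d. pairs (Y_k, xi_k),
  xi_k ~ Exp with mean 1/lambda, all independent.\<close>
definition LD_space :: "real \<Rightarrow> real \<Rightarrow> (nat \<times> (nat \<Rightarrow> (nat \<Rightarrow> real \<times> real) \<times> real)) measure" where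
  "LD_space lam c = measure_pmf (poisson_or_zero c) \<Otimes>\<^sub>M
                    PiM UNIV (\<lambda>_. bd_rand_space \<Otimes>\<^sub>M exp_meas lam)"

definition gen_LD :: "real \<Rightarrow> real \<Rightarrow> real \<Rightarrow> real \<Rightarrow> nat \<Rightarrow> real" where
  "gen_LD lam a b c m = measure (LD_space lam c)
     {x \<in> space (LD_space lam c).
        (\<Sum>k<fst x. bd_value a b (fst (snd x k)) (snd (snd x k))) = m}"

end

theory Submission
  imports Defs
begin

text \<open>
  Only two neutral sites have to be observed at a time. For a set T of at most two neutral sites, let N
  be the current number of cells, m the number of mutations at T among them, and fix x in (0,1). The
  expectation of x^m at the time when n cells are present is approximated by
  Psi = (1 - rho^N) g(N/n)^m H(N/n), where rho = b/a, 1 - rho^N is the survival probability, g is the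
  birth-death generating function in the time variable s = exp(-lambda t), and H is the exponential
  factor produced by Poissonian mutations; Psi solves the backward equation of the limiting dynamics, so one
  step of the jump chain changes its mean by o(1/n) as long as few cells carry a mutation at T or
  at a selective site. The error is dominated by a single potential, the sum of a logarithmic Lyapunov
  function for the number of mutants, the indicator of a cell with two relevant mutations, and a
  Green function of the drifting random walk N; selection therefore plays no role in the limit.
  Letting n grow, the generating functions of B_i and of pairs (B_i, B_j) converge, respectively, to
  the Luria-Delbrueck one and to the product of two of them. Chebyshev's inequality makes the
  generating function of the empirical measure converge in probability, and its values at finitely many
  small arguments control the distance in total variation.
\<close>


section \<open>The birth-death process at an exponential time\<close>

definition bd_step :: "real \<Rightarrow> real \<Rightarrow> nat \<Rightarrow> real \<times> real \<Rightarrow> nat" where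
  "bd_step a b y w = (if y = 0 \<or> a + b = 0 then y else if snd w < a / (a + b) then y + 1 else y - 1)"

fun bd_chain_from :: "real \<Rightarrow> real \<Rightarrow> nat \<Rightarrow> (nat \<Rightarrow> real \<times> real) \<Rightarrow> nat \<Rightarrow> nat" where
  "bd_chain_from a b y w 0 = y"
| "bd_chain_from a b y w (Suc k) = bd_step a b (bd_chain_from a b y w k) (w k)"

fun bd_jump_time_from :: "real \<Rightarrow> real \<Rightarrow> nat \<Rightarrow> (nat \<Rightarrow> real \<times> real) \<Rightarrow> nat \<Rightarrow> real" where
  "bd_jump_time_from a b y w 0 = 0"
| "bd_jump_time_from a b y w (Suc k) =
     bd_jump_time_from a b y w k + fst (w k) / (real (bd_chain_from a b y w k) * (a + b))"

definition bd_stopped :: "real \<Rightarrow> real \<Rightarrow> nat \<Rightarrow> (nat \<Rightarrow> real \<times> real) \<Rightarrow> real \<Rightarrow> nat \<Rightarrow> bool" where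
  "bd_stopped a b y w t k \<longleftrightarrow> bd_chain_from a b y w k = 0 \<or> a + b = 0 \<or> t < bd_jump_time_from a b y w (Suc k)"

text \<open>On an exploding path the index minimised in \<^const>\<open>bd_value\<close> does not exist and its value is
  unspecified. Here such paths contribute 0, so that the first-step decomposition holds for every path;
  explosion is excluded afterwards, by taking x = 1.\<close>
definition bd_pgf_val :: "real \<Rightarrow> real \<Rightarrow> real \<Rightarrow> nat \<Rightarrow> (nat \<Rightarrow> real \<times> real) \<Rightarrow> real \<Rightarrow> real" where
  "bd_pgf_val x a b y w t =
     (if \<exists>k. bd_stopped a b y w t k then x ^ bd_chain_from a b y w (LEAST k. bd_stopped a b y w t k) else 0)"

lemma bd_chain_eq_from: "bd_chain a b w k = bd_chain_from a b 1 w k"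
  by (induction k) (auto simp: bd_step_def)

lemma bd_jump_time_eq_from: "bd_jump_time a b w k = bd_jump_time_from a b 1 w k"
  by (induction k) (auto simp: bd_chain_eq_from)

lemma bd_value_eq_from:
  "bd_value a b w t = bd_chain_from a b 1 w (LEAST k. bd_stopped a b 1 w t k)"
  unfolding bd_value_def bd_stopped_def bd_chain_eq_from bd_jump_time_eq_from ..

lemma bd_chain_from_shift:
  "bd_chain_from a b y (case_nat s w) (Suc k) = bd_chain_from a b (bd_step a b y s) w k"
  by (induction k) auto

lemma bd_jump_time_from_shift:
  "bd_jump_time_from a b y (case_nat s w) (Suc k) =
     fst s / (real y * (a + b)) + bd_jump_time_from a b (bd_step a b y s) w k"
proof (induction k)
  case (Suc k)
  have "bd_jump_time_from a b y (case_nat s w) (Suc (Suc k)) =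
    bd_jump_time_from a b y (case_nat s w) (Suc k) +
    fst (w k) / (real (bd_chain_from a b y (case_nat s w) (Suc k)) * (a + b))"
    by (subst bd_jump_time_from.simps(2)) simp
  then show ?case
    unfolding bd_chain_from_shift Suc.IH by simp
qed simp

lemma bd_pgf_val_shift:
  assumes "y > 0" "a + b > 0"
  shows "bd_pgf_val x a b y (case_nat s w) t =
    (if t < fst s / (real y * (a + b)) then x ^ y
     else bd_pgf_val x a b (bd_step a b y s) w (t - fst s / (real y * (a + b))))"
proof -
  let ?P = "bd_stopped a b y (case_nat s w) t"
  let ?P' = "bd_stopped a b (bd_step a b y s) w (t - fst s / (real y * (a + b)))"
  have P0: "?P 0 \<longleftrightarrow> t < fst s / (real y * (a + b))"
    using assms by (simp add: bd_stopped_def)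
  have PS: "?P (Suc k) = ?P' k" for k
    unfolding bd_stopped_def bd_chain_from_shift bd_jump_time_from_shift by auto
  show ?thesis
  proof (cases "?P 0")
    case True
    then have "(LEAST k. ?P k) = 0" by (simp add: Least_eq_0)
    then show ?thesis using True P0 by (auto simp: bd_pgf_val_def)
  next
    case False
    have ex: "(\<exists>k. ?P k) \<longleftrightarrow> (\<exists>k. ?P' k)"
      using False PS by (metis not0_implies_Suc)
    show ?thesis
    proof (cases "\<exists>k. ?P k")
      case T: True
      then obtain k where "?P k" by blast
      then have "(LEAST k. ?P k) = Suc (LEAST k. ?P (Suc k))"
        using False by (rule Least_Suc)
      then have "bd_chain_from a b y (case_nat s w) (LEAST k. ?P k) =
         bd_chain_from a b (bd_step a b y s) w (LEAST k. ?P' k)"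
        unfolding PS using bd_chain_from_shift by simp
      then show ?thesis using T ex False P0 unfolding bd_pgf_val_def by auto
    next
      case F: False
      then show ?thesis using ex False P0 unfolding bd_pgf_val_def by auto
    qed
  qed
qed

lemma bd_pgf_val_0: "bd_pgf_val x a b 0 w t = 1"
proof -
  have "bd_stopped a b 0 w t 0" by (simp add: bd_stopped_def)
  moreover from this have "(LEAST k. bd_stopped a b 0 w t k) = 0" by (simp add: Least_eq_0)
  ultimately show ?thesis by (auto simp: bd_pgf_val_def)
qed

lemma bd_pgf_val_bounds: "0 \<le> x \<Longrightarrow> x \<le> 1 \<Longrightarrow> 0 \<le> bd_pgf_val x a b y w t \<and> bd_pgf_val x a b y w t \<le> 1"
  by (auto simp: bd_pgf_val_def power_le_one)

abbreviation bd_step_meas :: "(real \<times> real) measure" where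
  "bd_step_meas \<equiv> exp_meas 1 \<Otimes>\<^sub>M uniform_measure lborel {0..1}"

lemma sets_exp_meas [measurable_cong]: "sets (exp_meas l) = sets borel"
  by (simp add: exp_meas_def)

lemma space_exp_meas [simp]: "space (exp_meas l) = UNIV"
  by (simp add: exp_meas_def)

lemma sets_unif [measurable_cong]: "sets (uniform_measure lborel {0..1::real}) = sets borel"
  by simp

lemma measurable_bd_chain_from [measurable]:
  "(\<lambda>w. bd_chain_from a b y w k) \<in> measurable (PiM UNIV (\<lambda>_. bd_step_meas)) (count_space UNIV)"
proof (induction k)
  case (Suc k)
  note [measurable] = Suc
  show ?case unfolding bd_chain_from.simps bd_step_def by measurable
qed simp

lemma measurable_bd_jump_time_from [measurable]:
  "(\<lambda>w. bd_jump_time_from a b y w k) \<in> borel_measurable (PiM UNIV (\<lambda>_. bd_step_meas))"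
  by (induction k) simp_all

lemma measurable_bd_stopped [measurable]:
  "(\<lambda>(w, t). bd_stopped a b y w t k) \<in> measurable (PiM UNIV (\<lambda>_. bd_step_meas) \<Otimes>\<^sub>M borel) (count_space UNIV)"
  unfolding bd_stopped_def by measurable

lemma measurable_bd_chain_from_Least [measurable]:
  "(\<lambda>(w, t). bd_chain_from a b y w (LEAST k. bd_stopped a b y w t k)) \<in>
     measurable (PiM UNIV (\<lambda>_. bd_step_meas) \<Otimes>\<^sub>M borel) (count_space UNIV)"
  unfolding split_beta'
  by (rule measurable_compose_countable[where f = "\<lambda>k x. bd_chain_from a b y (fst x) k"]) measurable

lemma measurable_bd_pgf_val [measurable]:
  "(\<lambda>(w, t). bd_pgf_val x a b y w t) \<in> borel_measurable (PiM UNIV (\<lambda>_. bd_step_meas) \<Otimes>\<^sub>M borel)"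
  unfolding bd_pgf_val_def by measurable

lemma prob_space_exp_meas: "l > 0 \<Longrightarrow> prob_space (exp_meas l)"
  unfolding exp_meas_def by (rule prob_space_exponential_density)

lemma prob_space_unif: "prob_space (uniform_measure lborel {0..1::real})"
  by (rule prob_space_uniform_measure) auto

lemma prob_space_bd_step_meas: "prob_space bd_step_meas"
  by (intro prob_space_pair prob_space_exp_meas prob_space_unif) auto

lemma prob_space_bd_rand: "prob_space (PiM UNIV (\<lambda>_::nat. bd_step_meas))"
  by (intro prob_space_PiM prob_space_bd_step_meas)

lemma nn_integral_PiM_nat_case:
  assumes "prob_space M" and f[measurable]: "f \<in> borel_measurable (PiM (UNIV::nat set) (\<lambda>_. M))"
  shows "(\<integral>\<^sup>+w. f w \<partial>PiM UNIV (\<lambda>_. M)) = (\<integral>\<^sup>+s. \<integral>\<^sup>+w. f (case_nat s w) \<partial>PiM UNIV (\<lambda>_. M) \<partial>M)"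
proof -
  interpret M: prob_space M by fact
  interpret sequence_space M ..
  have "(\<integral>\<^sup>+w. f w \<partial>S) = (\<integral>\<^sup>+w. f w \<partial>distr (M \<Otimes>\<^sub>M S) S (\<lambda>(s, \<omega>). case_nat s \<omega>))"
    unfolding PiM_iter ..
  also have "\<dots> = (\<integral>\<^sup>+x. f (case_nat (fst x) (snd x)) \<partial>(M \<Otimes>\<^sub>M S))"
    by (subst nn_integral_distr) (auto simp: split_beta')
  also have "\<dots> = (\<integral>\<^sup>+s. \<integral>\<^sup>+w. f (case_nat s w) \<partial>S \<partial>M)"
    by (subst nn_integral_fst[symmetric]) auto
  finally show ?thesis .
qed

lemma nn_integral_exp_meas_shift:
  assumes l: "l > 0" and r: "r \<ge> 0" and f[measurable]: "f \<in> borel_measurable borel"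
  shows "(\<integral>\<^sup>+t. (if t < r then 0 else f (t - r)) \<partial>exp_meas l) = exp (- l * r) * (\<integral>\<^sup>+t. f t \<partial>exp_meas l)"
proof -
  have "(\<integral>\<^sup>+t. (if t < r then 0 else f (t - r)) \<partial>exp_meas l) =
     (\<integral>\<^sup>+t. ennreal (exponential_density l t) * (if t < r then 0 else f (t - r)) \<partial>lborel)"
    unfolding exp_meas_def by (subst nn_integral_density) auto
  also have "\<dots> = (\<integral>\<^sup>+t. ennreal (exponential_density l (r + t)) * (if r + t < r then 0 else f (r + t - r)) \<partial>lborel)"
    by (subst lborel_distr_plus[symmetric, of r]) (simp add: nn_integral_distr)
  also have "\<dots> = (\<integral>\<^sup>+t. ennreal (exp (- l * r)) * (ennreal (exponential_density l t) * f t) \<partial>lborel)"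
  proof (intro nn_integral_cong)
    fix t :: real
    show "ennreal (exponential_density l (r + t)) * (if r + t < r then 0 else f (r + t - r)) =
      ennreal (exp (- l * r)) * (ennreal (exponential_density l t) * f t)"
    proof (cases "t < 0")
      case False
      then have "exponential_density l (r + t) = exp (- l * r) * exponential_density l t"
        using r by (simp add: exponential_density_def mult_exp_exp algebra_simps)
      then have "ennreal (exponential_density l (r + t)) = ennreal (exp (- l * r)) * ennreal (exponential_density l t)"
        by (simp add: ennreal_mult')
      then show ?thesis using False by (simp add: mult.assoc)
    qed (simp add: exponential_density_def)
  qed
  also have "\<dots> = exp (- l * r) * (\<integral>\<^sup>+t. f t \<partial>exp_meas l)"
    unfolding exp_meas_def by (subst nn_integral_cmult) (auto simp: nn_integral_density)
  finally show ?thesis .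
qed

lemma AE_exp_meas_nonneg: "l > 0 \<Longrightarrow> AE e in exp_meas l. 0 \<le> e"
  unfolding exp_meas_def
  by (subst AE_density) (auto simp: exponential_density_def)

lemma nn_integral_exp_meas_Laplace:
  assumes "l > 0" "\<theta> \<ge> 0"
  shows "(\<integral>\<^sup>+e. ennreal (exp (- \<theta> * e)) \<partial>exp_meas l) = ennreal (l / (l + \<theta>))"
proof -
  have "(\<integral>\<^sup>+e. ennreal (exp (- \<theta> * e)) \<partial>exp_meas l) =
    (\<integral>\<^sup>+e. ennreal (exponential_density l e) * ennreal (exp (- \<theta> * e)) \<partial>lborel)"
    unfolding exp_meas_def by (subst nn_integral_density) auto
  also have "\<dots> = (\<integral>\<^sup>+e. ennreal (l / (l + \<theta>)) * ennreal (exponential_density (l + \<theta>) e) \<partial>lborel)"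
  proof (intro nn_integral_cong)
    fix e :: real
    have "exponential_density l e * exp (- \<theta> * e) = l / (l + \<theta>) * exponential_density (l + \<theta>) e"
    proof (cases "e < 0")
      case False
      have "exp (- e * (l + \<theta>)) = exp (- e * l) * exp (- \<theta> * e)"
        unfolding mult_exp_exp by (simp add: algebra_simps)
      then show ?thesis using False assms by (simp add: exponential_density_def)
    qed (simp add: exponential_density_def)
    then show "ennreal (exponential_density l e) * ennreal (exp (- \<theta> * e)) =
        ennreal (l / (l + \<theta>)) * ennreal (exponential_density (l + \<theta>) e)"
      using assms by (simp add: ennreal_mult'[symmetric] ennreal_mult''[symmetric])
  qed
  also have "\<dots> = ennreal (l / (l + \<theta>)) * emeasure (exp_meas (l + \<theta>)) UNIV"
    unfolding exp_meas_def by (subst nn_integral_cmult) (auto simp: emeasure_density)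
  also have "emeasure (exp_meas (l + \<theta>)) UNIV = 1"
    using prob_space.emeasure_space_1[OF prob_space_exp_meas[of "l + \<theta>"]] assms by simp
  finally show ?thesis by simp
qed

lemma nn_integral_one_minus:
  assumes "prob_space M" and [measurable]: "f \<in> borel_measurable M"
    and f: "AE x in M. 0 \<le> f x \<and> f x \<le> 1" and I: "(\<integral>\<^sup>+x. ennreal (f x) \<partial>M) = ennreal c" "0 \<le> c"
  shows "(\<integral>\<^sup>+x. ennreal (1 - f x) \<partial>M) = ennreal (1 - c)"
proof -
  interpret prob_space M by fact
  have "(\<integral>\<^sup>+x. ennreal (1 - f x) \<partial>M) + (\<integral>\<^sup>+x. ennreal (f x) \<partial>M) = (\<integral>\<^sup>+x. ennreal (1 - f x) + ennreal (f x) \<partial>M)"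
    by (subst nn_integral_add) auto
  also have "\<dots> = (\<integral>\<^sup>+x. 1 \<partial>M)"
  proof (intro nn_integral_cong_AE)
    show "AE x in M. ennreal (1 - f x) + ennreal (f x) = 1"
      using f by eventually_elim (simp add: ennreal_plus[symmetric] del: ennreal_plus)
  qed
  finally have "(\<integral>\<^sup>+x. ennreal (1 - f x) \<partial>M) + (\<integral>\<^sup>+x. ennreal (f x) \<partial>M) = (\<integral>\<^sup>+x. 1 \<partial>M)" .
  then have *: "(\<integral>\<^sup>+x. ennreal (1 - f x) \<partial>M) + ennreal c = 1"
    using I by (simp add: emeasure_space_1)
  then have "(\<integral>\<^sup>+x. ennreal (1 - f x) \<partial>M) = 1 - ennreal c"
    by (metis ennreal_add_diff_cancel_right ennreal_neq_top)
  then show ?thesis using ennreal_minus[OF I(2), of 1] by simp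
qed

lemma nn_integral_unif_split:
  assumes "0 \<le> p" "p \<le> (1::real)"
  shows "(\<integral>\<^sup>+U. (if U < p then A else B) \<partial>uniform_measure lborel {0..1}) = ennreal p * A + ennreal (1 - p) * B"
proof -
  let ?M = "uniform_measure lborel {0..1::real}"
  have "(\<integral>\<^sup>+U. (if U < p then A else B) \<partial>?M) = (\<integral>\<^sup>+U. A * indicator {..<p} U + B * indicator {p..} U \<partial>?M)"
    by (intro nn_integral_cong) (auto simp: indicator_def)
  also have "\<dots> = A * emeasure ?M {..<p} + B * emeasure ?M {p..}"
    by (subst nn_integral_add) (auto simp: nn_integral_cmult)
  also have "emeasure ?M {..<p} = ennreal p"
  proof -
    have "{0..1} \<inter> {..<p} = {0..<p}" using assms by auto
    then show ?thesis using assms by (subst emeasure_uniform_measure) (simp_all add: divide_ennreal_def)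
  qed
  also have "emeasure ?M {p..} = ennreal (1 - p)"
  proof -
    have "{0..1} \<inter> {p..} = {p..1}" using assms by auto
    then show ?thesis using assms by (subst emeasure_uniform_measure) (simp_all add: divide_ennreal_def)
  qed
  finally show ?thesis by (simp add: mult.commute)
qed

definition bd_exp_pgf :: "real \<Rightarrow> real \<Rightarrow> real \<Rightarrow> real \<Rightarrow> nat \<Rightarrow> ennreal" where
  "bd_exp_pgf x a b l y = (\<integral>\<^sup>+w. \<integral>\<^sup>+t. ennreal (bd_pgf_val x a b y w t) \<partial>exp_meas l \<partial>PiM UNIV (\<lambda>_. bd_step_meas))"

lemma bd_exp_pgf_le_1:
  assumes "0 \<le> x" "x \<le> 1" "l > 0"
  shows "bd_exp_pgf x a b l y \<le> 1"
proof -
  interpret E: prob_space "exp_meas l" using assms by (intro prob_space_exp_meas)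
  interpret W: prob_space "PiM UNIV (\<lambda>_::nat. bd_step_meas)" by (rule prob_space_bd_rand)
  have "bd_exp_pgf x a b l y \<le> (\<integral>\<^sup>+w. \<integral>\<^sup>+t. 1 \<partial>exp_meas l \<partial>PiM UNIV (\<lambda>_::nat. bd_step_meas))"
    unfolding bd_exp_pgf_def using bd_pgf_val_bounds[OF assms(1,2)] by (intro nn_integral_mono) (auto simp: ennreal_le_1)
  also have "\<dots> = 1" by (simp add: E.emeasure_space_1[simplified] W.emeasure_space_1)
  finally show ?thesis .
qed

lemma bd_exp_pgf_0: "l > 0 \<Longrightarrow> bd_exp_pgf x a b l 0 = 1"
proof -
  assume "l > 0"
  then interpret E: prob_space "exp_meas l" by (intro prob_space_exp_meas)
  interpret W: prob_space "PiM UNIV (\<lambda>_::nat. bd_step_meas)" by (rule prob_space_bd_rand)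
  show ?thesis unfolding bd_exp_pgf_def bd_pgf_val_0
    by (simp add: E.emeasure_space_1[simplified] W.emeasure_space_1)
qed

lemma nn_integral_bd_pgf_val_shift:
  assumes x: "0 \<le> x" "x \<le> 1" and "y > 0" "a + b > 0" and l: "l > 0" and s: "fst s \<ge> 0"
  defines "r \<equiv> fst s / (real y * (a + b))"
  shows "(\<integral>\<^sup>+w. \<integral>\<^sup>+t. ennreal (bd_pgf_val x a b y (case_nat s w) t) \<partial>exp_meas l \<partial>PiM UNIV (\<lambda>_. bd_step_meas)) =
    ennreal (x ^ y) * ennreal (1 - exp (- l * r)) + ennreal (exp (- l * r)) * bd_exp_pgf x a b l (bd_step a b y s)"
proof -
  interpret E: prob_space "exp_meas l" using l by (intro prob_space_exp_meas)
  interpret W: prob_space "PiM UNIV (\<lambda>_::nat. bd_step_meas)" by (rule prob_space_bd_rand)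
  have r: "r \<ge> 0" unfolding r_def using assms by auto
  have lt: "(\<integral>\<^sup>+t. indicator {..<r} t \<partial>exp_meas l) = ennreal (1 - exp (- l * r))"
  proof -
    have "(\<integral>\<^sup>+t. ennreal (indicator {r..} t) \<partial>exp_meas l) = (\<integral>\<^sup>+t. (if t < r then 0 else 1) \<partial>exp_meas l)"
      by (intro nn_integral_cong) (auto simp: indicator_def)
    also have "\<dots> = ennreal (exp (- l * r))"
      using nn_integral_exp_meas_shift[OF l r, of "\<lambda>_. 1"] E.emeasure_space_1 by simp
    finally have "(\<integral>\<^sup>+t. ennreal (1 - indicator {r..} t) \<partial>exp_meas l) = ennreal (1 - exp (- l * r))"
      by (intro nn_integral_one_minus E.prob_space_axioms) (auto simp: indicator_def)
    moreover have "(\<integral>\<^sup>+t. ennreal (1 - indicator {r..} t) \<partial>exp_meas l) = (\<integral>\<^sup>+t. indicator {..<r} t \<partial>exp_meas l)"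
      by (intro nn_integral_cong) (auto simp: indicator_def)
    ultimately show ?thesis by simp
  qed
  have "(\<integral>\<^sup>+t. ennreal (bd_pgf_val x a b y (case_nat s w) t) \<partial>exp_meas l) =
    ennreal (x ^ y) * ennreal (1 - exp (- l * r)) +
    ennreal (exp (- l * r)) * (\<integral>\<^sup>+t. ennreal (bd_pgf_val x a b (bd_step a b y s) w t) \<partial>exp_meas l)"
    if w: "w \<in> space (PiM UNIV (\<lambda>_::nat. bd_step_meas))" for w
  proof -
    have [measurable]: "(\<lambda>t. bd_pgf_val x a b y' w t) \<in> borel_measurable borel" for y'
      using measurable_Pair2[OF measurable_bd_pgf_val w] by simp
    have "(\<integral>\<^sup>+t. ennreal (bd_pgf_val x a b y (case_nat s w) t) \<partial>exp_meas l) =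
      (\<integral>\<^sup>+t. ennreal (x ^ y) * indicator {..<r} t +
        (if t < r then 0 else ennreal (bd_pgf_val x a b (bd_step a b y s) w (t - r))) \<partial>exp_meas l)"
      using assms by (intro nn_integral_cong) (auto simp: bd_pgf_val_shift indicator_def)
    also have "\<dots> = ennreal (x ^ y) * (\<integral>\<^sup>+t. indicator {..<r} t \<partial>exp_meas l) +
      (\<integral>\<^sup>+t. (if t < r then 0 else ennreal (bd_pgf_val x a b (bd_step a b y s) w (t - r))) \<partial>exp_meas l)"
      by (subst nn_integral_add, simp, measurable) (simp add: nn_integral_cmult)
    also note lt
    also have "(\<integral>\<^sup>+t. (if t < r then 0 else ennreal (bd_pgf_val x a b (bd_step a b y s) w (t - r))) \<partial>exp_meas l) =
      exp (- l * r) * (\<integral>\<^sup>+t. ennreal (bd_pgf_val x a b (bd_step a b y s) w t) \<partial>exp_meas l)"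
      by (rule nn_integral_exp_meas_shift[OF l r]) measurable
    finally show ?thesis .
  qed
  then have "(\<integral>\<^sup>+w. \<integral>\<^sup>+t. ennreal (bd_pgf_val x a b y (case_nat s w) t) \<partial>exp_meas l \<partial>PiM UNIV (\<lambda>_. bd_step_meas)) =
    (\<integral>\<^sup>+w. ennreal (x ^ y) * ennreal (1 - exp (- l * r)) +
    ennreal (exp (- l * r)) * (\<integral>\<^sup>+t. ennreal (bd_pgf_val x a b (bd_step a b y s) w t) \<partial>exp_meas l) \<partial>PiM UNIV (\<lambda>_. bd_step_meas))"
    by (intro nn_integral_cong) auto
  also have "\<dots> = ennreal (x ^ y) * ennreal (1 - exp (- l * r)) + ennreal (exp (- l * r)) * bd_exp_pgf x a b l (bd_step a b y s)"
    unfolding bd_exp_pgf_def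
    by (subst nn_integral_add, simp, measurable) (simp add: nn_integral_cmult W.emeasure_space_1)
  finally show ?thesis .
qed

lemma bd_exp_pgf_rec:
  assumes x: "0 \<le> x" "x \<le> 1" and y: "y > 0" and ab: "a > 0" "b \<ge> 0" and l: "l > 0"
  defines "q \<equiv> a + b"
  shows "bd_exp_pgf x a b l y =
    ennreal (l / (real y * q + l)) * ennreal (x ^ y) + ennreal (real y * q / (real y * q + l)) *
      (ennreal (a / q) * bd_exp_pgf x a b l (y + 1) + ennreal (b / q) * bd_exp_pgf x a b l (y - 1))"
proof -
  interpret E: prob_space "exp_meas l" using l by (intro prob_space_exp_meas)
  interpret E1: prob_space "exp_meas 1" by (intro prob_space_exp_meas) simp
  interpret Un: prob_space "uniform_measure lborel {0..1::real}" by (rule prob_space_unif)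
  interpret P: pair_prob_space "exp_meas 1" "uniform_measure lborel {0..1::real}" ..
  interpret W: prob_space "PiM UNIV (\<lambda>_::nat. bd_step_meas)" by (rule prob_space_bd_rand)
  define F where "F = bd_exp_pgf x a b l"
  define c where "c = real y * q"
  have q: "q > 0" "q \<noteq> 0" "c > 0" using ab y by (auto simp: q_def c_def)
  have [measurable]: "(\<lambda>s. F (bd_step a b y s)) \<in> borel_measurable bd_step_meas"
    unfolding bd_step_def by measurable
  have "F y = (\<integral>\<^sup>+s. \<integral>\<^sup>+w. \<integral>\<^sup>+t. ennreal (bd_pgf_val x a b y (case_nat s w) t) \<partial>exp_meas l \<partial>PiM UNIV (\<lambda>_. bd_step_meas) \<partial>bd_step_meas)"
    unfolding F_def bd_exp_pgf_def
    by (rule nn_integral_PiM_nat_case[OF prob_space_bd_step_meas]) measurable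
  also have "\<dots> = (\<integral>\<^sup>+s. ennreal (x ^ y) * ennreal (1 - exp (- l * (fst s / c))) +
      ennreal (exp (- l * (fst s / c))) * F (bd_step a b y s) \<partial>bd_step_meas)"
  proof (rule nn_integral_cong_AE)
    have "AE s in bd_step_meas. 0 \<le> fst s"
      by (rule P.AE_pair_measure, measurable) (auto intro!: AE_exp_meas_nonneg elim!: eventually_mono)
    then show "AE s in bd_step_meas. (\<integral>\<^sup>+w. \<integral>\<^sup>+t. ennreal (bd_pgf_val x a b y (case_nat s w) t) \<partial>exp_meas l \<partial>PiM UNIV (\<lambda>_. bd_step_meas)) =
       ennreal (x ^ y) * ennreal (1 - exp (- l * (fst s / c))) + ennreal (exp (- l * (fst s / c))) * F (bd_step a b y s)"
      unfolding F_def c_def q_def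
      by (rule AE_mp) (intro AE_I2 impI nn_integral_bd_pgf_val_shift, use assms in auto)
  qed
  also have "\<dots> = (\<integral>\<^sup>+e. \<integral>\<^sup>+U. ennreal (x ^ y) * ennreal (1 - exp (- l * (e / c))) +
      ennreal (exp (- l * (e / c))) * F (bd_step a b y (e, U)) \<partial>uniform_measure lborel {0..1} \<partial>exp_meas 1)"
    by (subst Un.nn_integral_fst[symmetric]) auto
  also have "\<dots> = (\<integral>\<^sup>+e. ennreal (x ^ y) * ennreal (1 - exp (- l * (e / c))) +
      ennreal (exp (- l * (e / c))) * (ennreal (a / q) * F (y + 1) + ennreal (b / q) * F (y - 1)) \<partial>exp_meas 1)"
  proof (intro nn_integral_cong)
    fix e :: real
    have "(\<integral>\<^sup>+U. F (bd_step a b y (e, U)) \<partial>uniform_measure lborel {0..1}) =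
      (\<integral>\<^sup>+U. (if U < a / q then F (y + 1) else F (y - 1)) \<partial>uniform_measure lborel {0..1})"
      using y q by (intro nn_integral_cong) (auto simp: bd_step_def q_def)
    also have "\<dots> = ennreal (a / q) * F (y + 1) + ennreal (1 - a / q) * F (y - 1)"
      using ab q by (intro nn_integral_unif_split) (auto simp: q_def)
    also have "1 - a / q = b / q" using q by (simp add: field_simps) (simp add: q_def)
    finally have *: "(\<integral>\<^sup>+U. F (bd_step a b y (e, U)) \<partial>uniform_measure lborel {0..1}) =
       ennreal (a / q) * F (y + 1) + ennreal (b / q) * F (y - 1)" .
    have [measurable]: "(\<lambda>U. F (bd_step a b y (e, U))) \<in> borel_measurable borel"
      unfolding bd_step_def snd_conv by measurable
    show "(\<integral>\<^sup>+U. ennreal (x ^ y) * ennreal (1 - exp (- l * (e / c))) +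
      ennreal (exp (- l * (e / c))) * F (bd_step a b y (e, U)) \<partial>uniform_measure lborel {0..1}) =
      ennreal (x ^ y) * ennreal (1 - exp (- l * (e / c))) +
      ennreal (exp (- l * (e / c))) * (ennreal (a / q) * F (y + 1) + ennreal (b / q) * F (y - 1))"
      by (subst nn_integral_add, simp, measurable)
         (simp add: nn_integral_cmult * Un.emeasure_space_1[simplified])
  qed
  also have "\<dots> = ennreal (x ^ y) * (\<integral>\<^sup>+e. ennreal (1 - exp (- (l / c) * e)) \<partial>exp_meas 1) +
     (\<integral>\<^sup>+e. ennreal (exp (- (l / c) * e)) \<partial>exp_meas 1) * (ennreal (a / q) * F (y + 1) + ennreal (b / q) * F (y - 1))"
    by (subst nn_integral_add) (simp_all add: nn_integral_cmult nn_integral_multc)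
  also have "(\<integral>\<^sup>+e. ennreal (exp (- (l / c) * e)) \<partial>exp_meas 1) = ennreal (1 / (1 + l / c))"
    using l q by (intro nn_integral_exp_meas_Laplace) auto
  also have "(\<integral>\<^sup>+e. ennreal (1 - exp (- (l / c) * e)) \<partial>exp_meas 1) = ennreal (1 - 1 / (1 + l / c))"
  proof (rule nn_integral_one_minus[OF E1.prob_space_axioms])
    show "AE e in exp_meas 1. 0 \<le> exp (- (l / c) * e) \<and> exp (- (l / c) * e) \<le> 1"
      using AE_exp_meas_nonneg[of 1] l q by (auto elim!: eventually_mono)
    show "(\<integral>\<^sup>+e. ennreal (exp (- (l / c) * e)) \<partial>exp_meas 1) = ennreal (1 / (1 + l / c))"
      using l q by (intro nn_integral_exp_meas_Laplace) auto
  qed (use l q in auto)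
  also have "1 - 1 / (1 + l / c) = l / (c + l)" using l q by (simp add: field_simps)
  also have "1 / (1 + l / c) = c / (c + l)" using l q by (simp add: field_simps)
  finally show ?thesis unfolding F_def c_def by (simp add: mult.commute)
qed

text \<open>The function 1 + y is a strict Lyapunov function for the recursion, so the difference of two
  bounded solutions, divided by 1 + y, cannot attain a positive maximum.\<close>
lemma bd_recursion_unique:
  fixes f g X :: "nat \<Rightarrow> real"
  assumes l: "a - b > 0" and b: "b \<ge> 0"
    and bound: "\<And>y. \<bar>f y - g y\<bar> \<le> C" and zero: "f 0 = g 0"
    and f: "\<And>y. y > 0 \<Longrightarrow> f y * ((a - b) + real y * (a + b)) = X y + real y * (a * f (y + 1) + b * f (y - 1))"
    and g: "\<And>y. y > 0 \<Longrightarrow> g y * ((a - b) + real y * (a + b)) = X y + real y * (a * g (y + 1) + b * g (y - 1))"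
  shows "f y = g y"
proof (rule ccontr)
  assume ne: "f y \<noteq> g y"
  define d where "d y = \<bar>f y - g y\<bar>" for y
  define r where "r y = d y / (1 + real y)" for y
  have d0: "d y \<ge> 0" for y by (simp add: d_def)
  have "r y > 0" using ne by (simp add: r_def d_def)
  obtain n where n: "real n > C / r y" using reals_Archimedean2 by blast
  have small: "r k < r y" if "k > n" for k
  proof -
    have "C / r y < 1 + real k" using n that by simp
    then have "C < r y * (1 + real k)" using \<open>r y > 0\<close> by (simp add: field_simps)
    then have "d k < r y * (1 + real k)" using bound[of k] by (simp add: d_def)
    then show ?thesis by (simp add: r_def field_simps)
  qed
  then have "y \<le> n" by (meson less_irrefl not_le_imp_less)
  have "Max (r ` {..n}) \<in> r ` {..n}" by (intro Max_in) auto
  then obtain k where k0: "Max (r ` {..n}) = r k" "k \<in> {..n}" by (rule imageE)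
  have k: "k \<le> n" "\<And>i. i \<le> n \<Longrightarrow> r i \<le> r k" using k0(2) by (auto simp flip: k0(1))
  have rk: "r k \<ge> r y" using k \<open>y \<le> n\<close> by auto
  have mx: "r i \<le> r k" for i
    using k(2)[of i] small[of i] rk by (cases "i \<le> n") auto
  have "k > 0" using rk \<open>r y > 0\<close> zero by (cases k) (auto simp: r_def d_def)
  have up: "d i \<le> r k * (1 + real i)" for i
    using mx[of i] by (simp add: r_def field_simps)
  have dk: "d k = r k * (1 + real k)" by (simp add: r_def)
  have fg: "(f k - g k) * ((a - b) + real k * (a + b)) = real k * (a * (f (k + 1) - g (k + 1)) + b * (f (k - 1) - g (k - 1)))"
    using f[OF \<open>k > 0\<close>] g[OF \<open>k > 0\<close>] by (simp add: algebra_simps)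
  have pos: "(a - b) + real k * (a + b) > 0" using l b by (intro add_pos_nonneg) auto
  have "d k * ((a - b) + real k * (a + b)) = \<bar>(f k - g k) * ((a - b) + real k * (a + b))\<bar>"
    using pos by (simp add: d_def abs_mult)
  also have "\<dots> \<le> real k * (a * d (k + 1) + b * d (k - 1))"
  proof -
    have "\<bar>a * (f (k + 1) - g (k + 1)) + b * (f (k - 1) - g (k - 1))\<bar> \<le> a * d (k + 1) + b * d (k - 1)"
      using l b abs_triangle_ineq[of "a * (f (k + 1) - g (k + 1))" "b * (f (k - 1) - g (k - 1))"]
      by (simp add: d_def abs_mult)
    then show ?thesis unfolding fg by (simp add: abs_mult mult_left_mono)
  qed
  also have "\<dots> \<le> real k * (a * (r k * (1 + real (k + 1))) + b * (r k * (1 + real (k - 1))))"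
    using l b by (intro mult_left_mono add_mono up) auto
  also have "real (k - 1) = real k - 1" using \<open>k > 0\<close> by simp
  finally have "r k * ((1 + real k) * ((a - b) + real k * (a + b))) \<le> r k * (real k * (a * (2 + real k) + b * real k))"
    unfolding dk by (simp add: algebra_simps)
  moreover have "r k > 0" using rk \<open>r y > 0\<close> by simp
  ultimately have "(1 + real k) * ((a - b) + real k * (a + b)) \<le> real k * (a * (2 + real k) + b * real k)"
    by simp
  then show False using l by (simp add: algebra_simps)
qed

lemma has_integral_unit_interval_DERIV:
  fixes F :: "real \<Rightarrow> real"
  assumes "\<And>s. 0 \<le> s \<Longrightarrow> s \<le> 1 \<Longrightarrow> (F has_real_derivative f s) (at s)"
  shows "(f has_integral (F 1 - F 0)) {0..1}"
proof (rule fundamental_theorem_of_calculus)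
  fix s :: real assume "s \<in> {0..1}"
  then show "(F has_vector_derivative f s) (at s within {0..1})"
    unfolding has_real_derivative_iff_has_vector_derivative[symmetric]
    using has_field_derivative_at_within[OF assms] by auto
qed simp

text \<open>With z = 1 - x and s = exp (- l t), the function \<open>1 - bd_phi a l z\<close> is the generating function at
  x of the birth-death process with rates a and a - l at time t, and \<open>bd_I\<close> is the primitive of
  \<open>bd_phi\<close> that vanishes at s = 1. The explicit primitive is the reason for excluding l = a z.\<close>
definition bd_phi :: "real \<Rightarrow> real \<Rightarrow> real \<Rightarrow> real \<Rightarrow> real" where
  "bd_phi a l z s = l * z / (a * z + (l - a * z) * s)"

definition bd_I :: "real \<Rightarrow> real \<Rightarrow> real \<Rightarrow> real \<Rightarrow> real" where
  "bd_I a l z s = l * z / (l - a * z) * ln ((a * z + (l - a * z) * s) / l)"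

locale bd_params =
  fixes a l z :: real
  assumes l: "0 < l" "l \<le> a" and z: "0 < z" "z \<le> 1" and ne: "l \<noteq> a * z"
begin

lemma a_pos: "a > 0" using l by simp

lemma den_ge:
  assumes "0 \<le> s" "s \<le> 1"
  shows "min (a * z) l \<le> a * z + (l - a * z) * s"
proof -
  have "a * z + (l - a * z) * s = (1 - s) * (a * z) + s * l" by (simp add: algebra_simps)
  moreover have "(1 - s) * (min (a * z) l) + s * (min (a * z) l) \<le> (1 - s) * (a * z) + s * l"
    using assms by (intro add_mono mult_left_mono) auto
  ultimately show ?thesis by (simp add: algebra_simps)
qed

lemma min_pos: "min (a * z) l > 0" using l z a_pos by auto

lemma den_pos: "0 \<le> s \<Longrightarrow> s \<le> 1 \<Longrightarrow> 0 < a * z + (l - a * z) * s"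
  using den_ge min_pos by fastforce

lemma phi_bounds:
  assumes "0 \<le> s" "s \<le> 1"
  shows "0 < bd_phi a l z s" "bd_phi a l z s \<le> 1"
proof -
  show "0 < bd_phi a l z s" unfolding bd_phi_def using den_pos[OF assms] l z by simp
  have "l * z \<le> a * z" "l * z \<le> l * 1" using l z by (auto intro!: mult_right_mono mult_left_mono)
  then have "l * z \<le> a * z + (l - a * z) * s" using den_ge[OF assms] by linarith
  then show "bd_phi a l z s \<le> 1" unfolding bd_phi_def using den_pos[OF assms] by simp
qed

lemma phi_1: "bd_phi a l z 1 = z" using l by (simp add: bd_phi_def)

lemma I_1: "bd_I a l z 1 = 0" using l by (simp add: bd_I_def)

lemma DERIV_I:
  assumes "0 \<le> s" "s \<le> 1"
  shows "(bd_I a l z has_real_derivative bd_phi a l z s) (at s)"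
proof -
  define D where "D = l - a * z"
  have nz: "D \<noteq> 0" "a * z + D * s > 0" using ne den_pos[OF assms] by (auto simp: D_def)
  have "((\<lambda>s. ln ((a * z + D * s) / l)) has_real_derivative (D / l) / ((a * z + D * s) / l)) (at s)"
    using nz l by (auto intro!: derivative_eq_intros)
  then have "((\<lambda>s. l * z / D * ln ((a * z + D * s) / l)) has_real_derivative l * z / D * ((D / l) / ((a * z + D * s) / l))) (at s)"
    by (rule DERIV_cmult)
  moreover have "l * z / D * ((D / l) / ((a * z + D * s) / l)) = l * z / (a * z + D * s)"
    using nz l by simp
  ultimately show ?thesis unfolding bd_I_def bd_phi_def D_def by simp
qed

lemma DERIV_phi:
  assumes "0 \<le> s" "s \<le> 1"
  shows "(bd_phi a l z has_real_derivative - ((l - a * z) / (l * z)) * (bd_phi a l z s)\<^sup>2) (at s)"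
proof -
  have [simp]: "a * z + (l - a * z) * s \<noteq> 0" using den_pos[OF assms] by auto
  have [simp]: "l \<noteq> 0" "z \<noteq> 0" using l z by auto
  have "(bd_phi a l z has_real_derivative - (l * z * (l - a * z)) / (a * z + (l - a * z) * s)\<^sup>2) (at s)"
    unfolding bd_phi_def by (auto intro!: derivative_eq_intros simp: power2_eq_square)
  moreover have "- (l * z * (l - a * z)) / (a * z + (l - a * z) * s)\<^sup>2 = - ((l - a * z) / (l * z)) * (bd_phi a l z s)\<^sup>2"
    unfolding bd_phi_def by (simp add: power_divide power2_eq_square)
  ultimately show ?thesis by simp
qed

lemma phi_ode:
  assumes "0 \<le> s" "s \<le> 1"
  shows "l * s * ((l - a * z) / (l * z) * (bd_phi a l z s)\<^sup>2) = (l - a * bd_phi a l z s) * bd_phi a l z s"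
proof -
  have "l \<noteq> 0" "z \<noteq> 0" using l z by auto
  have "bd_phi a l z s * (a * z + (l - a * z) * s) = l * z"
    unfolding bd_phi_def using den_pos[OF assms] by simp
  then have "bd_phi a l z s * (l - a * z) * s = (l - a * bd_phi a l z s) * z" by (simp add: algebra_simps)
  then have "(bd_phi a l z s * (l - a * z) * s) / z = l - a * bd_phi a l z s" using \<open>z \<noteq> 0\<close> by simp
  moreover have "l * s * ((l - a * z) / (l * z) * (bd_phi a l z s)\<^sup>2) =
      (bd_phi a l z s * (l - a * z) * s) / z * bd_phi a l z s"
    using \<open>l \<noteq> 0\<close> by (simp add: power2_eq_square)
  ultimately show ?thesis by simp
qed

lemma I_le_0:
  assumes "0 \<le> s" "s \<le> 1"
  shows "bd_I a l z s \<le> 0"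
proof -
  have "bd_I a l z s \<le> bd_I a l z 1"
  proof (rule DERIV_nonneg_imp_nondecreasing[of s 1 "bd_I a l z"])
    fix t assume "s \<le> t" "t \<le> 1"
    then show "\<exists>y. (bd_I a l z has_real_derivative y) (at t) \<and> 0 \<le> y"
      using DERIV_I[of t] phi_bounds(1)[of t] assms by (meson less_imp_le order_trans)
  qed (use assms in auto)
  then show ?thesis by (simp add: I_1)
qed

definition bd_sol :: "nat \<Rightarrow> real" where
  "bd_sol y = integral {0..1} (\<lambda>s. (1 - bd_phi a l z s) ^ y)"

lemma continuous_phi: "continuous_on {0..1} (bd_phi a l z)"
  by (intro continuous_at_imp_continuous_on ballI) (use DERIV_isCont[OF DERIV_phi] in auto)

lemma has_integral_sol: "((\<lambda>s. (1 - bd_phi a l z s) ^ y) has_integral bd_sol y) {0..1}"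
  unfolding bd_sol_def
  by (intro integrable_integral integrable_continuous_interval continuous_intros continuous_phi)

lemma bd_sol_0: "bd_sol 0 = 1"
  unfolding bd_sol_def by simp

lemma bd_sol_bounds: "0 \<le> bd_sol y" "bd_sol y \<le> 1"
proof -
  show "0 \<le> bd_sol y"
    by (rule has_integral_nonneg[OF has_integral_sol]) (use phi_bounds in auto)
  have "bd_sol y \<le> bd_sol 0"
    by (rule has_integral_le[OF has_integral_sol has_integral_sol])
       (auto intro!: power_le_one simp: phi_bounds less_imp_le)
  then show "bd_sol y \<le> 1" by (simp add: bd_sol_0)
qed

lemma bd_sol_1: "bd_sol 1 = 1 + bd_I a l z 0"
proof -
  have "(bd_phi a l z has_integral (bd_I a l z 1 - bd_I a l z 0)) {0..1}"
    by (intro has_integral_unit_interval_DERIV DERIV_I)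
  then have "((\<lambda>s. 1 - bd_phi a l z s) has_integral (1 - (bd_I a l z 1 - bd_I a l z 0))) {0..1}"
    using has_integral_diff[OF has_integral_const_real[of "1::real" 0 1]] by simp
  then show ?thesis using has_integral_sol[of 1] has_integral_unique[of _ "bd_sol 1"] by (auto simp: I_1)
qed

lemma bd_sol_rec:
  assumes y: "y > 0"
  shows "bd_sol y * (l + real y * (a + (a - l))) = l * (1 - z) ^ y + real y * (a * bd_sol (y + 1) + (a - l) * bd_sol (y - 1))"
proof -
  define g where "g s = 1 - bd_phi a l z s" for s
  have Dg: "(g has_real_derivative (l - a * z) / (l * z) * (bd_phi a l z s)\<^sup>2) (at s)" if "0 \<le> s" "s \<le> 1" for s
    unfolding g_def using DERIV_phi[OF that] by (auto intro!: derivative_eq_intros)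
  have D: "((\<lambda>s. l * (s * g s ^ y)) has_real_derivative
      l * g s ^ y - real y * (a * g s ^ (y + 1) - (a + (a - l)) * g s ^ y + (a - l) * g s ^ (y - 1))) (at s)"
    if s: "0 \<le> s" "s \<le> 1" for s
  proof -
    let ?D = "(l - a * z) / (l * z) * (bd_phi a l z s)\<^sup>2"
    obtain y' where y': "y = Suc y'" using y gr0_implies_Suc by blast
    have "((\<lambda>s. l * (s * g s ^ y)) has_real_derivative l * (g s ^ y + s * (real y * g s ^ (y - 1) * ?D))) (at s)"
      using Dg[OF s] by (auto intro!: derivative_eq_intros simp: algebra_simps)
    moreover have "l * (g s ^ y + s * (real y * g s ^ (y - 1) * ?D)) = l * g s ^ y + real y * g s ^ (y - 1) * (l * s * ?D)"
      by (simp only: algebra_simps)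
    moreover have "l * s * ?D = - (a * (g s)\<^sup>2 - (a + (a - l)) * g s + (a - l))"
      unfolding phi_ode[OF s] g_def by (simp add: power2_eq_square algebra_simps)
    moreover have "real y * g s ^ (y - 1) * - (a * (g s)\<^sup>2 - (a + (a - l)) * g s + (a - l)) =
      - real y * (a * g s ^ (y + 1) - (a + (a - l)) * g s ^ y + (a - l) * g s ^ (y - 1))"
      unfolding y' by (simp add: power2_eq_square algebra_simps)
    ultimately show ?thesis by simp
  qed
  have "((\<lambda>s. l * g s ^ y - real y * (a * g s ^ (y + 1) - (a + (a - l)) * g s ^ y + (a - l) * g s ^ (y - 1)))
     has_integral l * (1 * g 1 ^ y) - l * (0 * g 0 ^ y)) {0..1}"
    by (intro has_integral_unit_interval_DERIV[where F = "\<lambda>s. l * (s * g s ^ y)"] D)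
  moreover have "((\<lambda>s. l * g s ^ y - real y * (a * g s ^ (y + 1) - (a + (a - l)) * g s ^ y + (a - l) * g s ^ (y - 1)))
     has_integral l * bd_sol y - real y * (a * bd_sol (y + 1) - (a + (a - l)) * bd_sol y + (a - l) * bd_sol (y - 1))) {0..1}"
    unfolding g_def by (intro has_integral_diff has_integral_add has_integral_mult_right has_integral_sol)
  ultimately have "l * (1 * g 1 ^ y) - l * (0 * g 0 ^ y) =
      l * bd_sol y - real y * (a * bd_sol (y + 1) - (a + (a - l)) * bd_sol y + (a - l) * bd_sol (y - 1))"
    by (rule has_integral_unique)
  then show ?thesis unfolding g_def phi_1 by (simp add: algebra_simps)
qed

end

lemma bd_exp_pgf_real_rec:
  assumes x: "0 \<le> x" "x \<le> 1" and y: "y > 0" and ab: "a > b" "b \<ge> 0"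
  defines "f \<equiv> \<lambda>y. enn2real (bd_exp_pgf x a b (a - b) y)"
  shows "f y * ((a - b) + real y * (a + b)) = (a - b) * x ^ y + real y * (a * f (y + 1) + b * f (y - 1))"
proof -
  have fin: "bd_exp_pgf x a b (a - b) k = ennreal (f k)" for k
    unfolding f_def using bd_exp_pgf_le_1[OF x, of "a - b" a b k] ab
    by (subst ennreal_enn2real) (auto simp: less_top[symmetric] top_unique)
  have f0: "f k \<ge> 0" for k by (simp add: f_def)
  let ?q = "a + b" let ?l = "a - b"
  have pos: "real y * ?q + ?l > 0" "?q > 0" using ab y by (auto intro!: add_nonneg_pos)
  have "ennreal (f y) = ennreal (?l / (real y * ?q + ?l) * x ^ y + real y * ?q / (real y * ?q + ?l) *
      (a / ?q * f (y + 1) + b / ?q * f (y - 1)))"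
    unfolding fin[symmetric]
    by (subst bd_exp_pgf_rec) (use x y ab f0 pos in \<open>auto simp: fin ennreal_mult'[symmetric] ennreal_plus[symmetric] simp del: ennreal_plus\<close>)
  then have "f y = ?l / (real y * ?q + ?l) * x ^ y + real y * ?q / (real y * ?q + ?l) *
      (a / ?q * f (y + 1) + b / ?q * f (y - 1))"
    by (subst (asm) ennreal_inj) (use f0 x ab pos in \<open>auto intro!: add_nonneg_nonneg\<close>)
  also have "\<dots> = (?l * x ^ y + real y * (a * f (y + 1) + b * f (y - 1))) / (real y * ?q + ?l)"
  proof -
    have "u / c * X + v * q / c * (a / q * A + b / q * B) = (u * X + v * (a * A + b * B)) / c"
      if "q \<noteq> 0" "c \<noteq> 0" for u c X v q A B :: real
      using that by (simp add: field_simps)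
    then show ?thesis using pos by simp
  qed
  finally show ?thesis using pos by (simp add: field_simps)
qed

lemma bd_exp_pgf_eq:
  assumes ab: "a > b" "b \<ge> 0" and x: "0 \<le> x" "x < 1" and ne: "a - b \<noteq> a * (1 - x)"
  shows "bd_exp_pgf x a b (a - b) 1 = ennreal (1 + bd_I a (a - b) (1 - x) 0)"
proof -
  interpret bd_params a "a - b" "1 - x" by unfold_locales (use assms in auto)
  let ?f = "\<lambda>y. enn2real (bd_exp_pgf x a b (a - b) y)"
  have le: "bd_exp_pgf x a b (a - b) y \<le> 1" for y using bd_exp_pgf_le_1[of x "a - b"] assms by simp
  have f1: "0 \<le> ?f y \<and> ?f y \<le> 1" for y
    using enn2real_mono[OF le, of y] by simp
  have "?f 1 = bd_sol 1"
  proof (rule bd_recursion_unique[where a = a and b = b and C = 1 and X = "\<lambda>y. (a - b) * x ^ y"])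
    show "\<bar>?f y - bd_sol y\<bar> \<le> 1" for y using f1[of y, THEN conjunct1] f1[of y, THEN conjunct2] bd_sol_bounds[of y] by linarith
    show "?f 0 = bd_sol 0" using assms by (simp add: bd_exp_pgf_0 bd_sol_0)
    show "bd_sol y * ((a - b) + real y * (a + b)) = (a - b) * x ^ y + real y * (a * bd_sol (y + 1) + b * bd_sol (y - 1))" if "y > 0" for y
      using bd_sol_rec[OF that] by simp
  qed (use assms bd_exp_pgf_real_rec in auto)
  moreover have "bd_exp_pgf x a b (a - b) 1 = ennreal (?f 1)"
    using le[of 1] by (subst ennreal_enn2real) (auto simp: less_top[symmetric] top_unique)
  ultimately show ?thesis using bd_sol_1 by simp
qed

lemma bd_exp_pgf_eq_1:
  assumes ab: "a > b" "b \<ge> 0"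
  shows "bd_exp_pgf 1 a b (a - b) 1 = 1"
proof -
  let ?f = "\<lambda>y. enn2real (bd_exp_pgf 1 a b (a - b) y)"
  have le: "bd_exp_pgf 1 a b (a - b) y \<le> 1" for y using bd_exp_pgf_le_1[of 1 "a - b"] assms by simp
  have f1: "0 \<le> ?f y \<and> ?f y \<le> 1" for y
    using enn2real_mono[OF le, of y] by simp
  have "?f 1 = 1"
  proof (rule bd_recursion_unique[where a = a and b = b and C = 1 and X = "\<lambda>y. (a - b) * 1 ^ y" and g = "\<lambda>_. 1"])
    show "\<bar>?f y - 1\<bar> \<le> 1" for y using f1[of y, THEN conjunct1] f1[of y, THEN conjunct2] by linarith
    show "?f y * ((a - b) + real y * (a + b)) = (a - b) * 1 ^ y + real y * (a * ?f (y + 1) + b * ?f (y - 1))" if "y > 0" for y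
      using bd_exp_pgf_real_rec[of 1 y b a] that ab by simp
  qed (use assms in \<open>auto simp: bd_exp_pgf_0 algebra_simps\<close>)
  moreover have "bd_exp_pgf 1 a b (a - b) 1 = ennreal (?f 1)"
    using le[of 1] by (subst ennreal_enn2real) (auto simp: less_top[symmetric] top_unique)
  ultimately show ?thesis by simp
qed

section \<open>The generalised Luria-Delbrueck distribution\<close>

lemma pgf_sums_nn_integral:
  assumes "prob_space M" and X[measurable]: "X \<in> measurable M (count_space (UNIV :: nat set))"
    and x: "0 \<le> x" and I: "(\<integral>\<^sup>+\<omega>. ennreal (x ^ X \<omega>) \<partial>M) = ennreal c" "0 \<le> c"
  shows "(\<lambda>m. measure M {\<omega> \<in> space M. X \<omega> = m} * x ^ m) sums c"
proof -
  interpret prob_space M by fact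
  have "(\<integral>\<^sup>+\<omega>. ennreal (x ^ X \<omega>) \<partial>M) = (\<integral>\<^sup>+\<omega>. (\<Sum>m. ennreal (x ^ m) * indicator {\<omega> \<in> space M. X \<omega> = m} \<omega>) \<partial>M)"
  proof (intro nn_integral_cong)
    fix \<omega> assume "\<omega> \<in> space M"
    then have "(\<Sum>m. ennreal (x ^ m) * indicator {\<omega> \<in> space M. X \<omega> = m} \<omega>) =
       (\<Sum>m\<in>{X \<omega>}. ennreal (x ^ m) * indicator {\<omega> \<in> space M. X \<omega> = m} \<omega>)"
      by (intro suminf_finite) (auto simp: indicator_def)
    then show "ennreal (x ^ X \<omega>) = (\<Sum>m. ennreal (x ^ m) * indicator {\<omega> \<in> space M. X \<omega> = m} \<omega>)"
      using \<open>\<omega> \<in> space M\<close> by simp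
  qed
  also have "\<dots> = (\<Sum>m. ennreal (x ^ m) * emeasure M {\<omega> \<in> space M. X \<omega> = m})"
    by (subst nn_integral_suminf) (simp_all add: nn_integral_cmult)
  also have "\<dots> = (\<Sum>m. ennreal (measure M {\<omega> \<in> space M. X \<omega> = m} * x ^ m))"
    using x by (simp add: emeasure_eq_measure ennreal_mult'[symmetric] mult.commute)
  finally have *: "(\<Sum>m. ennreal (measure M {\<omega> \<in> space M. X \<omega> = m} * x ^ m)) = ennreal c" using I by simp
  have nn: "0 \<le> measure M {\<omega> \<in> space M. X \<omega> = m} * x ^ m" for m using x by simp
  have s: "summable (\<lambda>m. measure M {\<omega> \<in> space M. X \<omega> = m} * x ^ m)"
    by (rule summable_suminf_not_top) (use nn * in auto)
  then have "ennreal (\<Sum>m. measure M {\<omega> \<in> space M. X \<omega> = m} * x ^ m) = ennreal c"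
    using suminf_ennreal2[OF nn s] * by simp
  then have "(\<Sum>m. measure M {\<omega> \<in> space M. X \<omega> = m} * x ^ m) = c"
    using suminf_nonneg[OF s nn] I(2) by simp
  then show ?thesis using s by (simp add: sums_iff)
qed

lemma nn_integral_PiM_prod_power:
  assumes "prob_space M" and f[measurable]: "f \<in> borel_measurable M"
  shows "(\<integral>\<^sup>+\<omega>. (\<Prod>k<K. f (\<omega> k)) \<partial>PiM (UNIV::nat set) (\<lambda>_. M)) = (\<integral>\<^sup>+s. f s \<partial>M) ^ K"
proof (induction K)
  interpret M: prob_space M by fact
  interpret sequence_space M ..
  case 0
  show ?case by (simp add: P.emeasure_space_1)
next
  case (Suc K)
  have "(\<integral>\<^sup>+\<omega>. (\<Prod>k<Suc K. f (\<omega> k)) \<partial>PiM (UNIV::nat set) (\<lambda>_. M)) =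
    (\<integral>\<^sup>+s. \<integral>\<^sup>+\<omega>. (\<Prod>k<Suc K. f (case_nat s \<omega> k)) \<partial>PiM (UNIV::nat set) (\<lambda>_. M) \<partial>M)"
    by (rule nn_integral_PiM_nat_case[OF assms(1)]) measurable
  also have "\<dots> = (\<integral>\<^sup>+s. \<integral>\<^sup>+\<omega>. f s * (\<Prod>k<K. f (\<omega> k)) \<partial>PiM (UNIV::nat set) (\<lambda>_. M) \<partial>M)"
    by (simp add: prod.lessThan_Suc_shift del: prod.lessThan_Suc)
  also have "\<dots> = (\<integral>\<^sup>+s. f s * (\<integral>\<^sup>+s. f s \<partial>M) ^ K \<partial>M)"
    unfolding Suc.IH[symmetric] by (intro nn_integral_cong nn_integral_cmult) measurable
  also have "\<dots> = (\<integral>\<^sup>+s. f s \<partial>M) ^ Suc K"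
    by (subst nn_integral_multc) auto
  finally show ?case .
qed

lemma nn_integral_poisson_power:
  assumes c: "c \<ge> 0" and A: "0 \<le> A"
  shows "(\<integral>\<^sup>+K. ennreal A ^ K \<partial>measure_pmf (poisson_or_zero c)) = ennreal (exp (- c * (1 - A)))"
proof (cases "c = 0")
  case False
  then have c: "c > 0" using c by simp
  have "(\<integral>\<^sup>+K. ennreal A ^ K \<partial>measure_pmf (poisson_or_zero c)) = (\<Sum>K. ennreal (pmf (poisson_pmf c) K) * ennreal A ^ K)"
    using c by (simp add: poisson_or_zero_def nn_integral_measure_pmf nn_integral_count_space_nat)
  also have "\<dots> = (\<Sum>K. ennreal (exp (- c) * ((c * A) ^ K /\<^sub>R fact K)))"
    using c A by (intro suminf_cong) (simp add: ennreal_power ennreal_mult'[symmetric] ennreal_mult''[symmetric] power_mult_distrib field_simps)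
  also have "\<dots> = ennreal (exp (- c) * exp (c * A))"
  proof -
    have "(\<lambda>K. exp (- c) * ((c * A) ^ K /\<^sub>R fact K)) sums (exp (- c) * exp (c * A))"
      by (intro sums_mult exp_converges)
    then show ?thesis
      using c A by (subst suminf_ennreal2) (auto simp: sums_iff)
  qed
  also have "exp (- c) * exp (c * A) = exp (- c * (1 - A))"
    unfolding mult_exp_exp by (simp add: algebra_simps)
  finally show ?thesis .
qed (simp add: poisson_or_zero_def)

lemma bd_rand_space_eq: "bd_rand_space = PiM UNIV (\<lambda>_. bd_step_meas)"
  by (simp add: bd_rand_space_def)

lemma measurable_bd_value [measurable]:
  "(\<lambda>x. bd_value a b (fst x) (snd x)) \<in> measurable (bd_rand_space \<Otimes>\<^sub>M exp_meas l) (count_space UNIV)"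
proof -
  have "sets (bd_rand_space \<Otimes>\<^sub>M exp_meas l) = sets (PiM UNIV (\<lambda>_::nat. bd_step_meas) \<Otimes>\<^sub>M borel)"
    unfolding bd_rand_space_eq by (intro sets_pair_measure_cong) (simp_all add: sets_exp_meas)
  from measurable_bd_chain_from_Least[of a b 1] show ?thesis
    unfolding bd_value_eq_from split_beta' measurable_cong_sets[OF \<open>sets _ = sets _\<close> refl] .
qed

lemma nn_integral_bd_value:
  assumes ab: "a > b" "b \<ge> 0" and x: "0 \<le> x" "x \<le> 1"
  shows "(\<integral>\<^sup>+v. ennreal (x ^ bd_value a b (fst v) (snd v)) \<partial>(bd_rand_space \<Otimes>\<^sub>M exp_meas (a - b))) =
     bd_exp_pgf x a b (a - b) 1"
proof -
  let ?M = "bd_rand_space \<Otimes>\<^sub>M exp_meas (a - b)"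
  interpret E: prob_space "exp_meas (a - b)" using ab by (intro prob_space_exp_meas) simp
  interpret W: prob_space "bd_rand_space" unfolding bd_rand_space_eq by (rule prob_space_bd_rand)
  interpret P: pair_prob_space "bd_rand_space" "exp_meas (a - b)" ..
  have sets: "sets ?M = sets (PiM UNIV (\<lambda>_::nat. bd_step_meas) \<Otimes>\<^sub>M borel)"
    unfolding bd_rand_space_eq by (intro sets_pair_measure_cong) (simp_all add: sets_exp_meas)
  have [measurable]: "(\<lambda>v. bd_pgf_val x a b y (fst v) (snd v)) \<in> borel_measurable ?M" for x y
    using measurable_bd_pgf_val[of x a b y] unfolding split_beta' measurable_cong_sets[OF sets refl] .
  have pair: "bd_exp_pgf x a b (a - b) 1 = (\<integral>\<^sup>+v. ennreal (bd_pgf_val x a b 1 (fst v) (snd v)) \<partial>?M)" for x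
    unfolding bd_exp_pgf_def bd_rand_space_eq[symmetric]
    by (subst E.nn_integral_fst[symmetric]) auto
  have "AE v in ?M. bd_pgf_val 1 a b 1 (fst v) (snd v) = 1"
  proof -
    have "(\<integral>\<^sup>+v. ennreal (1 - bd_pgf_val 1 a b 1 (fst v) (snd v)) \<partial>?M) = ennreal (1 - 1)"
      by (intro nn_integral_one_minus P.prob_space_axioms)
         (use bd_pgf_val_bounds[of 1] pair[of 1] bd_exp_pgf_eq_1[OF ab] in auto)
    then have "AE v in ?M. ennreal (1 - bd_pgf_val 1 a b 1 (fst v) (snd v)) = 0"
      by (subst nn_integral_0_iff_AE[symmetric]) auto
    then show ?thesis
      using bd_pgf_val_bounds[of 1 a b 1] by (auto elim!: eventually_mono simp: ennreal_eq_0_iff intro: antisym)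
  qed
  then have "AE v in ?M. bd_pgf_val x a b 1 (fst v) (snd v) = x ^ bd_value a b (fst v) (snd v)"
    by eventually_elim (auto simp: bd_pgf_val_def bd_value_eq_from split: if_splits)
  then show ?thesis unfolding pair
    by (intro nn_integral_cong_AE) (auto elim!: eventually_mono)
qed

lemma gen_LD_sums_gen:
  assumes ab: "a > b" "b \<ge> 0" and x: "0 \<le> x" "x \<le> 1" and c: "c \<ge> 0"
    and A: "bd_exp_pgf x a b (a - b) 1 = ennreal A" "0 \<le> A"
  shows "(\<lambda>m. gen_LD (a - b) a b c m * x ^ m) sums exp (- c * (1 - A))"
proof -
  let ?M = "bd_rand_space \<Otimes>\<^sub>M exp_meas (a - b)"
  interpret E: prob_space "exp_meas (a - b)" using ab by (intro prob_space_exp_meas) simp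
  interpret W: prob_space "bd_rand_space" unfolding bd_rand_space_eq by (rule prob_space_bd_rand)
  interpret P: pair_prob_space "bd_rand_space" "exp_meas (a - b)" ..
  interpret Q: prob_space "PiM (UNIV::nat set) (\<lambda>_. ?M)" by (intro prob_space_PiM P.prob_space_axioms)
  interpret K: pair_prob_space "measure_pmf (poisson_or_zero c)" "PiM (UNIV::nat set) (\<lambda>_. ?M)" ..
  let ?X = "\<lambda>v. \<Sum>k<fst v. bd_value a b (fst (snd v k)) (snd (snd v k))"
  have [measurable]: "?X \<in> measurable (LD_space (a - b) c) (count_space UNIV)"
  proof -
    have "(\<lambda>v. (\<Sum>k<n. bd_value a b (fst (snd v k)) (snd (snd v k)))) \<in> measurable (LD_space (a - b) c) (count_space UNIV)" for n
    proof (induction n)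
      case (Suc n)
      have [measurable]: "(\<lambda>v. bd_value a b (fst (snd v n)) (snd (snd v n))) \<in> measurable (LD_space (a - b) c) (count_space UNIV)"
      proof -
        have "(\<lambda>v. snd v n) \<in> measurable (LD_space (a - b) c) ?M"
          unfolding LD_space_def by measurable
        from measurable_compose[OF this measurable_bd_value] show ?thesis .
      qed
      note Suc[measurable]
      show ?case unfolding sum.lessThan_Suc by measurable
    qed simp
    then show ?thesis
      by (rule measurable_compose_countable) (simp add: LD_space_def)
  qed
  have "(\<integral>\<^sup>+v. ennreal (x ^ ?X v) \<partial>LD_space (a - b) c) =
     (\<integral>\<^sup>+K. \<integral>\<^sup>+\<omega>. ennreal (x ^ (\<Sum>k<K. bd_value a b (fst (\<omega> k)) (snd (\<omega> k)))) \<partial>PiM UNIV (\<lambda>_. ?M) \<partial>measure_pmf (poisson_or_zero c))"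
  proof -
    have "(\<lambda>v. ennreal (x ^ ?X v)) \<in> borel_measurable (LD_space (a - b) c)" by measurable
    from Q.nn_integral_fst[OF this[unfolded LD_space_def]]
    show ?thesis unfolding LD_space_def by simp
  qed
  also have "\<dots> = (\<integral>\<^sup>+K. ennreal A ^ K \<partial>measure_pmf (poisson_or_zero c))"
  proof (intro nn_integral_cong)
    fix K :: nat
    have "(\<integral>\<^sup>+\<omega>. ennreal (x ^ (\<Sum>k<K. bd_value a b (fst (\<omega> k)) (snd (\<omega> k)))) \<partial>PiM UNIV (\<lambda>_. ?M)) =
       (\<integral>\<^sup>+\<omega>. (\<Prod>k<K. ennreal (x ^ bd_value a b (fst (\<omega> k)) (snd (\<omega> k)))) \<partial>PiM UNIV (\<lambda>_. ?M))"
      using x by (simp add: power_sum prod_ennreal)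
    also have "\<dots> = ennreal A ^ K"
      unfolding A(1)[symmetric] nn_integral_bd_value[OF ab x, symmetric]
      by (rule nn_integral_PiM_prod_power[OF P.prob_space_axioms, where f = "\<lambda>s. ennreal (x ^ bd_value a b (fst s) (snd s))"]) measurable
    finally show "(\<integral>\<^sup>+\<omega>. ennreal (x ^ (\<Sum>k<K. bd_value a b (fst (\<omega> k)) (snd (\<omega> k)))) \<partial>PiM UNIV (\<lambda>_. ?M)) = ennreal A ^ K" .
  qed
  also have "\<dots> = ennreal (exp (- c * (1 - A)))" by (rule nn_integral_poisson_power[OF c A(2)])
  finally have "(\<integral>\<^sup>+v. ennreal (x ^ ?X v) \<partial>LD_space (a - b) c) = ennreal (exp (- c * (1 - A)))" .
  then show ?thesis unfolding gen_LD_def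
    by (intro pgf_sums_nn_integral) (use x K.prob_space_axioms in \<open>auto simp: LD_space_def[symmetric]\<close>)
qed

lemma gen_LD_sums_1:
  assumes "a > b" "b \<ge> 0" "c \<ge> 0"
  shows "gen_LD (a - b) a b c sums 1"
  using gen_LD_sums_gen[of b a 1 c 1] bd_exp_pgf_eq_1[of b a] assms by simp

lemma gen_LD_pgf:
  assumes ab: "a > b" "b \<ge> 0" and x: "0 \<le> x" "x < 1" and c: "c \<ge> 0" and ne: "a - b \<noteq> a * (1 - x)"
  shows "(\<lambda>m. gen_LD (a - b) a b c m * x ^ m) sums exp (c * bd_I a (a - b) (1 - x) 0)"
proof -
  interpret bd_params a "a - b" "1 - x" by unfold_locales (use assms in auto)
  show ?thesis using gen_LD_sums_gen[OF ab, of x c "1 + bd_I a (a - b) (1 - x) 0"] bd_exp_pgf_eq[OF ab x ne]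
     bd_sol_bounds(1)[of 1] x c unfolding bd_sol_1 by simp
qed

lemma gen_LD_nonneg: "gen_LD l a b c m \<ge> 0"
  by (simp add: gen_LD_def)

section \<open>The embedded jump chain and potentials\<close>

lemma finite_nuc: "finite (A :: nuc set)"
proof -
  have "(UNIV :: nuc set) = {NA, NC, NG, NT}" using nuc.exhaust by auto
  then have "finite (UNIV :: nuc set)" by (metis finite.simps)
  then show ?thesis by (rule rev_finite_subset) simp
qed

lemma sum_mset_eq_sum_count:
  fixes f :: "'a \<Rightarrow> real"
  shows "(\<Sum>v\<in>#M. f v) = (\<Sum>v\<in>set_mset M. real (count M v) * f v)"
proof (induction M)
  case (add x M)
  show ?case
  proof (cases "x \<in># M")
    case True
    have "(\<Sum>v\<in>set_mset (add_mset x M). real (count (add_mset x M) v) * f v) =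
      (\<Sum>v\<in>set_mset M. real (count M v) * f v + (if v = x then f v else 0))"
      using True by (intro sum.cong) (auto simp: algebra_simps)
    also have "\<dots> = (\<Sum>v\<in>set_mset M. real (count M v) * f v) + f x"
      using True by (simp add: sum.distrib)
    finally show ?thesis using add by simp
  next
    case False
    have "(\<Sum>v\<in>set_mset M. real (count (add_mset x M) v) * f v) = (\<Sum>v\<in>set_mset M. real (count M v) * f v)"
      using False by (intro sum.cong) auto
    then show ?thesis using False add by (simp add: count_eq_zero_iff)
  qed
qed simp

lemma integral_measure_spmf_case_option:
  fixes g :: "'a \<Rightarrow> real"
  shows "(\<integral>x. g x \<partial>measure_spmf p) = (\<integral>y. (case y of None \<Rightarrow> 0 | Some x \<Rightarrow> g x) \<partial>measure_pmf p)"
proof -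
  have "(\<integral>x. g x \<partial>measure_spmf p) = (\<integral>y. indicator (range Some) y *\<^sub>R g (the y) \<partial>measure_pmf p)"
    unfolding measure_spmf_def by (simp add: integral_distr integral_restrict_space)
  also have "\<dots> = (\<integral>y. (case y of None \<Rightarrow> 0 | Some x \<Rightarrow> g x) \<partial>measure_pmf p)"
    by (intro Bochner_Integration.integral_cong) (auto simp: indicator_def split: option.split)
  finally show ?thesis .
qed

text \<open>If D - Q had a positive supremum, a state nearly attaining it would violate the strict decrease.\<close>
lemma potential_bound:
  fixes D Q :: "'s \<Rightarrow> real"
  assumes bound: "\<And>M. M \<in> St \<Longrightarrow> D M \<le> C" and Q: "\<And>M. M \<in> St \<Longrightarrow> Q M \<ge> 0" and eta: "\<eta> > 0"
    and step: "\<And>M. M \<in> St \<Longrightarrow> \<not> D M \<le> Q M \<Longrightarrow> finite (set_pmf (K M)) \<and> set_pmf (K M) \<subseteq> St \<and>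
       D M - Q M \<le> measure_pmf.expectation (K M) (\<lambda>M'. D M' - Q M') - \<eta>"
    and M: "M \<in> St"
  shows "D M \<le> Q M"
proof (rule ccontr)
  assume neg: "\<not> D M \<le> Q M"
  let ?X = "(\<lambda>M. D M - Q M) ` St"
  define \<sigma> where "\<sigma> = Sup ?X"
  have bdd: "bdd_above ?X"
    using bound Q by (intro bdd_aboveI[of _ C]) force
  have le: "D M' - Q M' \<le> \<sigma>" if "M' \<in> St" for M'
    unfolding \<sigma>_def using that bdd by (intro cSup_upper) auto
  have "\<sigma> > 0" using neg le[OF M] by linarith
  then have "max 0 (\<sigma> - \<eta>) < Sup ?X" using eta by (simp add: \<sigma>_def)
  then obtain M1 where M1: "M1 \<in> St" "max 0 (\<sigma> - \<eta>) < D M1 - Q M1"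
    using M by (subst (asm) less_cSup_iff[OF _ bdd]) auto
  then have s: "finite (set_pmf (K M1))" "set_pmf (K M1) \<subseteq> St"
     "D M1 - Q M1 \<le> measure_pmf.expectation (K M1) (\<lambda>M'. D M' - Q M') - \<eta>"
    using step[of M1] by auto
  have "measure_pmf.expectation (K M1) (\<lambda>M'. D M' - Q M') \<le> measure_pmf.expectation (K M1) (\<lambda>_. \<sigma>)"
    using s le by (intro integral_mono_AE) (auto simp: AE_measure_pmf_iff intro!: integrable_measure_pmf_finite)
  then show False using s(3) M1(2) by simp
qed

locale bp_model =
  fixes \<alpha> \<beta> :: "genome \<Rightarrow> real" and Ssel S :: "nat set" and \<mu> :: "nat \<Rightarrow> nuc \<Rightarrow> nuc pmf"
  assumes finS: "finite S" and nonneg: "\<And>x. \<alpha> x \<ge> 0" "\<And>x. \<beta> x \<ge> 0"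
begin

abbreviation ra :: "genome \<Rightarrow> real" where "ra v \<equiv> \<alpha> (sel_part Ssel v)"
abbreviation rb :: "genome \<Rightarrow> real" where "rb v \<equiv> \<beta> (sel_part Ssel v)"
abbreviation Zr :: "genome multiset \<Rightarrow> real" where "Zr M \<equiv> total_rate \<alpha> \<beta> Ssel M"
abbreviation dau :: "genome \<Rightarrow> genome pmf" where "dau v \<equiv> daughter S \<mu> v"
abbreviation stp :: "genome multiset \<Rightarrow> genome multiset pmf" where "stp M \<equiv> bp_step \<alpha> \<beta> Ssel S \<mu> M"
abbreviation dau2 :: "genome \<Rightarrow> (genome \<times> genome) pmf" where "dau2 v \<equiv> pair_pmf (dau v) (dau v)"
abbreviation hit :: "nat \<Rightarrow> genome multiset \<Rightarrow> genome multiset spmf" where "hit n M \<equiv> bp_hit \<alpha> \<beta> Ssel S \<mu> n M"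

definition gen :: "(genome multiset \<Rightarrow> real) \<Rightarrow> genome multiset \<Rightarrow> genome \<Rightarrow> real" where
  "gen F M v = ra v * (measure_pmf.expectation (dau2 v) (\<lambda>d. F (M - {#v#} + {#fst d, snd d#})) - F M)
     + rb v * (F (M - {#v#}) - F M)"

lemma finite_dau: "finite (set_pmf (dau v))"
proof -
  have "set_pmf (dau v) \<subseteq> PiE_dflt S NA (\<lambda>_. UNIV)"
    unfolding daughter_def using set_Pi_pmf_subset[OF finS] by (force simp: PiE_dflt_def)
  moreover have "finite (PiE_dflt S NA (\<lambda>_. (UNIV :: nuc set)))"
    by (rule finite_PiE_dflt[OF finS]) (rule finite_nuc)
  ultimately show ?thesis by (rule finite_subset)
qed

lemma finite_dau2: "finite (set_pmf (dau2 v))" by (simp add: finite_dau)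

lemma Zr_alt: "Zr M = (\<Sum>v\<in>#M. ra v) + (\<Sum>v\<in>#M. rb v)"
  by (simp add: total_rate_def sum_mset.distrib)

definition pick :: "genome multiset \<Rightarrow> (genome \<times> bool) pmf" where
  "pick M = embed_pmf (\<lambda>(v, d). real (count M v) * (if d then ra v else rb v) / Zr M)"

lemma pmf_pick:
  assumes Z: "Zr M > 0"
  shows "pmf (pick M) vd = real (count M (fst vd)) * (if snd vd then ra (fst vd) else rb (fst vd)) / Zr M"
    and "set_pmf (pick M) \<subseteq> set_mset M \<times> UNIV"
proof -
  define f where "f = (\<lambda>(v, d). real (count M v) * (if d then ra v else rb v) / Zr M)"
  have nn: "f vd \<ge> 0" for vd using nonneg Z by (auto simp: f_def split: prod.split)
  have "(\<integral>\<^sup>+ vd. ennreal (f vd) \<partial>count_space UNIV) = (\<Sum>vd\<in>set_mset M \<times> UNIV. ennreal (f vd))"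
  proof (rule nn_integral_count_space')
    fix vd assume "vd \<notin> set_mset M \<times> (UNIV :: bool set)"
    then have "fst vd \<notin># M" by (cases vd) auto
    then show "ennreal (f vd) = 0" by (simp add: f_def split_beta' not_in_iff)
  qed (auto simp: finite_SigmaI)
  also have "\<dots> = ennreal (\<Sum>vd\<in>set_mset M \<times> UNIV. f vd)" using nn by (simp add: sum_ennreal)
  also have "(\<Sum>vd\<in>set_mset M \<times> UNIV. f vd) = (\<Sum>v\<in>set_mset M. \<Sum>d\<in>UNIV. f (v, d))"
    by (simp add: sum.cartesian_product)
  also have "\<dots> = (\<Sum>v\<in>set_mset M. real (count M v) * (ra v + rb v) / Zr M)"
    by (intro sum.cong) (auto simp: f_def UNIV_bool distrib_left add_divide_distrib)
  also have "\<dots> = 1"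
    unfolding sum_divide_distrib[symmetric] sum_mset_eq_sum_count[symmetric]
    using Z by (simp add: total_rate_def)
  finally have int: "(\<integral>\<^sup>+ vd. ennreal (f vd) \<partial>count_space UNIV) = 1" by simp
  show *: "pmf (pick M) vd = real (count M (fst vd)) * (if snd vd then ra (fst vd) else rb (fst vd)) / Zr M" for vd
    using pmf_embed_pmf[OF nn int, of vd] by (simp add: pick_def f_def split_beta')
  show "set_pmf (pick M) \<subseteq> set_mset M \<times> UNIV"
    by (auto simp: set_pmf_eq * not_in_iff split: if_splits)
qed

lemma stp_eq:
  "stp M = bind_pmf (pick M) (\<lambda>(v, d). if d then map_pmf (\<lambda>d. M - {#v#} + {#fst d, snd d#}) (dau2 v) else return_pmf (M - {#v#}))"
  unfolding bp_step_def pick_def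
  by (intro bind_pmf_cong refl) (auto simp: pair_pmf_def map_bind_pmf map_pmf_def bind_assoc_pmf bind_return_pmf)

lemma finite_stp:
  assumes "Zr M > 0"
  shows "finite (set_pmf (stp M))"
proof -
  have "finite (set_pmf (pick M))" using pmf_pick(2)[OF assms] by (rule finite_subset) simp
  then show ?thesis unfolding stp_eq set_bind_pmf using finite_dau by (auto split: if_splits)
qed

lemma size_stp:
  assumes "Zr M > 0" "M' \<in> set_pmf (stp M)"
  shows "size M' \<le> size M + 1" "size M - 1 \<le> size M'"
proof -
  obtain v d where vd: "(v, d) \<in> set_pmf (pick M)"
    "M' \<in> set_pmf (if d then map_pmf (\<lambda>d. M - {#v#} + {#fst d, snd d#}) (dau2 v) else return_pmf (M - {#v#}))"
    using assms(2) unfolding stp_eq by auto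
  have "v \<in># M" using vd(1) pmf_pick(2)[OF assms(1)] by auto
  then have "size M = size (M - {#v#}) + 1" by (metis Suc_eq_plus1 insert_DiffM size_add_mset)
  then show "size M' \<le> size M + 1" "size M - 1 \<le> size M'" using vd(2) by (auto split: if_splits)
qed

lemma expectation_stp:
  assumes Z: "Zr M > 0"
  shows "measure_pmf.expectation (stp M) F - F M = (\<Sum>v\<in>#M. gen F M v) / Zr M"
proof -
  define E1 where "E1 v = measure_pmf.expectation (dau2 v) (\<lambda>d. F (M - {#v#} + {#fst d, snd d#}))" for v
  have "measure_pmf.expectation (stp M) F =
    (\<Sum>vd\<in>set_mset M \<times> UNIV. pmf (pick M) vd * (if snd vd then E1 (fst vd) else F (M - {#fst vd#})))"
    unfolding stp_eq
    by (subst pmf_expectation_bind[of "set_mset M \<times> UNIV"])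
       (use pmf_pick(2)[OF Z] finite_dau in \<open>auto simp: split_beta' E1_def intro!: sum.cong\<close>)
  also have "\<dots> = (\<Sum>v\<in>set_mset M. \<Sum>d\<in>UNIV. pmf (pick M) (v, d) * (if d then E1 v else F (M - {#v#})))"
    by (simp add: sum.cartesian_product split_beta')
  also have "\<dots> = (\<Sum>v\<in>set_mset M. real (count M v) * (ra v * E1 v + rb v * F (M - {#v#})) / Zr M)"
    using Z by (intro sum.cong refl) (simp add: UNIV_bool pmf_pick field_simps)
  also have "\<dots> = (\<Sum>v\<in>#M. ra v * E1 v + rb v * F (M - {#v#})) / Zr M"
    unfolding sum_divide_distrib[symmetric] sum_mset_eq_sum_count ..
  finally have 1: "measure_pmf.expectation (stp M) F = (\<Sum>v\<in>#M. ra v * E1 v + rb v * F (M - {#v#})) / Zr M" .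
  have "F M = (\<Sum>v\<in>#M. (ra v + rb v) * F M) / Zr M"
    using Z by (simp add: sum_mset_distrib_right[symmetric] total_rate_def)
  then have "measure_pmf.expectation (stp M) F - F M =
     ((\<Sum>v\<in>#M. ra v * E1 v + rb v * F (M - {#v#})) - (\<Sum>v\<in>#M. (ra v + rb v) * F M)) / Zr M"
    unfolding 1 diff_divide_distrib by simp
  also have "(\<Sum>v\<in>#M. ra v * E1 v + rb v * F (M - {#v#})) - (\<Sum>v\<in>#M. (ra v + rb v) * F M) = (\<Sum>v\<in>#M. gen F M v)"
    unfolding sum_mset_eq_sum_count sum_subtractf[symmetric]
    by (intro sum.cong refl) (simp add: gen_def E1_def algebra_simps)
  finally show ?thesis .
qed

definition bp_val :: "nat \<Rightarrow> (genome multiset \<Rightarrow> real) \<Rightarrow> genome multiset \<Rightarrow> real" where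
  "bp_val n g M = (\<integral>M'. g M' \<partial>measure_spmf (hit n M))"

lemma bp_val_terminal: "size M = n \<Longrightarrow> bp_val n g M = g M"
  unfolding bp_val_def integral_measure_spmf_case_option by (subst bp_hit.simps) simp

lemma bp_val_dead: "size M = 0 \<Longrightarrow> n \<noteq> 0 \<Longrightarrow> bp_val n g M = 0"
  unfolding bp_val_def integral_measure_spmf_case_option by (subst bp_hit.simps) simp

lemma bp_val_step:
  assumes "size M \<noteq> n" "size M \<noteq> 0" "Zr M > 0" and g: "\<And>M. \<bar>g M\<bar> \<le> 1"
  shows "bp_val n g M = measure_pmf.expectation (stp M) (bp_val n g)"
proof -
  have "hit n M = bind_pmf (stp M) (hit n)"
    using assms by (subst bp_hit.simps) (simp add: bind_spmf_of_pmf)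
  then have "bp_val n g M = (\<integral>y. (case y of None \<Rightarrow> 0 | Some x \<Rightarrow> g x) \<partial>measure_pmf (bind_pmf (stp M) (hit n)))"
    unfolding bp_val_def integral_measure_spmf_case_option by simp
  also have "\<dots> = measure_pmf.expectation (stp M) (\<lambda>M'. \<integral>y. (case y of None \<Rightarrow> 0 | Some x \<Rightarrow> g x) \<partial>measure_pmf (hit n M'))"
    unfolding measure_pmf_bind
    by (rule integral_bind[where K = "count_space UNIV" and B = 1 and B' = 1])
       (use g in \<open>auto split: option.split simp: measure_pmf.emeasure_space_1 space_subprob_algebra subprob_space_measure_pmf intro: measure_pmf_in_subprob_algebra\<close>)
  finally show ?thesis unfolding bp_val_def integral_measure_spmf_case_option .
qed

lemma bp_val_bounds:
  assumes "\<And>M. 0 \<le> g M \<and> g M \<le> 1"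
  shows "0 \<le> bp_val n g M" "bp_val n g M \<le> 1"
proof -
  let ?g = "\<lambda>y. (case y of None \<Rightarrow> 0 | Some x \<Rightarrow> g x)"
  show "0 \<le> bp_val n g M"
    unfolding bp_val_def integral_measure_spmf_case_option using assms by (intro integral_nonneg_AE) (auto split: option.split)
  have "(\<integral>y. ?g y \<partial>measure_pmf (hit n M)) \<le> (\<integral>y. 1 \<partial>measure_pmf (hit n M))"
    using assms by (intro integral_mono measure_pmf.integrable_const_bound[where B = 1]) (auto split: option.split)
  then show "bp_val n g M \<le> 1"
    unfolding bp_val_def integral_measure_spmf_case_option by simp
qed

end

section \<open>Mutants at the observed sites\<close>

lemma expectation_diff_le_prob:
  fixes f :: "'a \<Rightarrow> real"
  assumes fin: "finite (set_pmf p)" and f: "\<And>d. d \<in> set_pmf p \<Longrightarrow> \<bar>f d - c\<bar> \<le> C * indicator X d"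
  shows "\<bar>measure_pmf.expectation p f - c\<bar> \<le> C * measure_pmf.prob p X"
proof -
  have "measure_pmf.expectation p f - c = measure_pmf.expectation p (\<lambda>d. f d - c)"
    by (subst Bochner_Integration.integral_diff) (auto intro!: integrable_measure_pmf_finite fin)
  then have "\<bar>measure_pmf.expectation p f - c\<bar> \<le> measure_pmf.expectation p (\<lambda>d. \<bar>f d - c\<bar>)"
    using integral_abs_bound[of p "\<lambda>d. f d - c"] by simp
  also have "\<dots> \<le> measure_pmf.expectation p (\<lambda>d. C * indicator X d)"
    using f by (intro integral_mono_AE) (auto simp: AE_measure_pmf_iff intro!: integrable_measure_pmf_finite fin)
  also have "\<dots> = C * measure_pmf.prob p X" by simp
  finally show ?thesis .
qed

lemma expectation_le_prob:
  fixes f :: "'a \<Rightarrow> real"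
  assumes fin: "finite (set_pmf p)" and f: "\<And>d. d \<in> set_pmf p \<Longrightarrow> f d \<le> c + C * indicator X d"
  shows "measure_pmf.expectation p f \<le> c + C * measure_pmf.prob p X"
proof -
  have "measure_pmf.expectation p f \<le> measure_pmf.expectation p (\<lambda>d. c + C * indicator X d)"
    using f by (intro integral_mono_AE) (auto simp: AE_measure_pmf_iff intro!: integrable_measure_pmf_finite fin)
  also have "\<dots> = c + C * measure_pmf.prob p X"
    by (subst Bochner_Integration.integral_add) (auto intro!: integrable_measure_pmf_finite fin)
  finally show ?thesis .
qed

text \<open>T is the set of observed neutral sites and n the target population size; every cell has
  at most the rates Rm, and a daughter differs from her mother at T or at a selective site with probability at
  most E0 / n.\<close>
locale bp_sites = bp_model +
  fixes T :: "nat set" and u :: genome and a b Rm E0 :: real and n :: nat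
  assumes Ssel_S: "Ssel \<subseteq> S" and T_S: "T \<subseteq> S" and disj: "T \<inter> Ssel = {}"
    and a_eq: "\<alpha> (sel_part Ssel u) = a" and b_eq: "\<beta> (sel_part Ssel u) = b" and ab: "b < a"
    and Rm: "\<And>v. \<alpha> (sel_part Ssel v) \<le> Rm" "\<And>v. \<beta> (sel_part Ssel v) \<le> Rm"
    and mut: "\<And>v. (\<Sum>i\<in>Ssel \<union> T. 1 - pmf (\<mu> i (v i)) (v i)) \<le> E0 / real n"
    and npos: "n > 0"
begin

definition wild :: "genome \<Rightarrow> bool" where "wild v \<longleftrightarrow> (\<forall>i\<in>Ssel \<union> T. v i = u i)"
definition ct :: "genome \<Rightarrow> nat" where "ct v = card {i \<in> T. v i \<noteq> u i}"
definition dbl :: "genome \<Rightarrow> bool" where "dbl v \<longleftrightarrow> ct v \<ge> 2 \<or> (ct v \<ge> 1 \<and> (\<exists>i\<in>Ssel. v i \<noteq> u i))"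
definition mc :: "genome multiset \<Rightarrow> nat" where "mc M = (\<Sum>v\<in>#M. ct v)"
definition nw :: "genome multiset \<Rightarrow> nat" where "nw M = size (filter_mset (\<lambda>v. \<not> wild v) M)"
definition me :: real where "me = E0 / real n"
abbreviation lam :: real where "lam \<equiv> a - b"

lemma b0: "b \<ge> 0" using nonneg(2) b_eq by metis
lemma a0: "a > 0" using ab b0 by simp
lemma RmA: "a \<le> Rm" using Rm(1)[of u] a_eq by simp
lemma Rm0: "Rm > 0" using RmA a0 by simp
lemma finT: "finite T" using T_S finS finite_subset by blast
lemma finSel: "finite Ssel" using Ssel_S finS finite_subset by blast

lemma me0: "me \<ge> 0"
proof -
  have "0 \<le> (\<Sum>i\<in>Ssel \<union> T. 1 - pmf (\<mu> i (u i)) (u i))" by (intro sum_nonneg) (simp add: pmf_le_1)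
  then show ?thesis unfolding me_def using mut[of u] by linarith
qed

lemma rates_unsel: "\<forall>i\<in>Ssel. v i = u i \<Longrightarrow> ra v = a \<and> rb v = b"
proof -
  assume "\<forall>i\<in>Ssel. v i = u i"
  then have "sel_part Ssel v = sel_part Ssel u" by (auto simp: sel_part_def)
  then show ?thesis using a_eq b_eq by simp
qed

lemma rates_wild: "wild v \<Longrightarrow> ra v = a \<and> rb v = b"
  by (rule rates_unsel) (auto simp: wild_def)

lemma ct_cong: "\<forall>i\<in>Ssel \<union> T. v i = d i \<Longrightarrow> ct v = ct d"
proof -
  assume "\<forall>i\<in>Ssel \<union> T. v i = d i"
  then have "{i \<in> T. v i \<noteq> u i} = {i \<in> T. d i \<noteq> u i}" by auto
  then show ?thesis by (simp add: ct_def)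
qed

lemma dbl_cong: "\<forall>i\<in>Ssel \<union> T. v i = d i \<Longrightarrow> dbl v = dbl d"
  using ct_cong[of v d] by (auto simp: dbl_def)

lemma ct_wild: "wild v \<Longrightarrow> ct v = 0"
proof -
  assume "wild v"
  then have "{i \<in> T. v i \<noteq> u i} = {}" by (auto simp: wild_def)
  then show ?thesis by (simp only: ct_def card.empty)
qed

lemma dbl_wild: "wild v \<Longrightarrow> \<not> dbl v"
  using ct_wild by (auto simp: dbl_def)

lemma ct_not_dbl: "\<not> dbl v \<Longrightarrow> ct v \<le> (if wild v then 0 else 1)"
  using ct_wild by (auto simp: dbl_def)

lemma ct_pos_unsel: "\<not> dbl v \<Longrightarrow> ct v = 1 \<Longrightarrow> ra v = a \<and> rb v = b"
  by (rule rates_unsel) (auto simp: dbl_def)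

lemma mc_le_nw: "\<forall>v\<in>#M. \<not> dbl v \<Longrightarrow> mc M \<le> nw M"
proof (induction M)
  case (add v M)
  then show ?case using ct_not_dbl[of v] by (auto simp: mc_def nw_def)
qed (simp add: mc_def nw_def)

lemma prob_site: "i \<in> S \<Longrightarrow> measure_pmf.prob (dau v) {d. d i \<noteq> v i} = 1 - pmf (\<mu> i (v i)) (v i)"
proof -
  assume i: "i \<in> S"
  have "measure_pmf.prob (dau v) {d. d i \<noteq> v i} = measure_pmf.prob (map_pmf (\<lambda>d. d i) (dau v)) {y. y \<noteq> v i}"
    by (simp add: vimage_def)
  also have "map_pmf (\<lambda>d. d i) (dau v) = \<mu> i (v i)"
    unfolding daughter_def using i finS by (subst Pi_pmf_component) auto
  also have "measure_pmf.prob (\<mu> i (v i)) {y. y \<noteq> v i} = 1 - pmf (\<mu> i (v i)) (v i)"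
  proof -
    have "{y. y \<noteq> v i} = - {v i}" by auto
    then show ?thesis
      using measure_pmf.prob_compl[of "{v i}" "\<mu> i (v i)"] by (simp add: Compl_eq_Diff_UNIV measure_pmf_single)
  qed
  finally show ?thesis .
qed

lemma prob_mut: "measure_pmf.prob (dau v) {d. \<exists>i\<in>Ssel \<union> T. d i \<noteq> v i} \<le> me"
proof -
  have eq: "{d. \<exists>i\<in>Ssel \<union> T. d i \<noteq> v i} = (\<Union>i\<in>Ssel \<union> T. {d. d i \<noteq> v i})" by auto
  have "measure_pmf.prob (dau v) {d. \<exists>i\<in>Ssel \<union> T. d i \<noteq> v i} \<le> (\<Sum>i\<in>Ssel \<union> T. measure_pmf.prob (dau v) {d. d i \<noteq> v i})"
    unfolding eq by (rule measure_pmf.finite_measure_subadditive_finite) (use finT finSel in auto)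
  also have "\<dots> = (\<Sum>i\<in>Ssel \<union> T. 1 - pmf (\<mu> i (v i)) (v i))"
    using Ssel_S T_S by (intro sum.cong prob_site) auto
  also have "\<dots> \<le> me" unfolding me_def by (rule mut)
  finally show ?thesis .
qed

lemma prob_dau2:
  assumes "measure_pmf.prob (dau v) {d. P d} \<le> c"
  shows "measure_pmf.prob (dau2 v) {d. P (fst d) \<or> P (snd d)} \<le> 2 * c"
proof -
  have "measure_pmf.prob (dau2 v) {d. P (fst d)} = measure_pmf.prob (map_pmf fst (dau2 v)) {d. P d}"
    by (simp add: vimage_def del: map_fst_pair_pmf)
  then have 1: "measure_pmf.prob (dau2 v) {d. P (fst d)} \<le> c" using assms by (simp add: map_fst_pair_pmf)
  have "measure_pmf.prob (dau2 v) {d. P (snd d)} = measure_pmf.prob (map_pmf snd (dau2 v)) {d. P d}"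
    by (simp add: vimage_def del: map_snd_pair_pmf)
  then have 2: "measure_pmf.prob (dau2 v) {d. P (snd d)} \<le> c" using assms by (simp add: map_snd_pair_pmf)
  have "{d. P (fst d) \<or> P (snd d)} = {d. P (fst d)} \<union> {d. P (snd d)}" by auto
  then show ?thesis using 1 2 measure_Un_le[of "{d. P (fst d)}" "dau2 v" "{d. P (snd d)}"] by simp
qed

lemma expectation_dau_prod:
  fixes f :: "nat \<Rightarrow> nuc \<Rightarrow> real"
  assumes X: "X \<subseteq> S" and f: "\<And>i y. f i y \<ge> 0"
  shows "measure_pmf.expectation (dau v) (\<lambda>d. \<Prod>i\<in>X. f i (d i)) = (\<Prod>i\<in>X. measure_pmf.expectation (\<mu> i (v i)) (f i))"
proof -
  let ?f = "\<lambda>i y. if i \<in> X then f i y else 1"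
  have XS: "S \<inter> X = X" using X by auto
  have "measure_pmf.expectation (dau v) (\<lambda>d. \<Prod>i\<in>X. f i (d i)) = measure_pmf.expectation (dau v) (\<lambda>d. \<Prod>i\<in>S. ?f i (d i))"
    using finS XS by (simp add: prod.inter_restrict[symmetric])
  also have "\<dots> = (\<Prod>i\<in>S. measure_pmf.expectation (\<mu> i (v i)) (?f i))"
    unfolding daughter_def using f
    by (intro expectation_prod_Pi_pmf finS integrable_measure_pmf_finite) (auto intro: finite_nuc)
  also have "\<dots> = (\<Prod>i\<in>S. if i \<in> X then measure_pmf.expectation (\<mu> i (v i)) (f i) else 1)"
    by (intro prod.cong) auto
  also have "\<dots> = (\<Prod>i\<in>X. measure_pmf.expectation (\<mu> i (v i)) (f i))"
    using finS XS by (simp add: prod.inter_restrict[symmetric])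
  finally show ?thesis .
qed

lemma expectation_nuc: "measure_pmf.expectation p (\<lambda>y. if y \<noteq> w then c else d) = d - (1 - pmf p w) * (d - c)" for c d :: real and p :: "nuc pmf"
proof -
  have "(\<lambda>y. if y \<noteq> w then c else d) = (\<lambda>y. c + (d - c) * indicator {w} y)" by (auto simp: indicator_def)
  then have "measure_pmf.expectation p (\<lambda>y. if y \<noteq> w then c else d) = c + (d - c) * pmf p w"
    by (simp add: Bochner_Integration.integral_add integrable_measure_pmf_finite finite_nuc measure_pmf_single)
  then show ?thesis by (simp add: algebra_simps)
qed

definition mu0 :: "nat \<Rightarrow> real" where "mu0 i = 1 - pmf (\<mu> i (u i)) (u i)"

lemma mu0_nonneg: "mu0 i \<ge> 0" by (simp add: mu0_def pmf_le_1)

lemma sum_mu0: "(\<Sum>i\<in>Ssel \<union> T. mu0 i) \<le> me" unfolding mu0_def me_def by (rule mut)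

lemma expectation_dau_ct:
  assumes "wild v" "g \<ge> 0"
  shows "measure_pmf.expectation (dau v) (\<lambda>d. g ^ ct d) = (\<Prod>i\<in>T. 1 - mu0 i * (1 - g))"
proof -
  have "g ^ ct d = (\<Prod>i\<in>T. if d i \<noteq> u i then g else 1)" for d
    using finT by (simp add: ct_def prod.If_cases Int_def)
  then have "measure_pmf.expectation (dau v) (\<lambda>d. g ^ ct d) = (\<Prod>i\<in>T. measure_pmf.expectation (\<mu> i (v i)) (\<lambda>y. if y \<noteq> u i then g else 1))"
    using expectation_dau_prod[OF T_S, of "\<lambda>i y. if y \<noteq> u i then g else 1" v] assms by simp
  also have "\<dots> = (\<Prod>i\<in>T. 1 - mu0 i * (1 - g))"
    using assms by (intro prod.cong refl) (auto simp: expectation_nuc mu0_def wild_def)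
  finally show ?thesis .
qed

lemma prob_dbl_wild:
  assumes "wild v"
  shows "measure_pmf.prob (dau v) {d. dbl d} \<le> me\<^sup>2"
proof -
  let ?U = "Ssel \<union> T"
  let ?I = "{(i, j). i \<in> ?U \<and> j \<in> ?U \<and> i \<noteq> j}"
  have finI: "finite ?I" by (rule finite_subset[of _ "?U \<times> ?U"]) (use finT finSel in auto)
  have sub: "{d. dbl d} \<subseteq> (\<Union>ij\<in>?I. {d. d (fst ij) \<noteq> u (fst ij) \<and> d (snd ij) \<noteq> u (snd ij)})"
  proof
    fix d assume "d \<in> {d. dbl d}"
    then consider "ct d \<ge> 2" | "ct d \<ge> 1" "\<exists>i\<in>Ssel. d i \<noteq> u i" by (auto simp: dbl_def)
    then show "d \<in> (\<Union>ij\<in>?I. {d. d (fst ij) \<noteq> u (fst ij) \<and> d (snd ij) \<noteq> u (snd ij)})"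
    proof cases
      case 1
      then have "2 \<le> card {i \<in> T. d i \<noteq> u i}" by (simp only: ct_def)
      then obtain B where B: "B \<subseteq> {i \<in> T. d i \<noteq> u i}" "card B = 2"
        by (rule obtain_subset_with_card_n)
      then obtain i j where "B = {i, j}" "i \<noteq> j" unfolding card_2_iff by auto
      with B(1) have "i \<in> T" "d i \<noteq> u i" "j \<in> T" "d j \<noteq> u j" "i \<noteq> j" by auto
      then show ?thesis by (intro UN_I[of "(i, j)"]) auto
    next
      case 2
      then have "{i \<in> T. d i \<noteq> u i} \<noteq> {}" unfolding ct_def by (metis card.empty not_one_le_zero)
      then obtain i where "i \<in> T" "d i \<noteq> u i" by auto
      moreover obtain j where "j \<in> Ssel" "d j \<noteq> u j" using 2 by auto
      ultimately show ?thesis using disj by (intro UN_I[of "(i, j)"]) auto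
    qed
  qed
  have "measure_pmf.prob (dau v) {d. dbl d} \<le> measure_pmf.prob (dau v) (\<Union>ij\<in>?I. {d. d (fst ij) \<noteq> u (fst ij) \<and> d (snd ij) \<noteq> u (snd ij)})"
    by (rule measure_pmf.finite_measure_mono[OF sub]) simp
  also have "\<dots> \<le> (\<Sum>ij\<in>?I. measure_pmf.prob (dau v) {d. d (fst ij) \<noteq> u (fst ij) \<and> d (snd ij) \<noteq> u (snd ij)})"
    using finI by (intro measure_pmf.finite_measure_subadditive_finite) auto
  also have "\<dots> = (\<Sum>ij\<in>?I. mu0 (fst ij) * mu0 (snd ij))"
  proof (intro sum.cong refl)
    fix ij assume "ij \<in> ?I"
    then obtain i j where ij: "ij = (i, j)" "i \<in> ?U" "j \<in> ?U" "i \<noteq> j" by auto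
    have "measure_pmf.prob (dau v) {d. d i \<noteq> u i \<and> d j \<noteq> u j} =
       measure_pmf.expectation (dau v) (\<lambda>d. \<Prod>k\<in>{i, j}. if d k \<noteq> u k then 1 else 0)"
    proof -
      have "measure_pmf.prob (dau v) {d. d i \<noteq> u i \<and> d j \<noteq> u j} =
        measure_pmf.expectation (dau v) (indicator {d. d i \<noteq> u i \<and> d j \<noteq> u j})" by simp
      also have "\<dots> = measure_pmf.expectation (dau v) (\<lambda>d. \<Prod>k\<in>{i, j}. if d k \<noteq> u k then 1 else 0)"
        using ij(4) by (intro Bochner_Integration.integral_cong) (auto simp: indicator_def)
      finally show ?thesis .
    qed
    also have "\<dots> = (\<Prod>k\<in>{i, j}. measure_pmf.expectation (\<mu> k (v k)) (\<lambda>y. if y \<noteq> u k then 1 else 0))"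
      using ij Ssel_S T_S by (intro expectation_dau_prod) auto
    also have "\<dots> = mu0 i * mu0 j"
      using ij assms by (simp add: expectation_nuc mu0_def wild_def)
    finally show "measure_pmf.prob (dau v) {d. d (fst ij) \<noteq> u (fst ij) \<and> d (snd ij) \<noteq> u (snd ij)} = mu0 (fst ij) * mu0 (snd ij)"
      by (simp add: ij)
  qed
  also have "\<dots> \<le> (\<Sum>ij\<in>?U \<times> ?U. mu0 (fst ij) * mu0 (snd ij))"
    using finT finSel mu0_nonneg by (intro sum_mono2) auto
  also have "\<dots> = (\<Sum>i\<in>?U. mu0 i)\<^sup>2"
    by (simp add: power2_eq_square sum_product sum.cartesian_product split_beta')
  also have "\<dots> \<le> me\<^sup>2" using sum_mu0 mu0_nonneg by (intro power_mono sum_nonneg) auto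
  finally show ?thesis .
qed

abbreviation UA :: "genome multiset \<Rightarrow> real" where "UA M \<equiv> (\<Sum>v\<in>#M. ra v)"
abbreviation UB :: "genome multiset \<Rightarrow> real" where "UB M \<equiv> (\<Sum>v\<in>#M. rb v)"

lemma nw_le_size: "nw M \<le> size M"
  unfolding nw_def by (simp add: size_filter_mset_lesseq)

lemma UA_UB_bounds:
  "UA M \<ge> (real (size M) - real (nw M)) * a" "UB M \<le> (real (size M) - real (nw M)) * b + real (nw M) * Rm"
  "UB M \<ge> (real (size M) - real (nw M)) * b" "UB M \<ge> 0" "UA M \<ge> 0"
proof -
  have "UA M \<ge> (real (size M) - real (nw M)) * a \<and> UB M \<le> (real (size M) - real (nw M)) * b + real (nw M) * Rm
     \<and> UB M \<ge> (real (size M) - real (nw M)) * b \<and> UB M \<ge> 0 \<and> UA M \<ge> 0"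
  proof (induction M)
    case (add v M)
    have nw: "nw (add_mset v M) = (if wild v then 0 else 1) + nw M" by (simp add: nw_def)
    show ?case using add.IH rates_wild[of v] nonneg Rm(2)[of v] unfolding nw
      by (cases "wild v") (auto simp: algebra_simps add_increasing)
  qed (simp add: nw_def)
  then show "UA M \<ge> (real (size M) - real (nw M)) * a" "UB M \<le> (real (size M) - real (nw M)) * b + real (nw M) * Rm"
    "UB M \<ge> (real (size M) - real (nw M)) * b" "UB M \<ge> 0" "UA M \<ge> 0" by auto
qed

definition few :: "genome multiset \<Rightarrow> bool" where
  "few M \<longleftrightarrow> size M > 0 \<and> real (nw M) * (8 * Rm + lam) \<le> real (size M) * lam"

lemma few_facts:
  assumes "few M"
  shows "2 * real (nw M) \<le> real (size M)" "Zr M \<ge> real (size M) * (a + b) / 2" "Zr M > 0"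
    "UB M * (3 * a + b) \<le> UA M * (a + 3 * b)"
    "UA M - UB M \<ge> lam / (2 * (a + b)) * Zr M" "UA M * (4 * (a + b)) \<ge> (3 * a + b) * Zr M"
proof -
  let ?N = "real (size M)" and ?R = "real (nw M)"
  have N: "?N > 0" and few: "?R * (8 * Rm + lam) \<le> ?N * lam" using assms by (auto simp: few_def)
  have l: "lam > 0" "lam \<le> Rm" using ab RmA b0 by auto
  have "?R * (2 * lam) \<le> ?R * (8 * Rm + lam)" using l by (intro mult_left_mono) auto
  then have "(2 * ?R) * lam \<le> ?N * lam" using few by (simp add: algebra_simps)
  then show half: "2 * ?R \<le> ?N" using l by simp
  have "Zr M \<ge> (?N - ?R) * (a + b)"
    using UA_UB_bounds(1,3)[of M] by (simp add: Zr_alt algebra_simps)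
  moreover have "(?N - ?R) * (a + b) \<ge> (?N / 2) * (a + b)"
    using half a0 b0 by (intro mult_right_mono) auto
  ultimately show Z2: "Zr M \<ge> ?N * (a + b) / 2" by simp
  have "?N * (a + b) / 2 > 0" using N a0 b0 by simp
  then show Z: "Zr M > 0" using Z2 by linarith
  have "UB M * (3 * a + b) \<le> ((?N - ?R) * b + ?R * Rm) * (3 * a + b)"
    using UA_UB_bounds(2) a0 b0 by (intro mult_right_mono) auto
  also have "\<dots> \<le> (?N - ?R) * a * (a + 3 * b)"
  proof -
    have "?R * Rm * (3 * a + b) \<le> ?R * Rm * (4 * (a + b))"
      using Rm0 a0 b0 by (intro mult_left_mono) auto
    also have "\<dots> = (?R * (4 * Rm)) * (a + b)" by simp
    also have "\<dots> \<le> ((?N - ?R) * lam) * (a + b)"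
    proof (rule mult_right_mono)
      have "?R * (4 * Rm) \<le> ?R * (8 * Rm)" using Rm0 by (intro mult_left_mono) auto
      then show "?R * (4 * Rm) \<le> (?N - ?R) * lam" using few by (simp add: algebra_simps)
    qed (use a0 b0 in auto)
    finally show ?thesis by (simp add: algebra_simps)
  qed
  also have "\<dots> \<le> UA M * (a + 3 * b)"
    using UA_UB_bounds(1) a0 b0 by (intro mult_right_mono) auto
  finally show dr: "UB M * (3 * a + b) \<le> UA M * (a + 3 * b)" .
  then show "UA M * (4 * (a + b)) \<ge> (3 * a + b) * Zr M" by (simp add: Zr_alt algebra_simps)
  have "(UA M - UB M) * (2 * (a + b)) \<ge> lam * Zr M" using dr by (simp add: Zr_alt algebra_simps)
  then show "UA M - UB M \<ge> lam / (2 * (a + b)) * Zr M" using a0 b0 by (simp add: field_simps)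
qed

definition rho1 :: real where "rho1 = (a + 3 * b) / (3 * a + b)"

text \<open>A superharmonic majorant of the Green function of the population size; the truncated difference N - k
  is the positive part that is meant.\<close>
definition Gr :: "(nat \<Rightarrow> real) \<Rightarrow> nat \<Rightarrow> real" where
  "Gr f N = 2 * (a + b) / lam * (\<Sum>k=1..n. f k * rho1 ^ (N - k))"

lemma rho1: "0 < rho1" "rho1 < 1" using ab b0 by (auto simp: rho1_def add_pos_nonneg)

lemma size_Diff:
  "v \<in># M \<Longrightarrow> size (M - {#v#}) = size M - 1"
  "v \<in># M \<Longrightarrow> size (M - {#v#} + {#d1, d2#}) = size M + 1"
proof -
  assume "v \<in># M"
  then have "size M = Suc (size (M - {#v#}))" by (metis insert_DiffM size_add_mset)
  then show "size (M - {#v#}) = size M - 1" "size (M - {#v#} + {#d1, d2#}) = size M + 1" by simp_all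
qed

lemma sum_mset_gen_size:
  "(\<Sum>v\<in>#M. gen (\<lambda>M. F (size M)) M v) = UA M * (F (size M + 1) - F (size M)) + UB M * (F (size M - 1) - F (size M))"
proof -
  have "(\<Sum>v\<in>#M. gen (\<lambda>M. F (size M)) M v) =
    (\<Sum>v\<in>#M. ra v * (F (size M + 1) - F (size M)) + rb v * (F (size M - 1) - F (size M)))"
    by (rule arg_cong[where f = sum_mset], rule image_mset_cong) (simp only: gen_def size_Diff, simp)
  then show ?thesis by (simp add: sum_mset.distrib sum_mset_distrib_right)
qed

lemma Gr_step:
  assumes few: "few M" and sz: "size M \<le> n" and f: "\<And>k. k \<in> {1..n} \<Longrightarrow> f k \<ge> 0"
  shows "measure_pmf.expectation (stp M) (\<lambda>M. Gr f (size M)) - Gr f (size M) \<le> - f (size M)"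
proof -
  let ?N = "size M"
  have N: "?N \<in> {1..n}" using few sz by (auto simp: few_def Suc_le_eq)
  have Z: "Zr M > 0" by (rule few_facts(3)[OF few])
  have q: "a + b > 0" "lam > 0" "3 * a + b > 0" using a0 b0 ab by auto
  have UBA: "UB M \<le> rho1 * UA M" using few_facts(4)[OF few] q by (simp add: rho1_def field_simps)
  define g where "g k = UA M * (rho1 ^ (?N + 1 - k) - rho1 ^ (?N - k)) + UB M * (rho1 ^ (?N - 1 - k) - rho1 ^ (?N - k))" for k
  have g0: "g k \<le> 0" if "k \<noteq> ?N" for k
  proof (cases "k < ?N")
    case True
    then obtain j where j: "?N = k + Suc j" using less_iff_Suc_add by auto
    have "g k = rho1 ^ j * (1 - rho1) * (UB M - rho1 * UA M)"
      unfolding g_def j by (simp add: algebra_simps)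
    then show ?thesis using UBA rho1 by (simp add: mult_nonneg_nonpos)
  next
    case False
    then have "?N - k = 0" "?N + 1 - k = 0" "?N - 1 - k = 0" using that by auto
    then show ?thesis by (simp add: g_def)
  qed
  have gN: "g ?N \<le> - (lam / (2 * (a + b)) * Zr M)"
  proof -
    have "g ?N = - (UA M * (1 - rho1))" by (simp add: g_def algebra_simps)
    moreover have "1 - rho1 = 2 * lam / (3 * a + b)" using q by (simp add: rho1_def field_simps)
    moreover have "UA M * (2 * lam / (3 * a + b)) \<ge> lam / (2 * (a + b)) * Zr M"
    proof -
      have *: "l / (2 * Q) * Z = (2 * l) * (c * Z) / ((4 * Q) * c)" if "Q > 0" "c > 0" for l Q c Z :: real
        using that by (simp add: field_simps)
      have "lam / (2 * (a + b)) * Zr M = (2 * lam) * ((3 * a + b) * Zr M) / ((4 * (a + b)) * (3 * a + b))"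
        by (rule *) (use q in auto)
      also have "\<dots> \<le> (2 * lam) * (UA M * (4 * (a + b))) / ((4 * (a + b)) * (3 * a + b))"
        using few_facts(6)[OF few] q by (intro divide_right_mono mult_left_mono) auto
      also have "\<dots> = UA M * (2 * lam / (3 * a + b))" using q by simp
      finally show ?thesis .
    qed
    ultimately show ?thesis by simp
  qed
  have "measure_pmf.expectation (stp M) (\<lambda>M. Gr f (size M)) - Gr f ?N =
    (UA M * (Gr f (?N + 1) - Gr f ?N) + UB M * (Gr f (?N - 1) - Gr f ?N)) / Zr M"
    using expectation_stp[OF Z, of "\<lambda>M. Gr f (size M)"] sum_mset_gen_size[of "Gr f" M] by simp
  also have "UA M * (Gr f (?N + 1) - Gr f ?N) + UB M * (Gr f (?N - 1) - Gr f ?N) =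
    2 * (a + b) / lam * (\<Sum>k=1..n. f k * g k)"
    unfolding Gr_def g_def
    by (simp add: sum_subtractf sum.distrib sum_distrib_left algebra_simps)
  also have "(\<Sum>k=1..n. f k * g k) \<le> f ?N * - (lam / (2 * (a + b)) * Zr M)"
  proof -
    have "(\<Sum>k=1..n. f k * g k) = f ?N * g ?N + (\<Sum>k\<in>{1..n} - {?N}. f k * g k)"
      using N by (simp add: sum.remove)
    also have "(\<Sum>k\<in>{1..n} - {?N}. f k * g k) \<le> 0"
      using g0 f by (intro sum_nonpos mult_nonneg_nonpos) auto
    also have "f ?N * g ?N \<le> f ?N * - (lam / (2 * (a + b)) * Zr M)"
      using gN f N by (intro mult_left_mono) auto
    finally show ?thesis by simp
  qed
  also have "2 * (a + b) / lam * (f ?N * - (lam / (2 * (a + b)) * Zr M)) / Zr M = - f ?N"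
  proof -
    have "2 * Q / l * (F * - (l / (2 * Q) * Z)) / Z = - F" if "Q > 0" "l > 0" "Z > 0" for Q l F Z :: real
      using that by (simp add: field_simps)
    then show ?thesis using q Z by blast
  qed
  finally show ?thesis using q Z by (simp add: divide_right_mono mult_left_mono)
qed

end

lemma sum_mset_mono_real:
  fixes f g :: "'a \<Rightarrow> real"
  assumes "\<And>v. v \<in># M \<Longrightarrow> f v \<le> g v"
  shows "(\<Sum>v\<in>#M. f v) \<le> (\<Sum>v\<in>#M. g v)"
  unfolding sum_mset_eq_sum_count using assms by (intro sum_mono mult_left_mono) auto

context bp_sites begin

text \<open>The logarithm of the number of mutants grows by at most Rm per unit of time even if mutants are favoured
  by selection, while ln (n / N) decreases at rate a - b; the weight Kc lets the latter win.\<close>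
definition Kc :: real where "Kc = 8 * Rm / lam"

definition Wf :: "nat \<Rightarrow> nat \<Rightarrow> real" where
  "Wf R N = (if R = 0 then 0 else ln (real R) + Kc * ln (real n / real N))"

definition Wp :: "genome multiset \<Rightarrow> real" where
  "Wp M = Wf (nw M) (size M)"

lemma Kc: "Kc \<ge> 8"
  using RmA ab b0 by (simp add: Kc_def field_simps)

lemma nw_Diff:
  assumes "v \<in># M"
  shows "nw M = nw (M - {#v#}) + (if wild v then 0 else 1)"
    "nw (M - {#v#} + {#d1, d2#}) = nw (M - {#v#}) + (if wild d1 then 0 else 1) + (if wild d2 then 0 else 1)"
proof -
  obtain M' where M: "M = add_mset v M'" using assms by (metis insert_DiffM)
  show "nw M = nw (M - {#v#}) + (if wild v then 0 else 1)" unfolding M by (simp add: nw_def)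
  show "nw (M - {#v#} + {#d1, d2#}) = nw (M - {#v#}) + (if wild d1 then 0 else 1) + (if wild d2 then 0 else 1)"
    by (simp add: nw_def)
qed

lemma mc_Diff:
  assumes "v \<in># M"
  shows "mc M = mc (M - {#v#}) + ct v"
    "mc (M - {#v#} + {#d1, d2#}) = mc (M - {#v#}) + ct d1 + ct d2"
proof -
  obtain M' where M: "M = add_mset v M'" using assms by (metis insert_DiffM)
  show "mc M = mc (M - {#v#}) + ct v" unfolding M by (simp add: mc_def)
  show "mc (M - {#v#} + {#d1, d2#}) = mc (M - {#v#}) + ct d1 + ct d2" by (simp add: mc_def)
qed

lemma nw_eq_0D: "nw M = 0 \<Longrightarrow> v \<in># M \<Longrightarrow> wild v"
proof (rule ccontr)
  assume "nw M = 0" "v \<in># M" "\<not> wild v"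
  then have "v \<in># filter_mset (\<lambda>v. \<not> wild v) M" by simp
  then show False using \<open>nw M = 0\<close> unfolding nw_def by (metis empty_iff set_mset_empty size_eq_0_iff_empty)
qed

lemma Wf_nonneg: "0 < N \<Longrightarrow> N \<le> n \<Longrightarrow> Wf R N \<ge> 0"
  unfolding Wf_def using Kc by (auto intro!: add_nonneg_nonneg mult_nonneg_nonneg ln_ge_zero)

lemma Wf_le:
  assumes R: "R > 0" and N: "0 < N" "N \<le> n"
  shows "Wf R' N \<le> ln (real R) + (if R' > R then (real R' - real R) / real R else 0) + Kc * ln (real n / real N)"
proof -
  have K: "Kc * ln (real n / real N) \<ge> 0" using Kc N by (auto intro!: mult_nonneg_nonneg ln_ge_zero)
  have lnR: "ln (real R) \<ge> 0" using R by simp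
  consider "R' = 0" | "0 < R'" "R' \<le> R" | "R < R'" by linarith
  then show ?thesis
  proof cases
    case 1 then show ?thesis using K lnR by (simp add: Wf_def)
  next
    case 2 then show ?thesis by (simp add: Wf_def)
  next
    case 3
    have "ln (real R') - ln (real R) = ln (real R' / real R)" using R 3 by (simp add: ln_div)
    also have "\<dots> \<le> real R' / real R - 1" using R 3 by (intro ln_le_minus_one) simp
    also have "\<dots> = (real R' - real R) / real R" using R by (simp add: field_simps)
    finally show ?thesis using 3 by (simp add: Wf_def)
  qed
qed

lemma sum_mset_nonwild:
  assumes "\<And>v. v \<in># M \<Longrightarrow> f v \<le> c"
  shows "(\<Sum>v\<in>#M. if wild v then 0 else f v) \<le> real (nw M) * (c :: real)"
  using assms
proof (induction M)
  case (add v M)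
  have "nw (add_mset v M) = nw M + (if wild v then 0 else 1)" by (simp add: nw_def)
  then show ?case using add.IH add.prems by (force simp: algebra_simps)
qed (simp add: nw_def)

lemma prob_nonwild2:
  assumes "wild v"
  shows "measure_pmf.prob (dau2 v) {d. \<not> wild (fst d) \<or> \<not> wild (snd d)} \<le> 2 * me"
proof (rule prob_dau2)
  have "{d. \<not> wild d} \<subseteq> {d. \<exists>i\<in>Ssel \<union> T. d i \<noteq> v i}" using assms by (auto simp: wild_def)
  then have "measure_pmf.prob (dau v) {d. \<not> wild d} \<le> measure_pmf.prob (dau v) {d. \<exists>i\<in>Ssel \<union> T. d i \<noteq> v i}"
    by (intro measure_pmf.finite_measure_mono) auto
  then show "measure_pmf.prob (dau v) {d. \<not> wild d} \<le> me" using prob_mut[of v] by linarith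
qed

lemma Wp_step_0:
  assumes few: "few M" and sz: "size M < n" and R: "nw M = 0"
  shows "measure_pmf.expectation (stp M) Wp - Wp M \<le> 4 * me * (1 + Kc * ln (real n / real (size M)))"
proof -
  let ?N = "size M"
  define w where "w = 1 + Kc * ln (real n / real ?N)"
  have N: "?N > 0" using few by (simp add: few_def)
  have Z: "Zr M > 0" by (rule few_facts(3)[OF few])
  have w0: "w \<ge> 0" unfolding w_def using Kc sz N by (auto intro!: add_nonneg_nonneg mult_nonneg_nonneg ln_ge_zero)
  have "gen Wp M v \<le> ra v * (4 * me * w)" if v: "v \<in># M" for v
  proof -
    have wv: "wild v" using nw_eq_0D[OF R v] .
    have R1: "nw (M - {#v#}) = 0" using nw_Diff(1)[OF v] R by simp
    have "measure_pmf.expectation (dau2 v) (\<lambda>d. Wp (M - {#v#} + {#fst d, snd d#})) \<le>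
        0 + (2 * w) * measure_pmf.prob (dau2 v) {d. \<not> wild (fst d) \<or> \<not> wild (snd d)}"
    proof (rule expectation_le_prob[OF finite_dau2])
      fix d :: "genome \<times> genome"
      let ?R' = "nw (M - {#v#} + {#fst d, snd d#})"
      have R': "?R' = (if wild (fst d) then 0 else 1) + (if wild (snd d) then 0 else 1)"
        using nw_Diff(2)[OF v] R1 by simp
      have ln2: "ln (real ?R') \<le> 1" unfolding R' using ln_2_less_1 by auto
      have "Kc * ln (real n / real (?N + 1)) \<le> Kc * ln (real n / real ?N)"
        using Kc N sz by (intro mult_left_mono) (auto simp: frac_le)
      then have "ln (real ?R') + Kc * ln (real n / real (?N + 1)) \<le> w" using ln2 by (simp add: w_def)
      then show "Wp (M - {#v#} + {#fst d, snd d#}) \<le> 0 + (2 * w) * indicator {d. \<not> wild (fst d) \<or> \<not> wild (snd d)} d"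
        unfolding Wp_def size_Diff(2)[OF v] using R' w0 by (auto simp: Wf_def indicator_def)
    qed
    also have "\<dots> \<le> 0 + (2 * w) * (2 * me)"
      using prob_nonwild2[OF wv] w0 by (intro add_left_mono mult_left_mono) auto
    finally have "measure_pmf.expectation (dau2 v) (\<lambda>d. Wp (M - {#v#} + {#fst d, snd d#})) \<le> 4 * me * w" by (simp add: mult_ac)
    then have "ra v * measure_pmf.expectation (dau2 v) (\<lambda>d. Wp (M - {#v#} + {#fst d, snd d#})) \<le> ra v * (4 * me * w)"
      using nonneg by (intro mult_left_mono) auto
    then show ?thesis unfolding gen_def using R R1 by (simp add: Wp_def Wf_def)
  qed
  then have "(\<Sum>v\<in>#M. gen Wp M v) \<le> (\<Sum>v\<in>#M. ra v * (4 * me * w))" by (rule sum_mset_mono_real)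
  also have "\<dots> = UA M * (4 * me * w)" by (rule sum_mset_distrib_right[symmetric])
  also have "\<dots> \<le> Zr M * (4 * me * w)"
    using UA_UB_bounds(4)[of M] me0 w0 by (intro mult_right_mono) (auto simp: Zr_alt)
  finally have "(\<Sum>v\<in>#M. gen Wp M v) / Zr M \<le> 4 * me * w" using Z by (simp add: field_simps)
  then show ?thesis unfolding expectation_stp[OF Z] w_def .
qed

lemma Wp_step_pos:
  assumes few: "few M" and sz: "size M < n" and R: "nw M > 0" and big: "real (size M) * lam \<ge> 8 * (a + b)"
  shows "measure_pmf.expectation (stp M) Wp - Wp M \<le> 4 * me"
proof -
  let ?N = "size M" and ?R = "nw M"
  have N: "?N > 0" using few by (simp add: few_def)
  have Z: "Zr M > 0" by (rule few_facts(3)[OF few])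
  have q: "a + b > 0" "lam > 0" using a0 b0 ab by auto
  have "lam \<le> a + b" using b0 by simp
  then have "8 * lam \<le> 8 * (a + b)" by simp
  then have "real ?N * lam \<ge> 8 * lam" using big by (rule order_trans)
  then have N8: "real ?N \<ge> 8" using q(2) by (rule mult_right_le_imp_le)
  define up dn where "up = Kc * (ln (real ?N) - ln (real (?N + 1)))" and "dn = Kc * (ln (real ?N) - ln (real (?N - 1)))"
  have K0: "Kc \<ge> 0" using Kc by simp
  have ln_eq: "ln (real n / real N') = ln (real n) - ln (real N')" if "N' > 0" for N' using that npos by (simp add: ln_div)
  have ln_eq': "ln (real n / (real ?N - 1)) = ln (real n) - ln (real ?N - 1)"
    using N8 npos by (simp add: ln_div)
  have WM: "Wp M = ln (real ?R) + Kc * ln (real n / real ?N)" using R by (simp add: Wp_def Wf_def)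
  have gen_le: "gen Wp M v \<le> ra v * (4 * me + up) + rb v * dn + (if wild v then 0 else ra v / real ?R)" if v: "v \<in># M" for v
  proof -
    have N1: "?N - 1 > 0" "?N - 1 \<le> n" using N8 sz by auto
    have Rd: "nw (M - {#v#}) \<le> ?R" using nw_Diff(1)[OF v] by simp
    have "Wp (M - {#v#}) \<le> ln (real ?R) + Kc * ln (real n / real (?N - 1))"
      unfolding Wp_def size_Diff(1)[OF v] using Wf_le[OF R N1, of "nw (M - {#v#})"] Rd by auto
    then have dn_le: "Wp (M - {#v#}) - Wp M \<le> dn"
      unfolding WM dn_def using N1 N by (simp add: ln_eq ln_eq' algebra_simps)
    have Wup: "Wp (M - {#v#} + {#fst d, snd d#}) \<le> Wp M + up + (if nw (M - {#v#} + {#fst d, snd d#}) > ?R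
        then (real (nw (M - {#v#} + {#fst d, snd d#})) - real ?R) / real ?R else 0)" for d
    proof -
      let ?R' = "nw (M - {#v#} + {#fst d, snd d#})"
      have "Wp (M - {#v#} + {#fst d, snd d#}) = Wf ?R' (?N + 1)"
        by (simp only: Wp_def size_Diff(2)[OF v])
      moreover have "Wf ?R' (?N + 1) \<le> ln (real ?R) + (if ?R' > ?R then (real ?R' - real ?R) / real ?R else 0) + Kc * ln (real n / real (?N + 1))"
        using sz by (intro Wf_le[OF R]) auto
      moreover have "Kc * ln (real n / real (?N + 1)) = Kc * ln (real n / real ?N) + up"
      proof -
        have "ln (real n / real (?N + 1)) = ln (real n / real ?N) + (ln (real ?N) - ln (real (?N + 1)))"
          using ln_eq[OF N] ln_eq[of "?N + 1"] by simp
        then show ?thesis unfolding up_def distrib_left[symmetric] by simp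
      qed
      ultimately show ?thesis unfolding WM by linarith
    qed
    have up_le: "measure_pmf.expectation (dau2 v) (\<lambda>d. Wp (M - {#v#} + {#fst d, snd d#})) - Wp M \<le>
      up + (if wild v then 4 * me else 1 / real ?R)"
    proof (cases "wild v")
      case True
      have "measure_pmf.expectation (dau2 v) (\<lambda>d. Wp (M - {#v#} + {#fst d, snd d#})) \<le>
        (Wp M + up) + 2 * measure_pmf.prob (dau2 v) {d. \<not> wild (fst d) \<or> \<not> wild (snd d)}"
      proof (rule expectation_le_prob[OF finite_dau2])
        fix d :: "genome \<times> genome"
        let ?R' = "nw (M - {#v#} + {#fst d, snd d#})"
        have R': "?R' = ?R + (if wild (fst d) then 0 else 1) + (if wild (snd d) then 0 else 1)"
          using nw_Diff[OF v] True by simp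
        have "(if ?R' > ?R then (real ?R' - real ?R) / real ?R else 0) \<le> 2 * indicator {d. \<not> wild (fst d) \<or> \<not> wild (snd d)} d"
          using R unfolding R' by (auto simp: indicator_def field_simps)
        then show "Wp (M - {#v#} + {#fst d, snd d#}) \<le> (Wp M + up) + 2 * indicator {d. \<not> wild (fst d) \<or> \<not> wild (snd d)} d"
          using Wup[of d] by linarith
      qed
      then show ?thesis using prob_nonwild2[OF True] True by simp
    next
      case False
      have "measure_pmf.expectation (dau2 v) (\<lambda>d. Wp (M - {#v#} + {#fst d, snd d#})) \<le>
        (Wp M + up + 1 / real ?R) + 0 * measure_pmf.prob (dau2 v) UNIV"
      proof (rule expectation_le_prob[OF finite_dau2])
        fix d :: "genome \<times> genome"
        let ?R' = "nw (M - {#v#} + {#fst d, snd d#})"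
        have R': "?R' \<le> ?R + 1" using nw_Diff[OF v] False by simp
        then have "real ?R' - real ?R \<le> 1" by linarith
        then have "(real ?R' - real ?R) / real ?R \<le> 1 / real ?R" by (intro divide_right_mono) auto
        then have "(if ?R' > ?R then (real ?R' - real ?R) / real ?R else 0) \<le> 1 / real ?R" by simp
        then show "Wp (M - {#v#} + {#fst d, snd d#}) \<le> (Wp M + up + 1 / real ?R) + 0 * indicator UNIV d"
          using Wup[of d] by simp
      qed
      then show ?thesis using False by simp
    qed
    have "gen Wp M v \<le> ra v * (up + (if wild v then 4 * me else 1 / real ?R)) + rb v * dn"
      unfolding gen_def using up_le dn_le nonneg by (intro add_mono mult_left_mono) auto
    also have "\<dots> \<le> ra v * (4 * me + up) + rb v * dn + (if wild v then 0 else ra v / real ?R)"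
      using nonneg(1)[of "sel_part Ssel v"] me0 by (auto simp: algebra_simps)
    finally show ?thesis .
  qed
  have "(\<Sum>v\<in>#M. gen Wp M v) \<le> (\<Sum>v\<in>#M. ra v * (4 * me + up) + rb v * dn + (if wild v then 0 else ra v / real ?R))"
    using gen_le by (rule sum_mset_mono_real)
  also have "\<dots> = UA M * (4 * me + up) + UB M * dn + (\<Sum>v\<in>#M. if wild v then 0 else ra v / real ?R)"
    by (simp add: sum_mset.distrib sum_mset_distrib_right)
  also have "(\<Sum>v\<in>#M. if wild v then 0 else ra v / real ?R) \<le> real ?R * (Rm / real ?R)"
    by (rule sum_mset_nonwild) (use Rm in \<open>auto intro!: divide_right_mono\<close>)
  also have "real ?R * (Rm / real ?R) = Rm" using R by simp
  also have "UA M * (4 * me + up) + UB M * dn + Rm \<le> Zr M * (4 * me)"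
  proof -
    define t where "t = 1 / real ?N"
    have Mne: "M \<noteq> {#}" using N by auto
    have t: "0 < t" "t \<le> 1 / 8" using N8 by (auto simp: t_def field_simps)
    have "ln (1 + t) \<ge> t - t\<^sup>2" using t by (intro ln_one_plus_pos_lower_bound) auto
    moreover have "ln (real (?N + 1)) - ln (real ?N) = ln (1 + t)"
    proof -
      have "1 + t = real (?N + 1) / real ?N" using Mne by (simp add: t_def field_simps)
      then show ?thesis using N by (simp add: ln_div)
    qed
    ultimately have up_b: "up \<le> Kc * (- t + t\<^sup>2)" unfolding up_def using K0 by (intro mult_left_mono) auto
    have "ln (1 - t) \<ge> - t - 2 * t\<^sup>2" using t by (intro ln_one_minus_pos_lower_bound) auto
    moreover have "ln (real (?N - 1)) - ln (real ?N) = ln (1 - t)"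
    proof -
      have "1 - t = real (?N - 1) / real ?N" using Mne N8 by (simp add: t_def field_simps of_nat_diff)
      then show ?thesis using N8 Mne by (simp add: ln_div)
    qed
    ultimately have dn_b: "dn \<le> Kc * (t + 2 * t\<^sup>2)" unfolding dn_def using K0 by (intro mult_left_mono) auto
    have "UA M * up + UB M * dn \<le> UA M * (Kc * (- t + t\<^sup>2)) + UB M * (Kc * (t + 2 * t\<^sup>2))"
      using up_b dn_b UA_UB_bounds(4,5) by (intro add_mono mult_left_mono) auto
    also have "\<dots> = Kc * (- t * (UA M - UB M) + t\<^sup>2 * (UA M + 2 * UB M))" by (simp add: algebra_simps)
    also have "\<dots> \<le> Kc * (- t * (lam / (2 * (a + b)) * Zr M) + t\<^sup>2 * (2 * Zr M))"
    proof (rule mult_left_mono[OF _ K0])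
      have "t * (lam / (2 * (a + b)) * Zr M) \<le> t * (UA M - UB M)"
        using few_facts(5)[OF few] t by (intro mult_left_mono) auto
      moreover have "t\<^sup>2 * (UA M + 2 * UB M) \<le> t\<^sup>2 * (2 * Zr M)"
        using UA_UB_bounds(5)[of M] by (intro mult_left_mono) (auto simp: Zr_alt)
      ultimately show "- t * (UA M - UB M) + t\<^sup>2 * (UA M + 2 * UB M) \<le>
          - t * (lam / (2 * (a + b)) * Zr M) + t\<^sup>2 * (2 * Zr M)" by simp
    qed
    also have "\<dots> = Kc * (t * Zr M) * (2 * t - lam / (2 * (a + b)))"
    proof -
      have "K * (- t * (r * Z) + t\<^sup>2 * (2 * Z)) = K * (t * Z) * (2 * t - r)" for K Z r :: real
        by (simp add: algebra_simps power2_eq_square)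
      then show ?thesis by blast
    qed
    also have "\<dots> \<le> Kc * (t * Zr M) * (- (lam / (4 * (a + b))))"
    proof (intro mult_left_mono)
      have *: "2 * (1 / k) \<le> l / (4 * Q)" if "8 * Q \<le> k * l" "k > 0" "Q > 0" for k l Q :: real
        using that by (simp add: field_simps)
      have "2 * t \<le> lam / (4 * (a + b))" unfolding t_def by (rule *[OF big _ q(1)]) (use N8 in linarith)
      moreover have "2 * t - l / (2 * Q) \<le> - (l / (4 * Q))" if "2 * t \<le> l / (4 * Q)" for l Q :: real
        using that by simp
      ultimately show "2 * t - lam / (2 * (a + b)) \<le> - (lam / (4 * (a + b)))" by blast
    qed (use K0 t Z in auto)
    also have "\<dots> \<le> Kc * ((a + b) / 2) * (- (lam / (4 * (a + b))))"
    proof (intro mult_right_mono_neg mult_left_mono)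
      have *: "Q / 2 \<le> 1 / k * Z" if "k * Q / 2 \<le> Z" "k > 0" for k Q Z :: real
        using that by (simp add: field_simps)
      show "(a + b) / 2 \<le> t * Zr M" unfolding t_def by (rule *[OF few_facts(2)[OF few]]) (use N8 in linarith)
    qed (use K0 q in auto)
    also have "\<dots> = - Rm"
    proof -
      have "8 * r / l * (Q / 2) * (- (l / (4 * Q))) = - r" if "l > 0" "Q > 0" for r l Q :: real
        using that by (simp add: field_simps)
      then show ?thesis unfolding Kc_def using q by blast
    qed
    finally have "UA M * up + UB M * dn \<le> - Rm" .
    moreover have "UA M * (4 * me) \<le> Zr M * (4 * me)"
      using UA_UB_bounds(4)[of M] me0 by (intro mult_right_mono) (auto simp: Zr_alt)
    ultimately show ?thesis by (simp add: algebra_simps)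
  qed
  finally have "(\<Sum>v\<in>#M. gen Wp M v) / Zr M \<le> 4 * me" using Z by (simp add: field_simps)
  then show ?thesis unfolding expectation_stp[OF Z] .
qed

definition Db :: "genome multiset \<Rightarrow> real" where "Db M = of_bool (\<exists>v\<in>#M. dbl v)"

lemma Db_step:
  assumes few: "few M" and nd: "\<forall>v\<in>#M. \<not> dbl v"
  shows "measure_pmf.expectation (stp M) Db - Db M \<le> 2 * me\<^sup>2 + 4 * me * Rm * real (nw M) / (real (size M) * (a + b))"
proof -
  have Z: "Zr M > 0" by (rule few_facts(3)[OF few])
  have N: "size M > 0" using few by (simp add: few_def)
  have q: "a + b > 0" using a0 b0 by auto
  have D0: "Db M = 0" using nd by (simp add: Db_def)
  have gen_le: "gen Db M v \<le> ra v * (2 * me\<^sup>2) + (if wild v then 0 else ra v * (2 * me))" if v: "v \<in># M" for v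
  proof -
    have ndv: "\<forall>w\<in>#M - {#v#}. \<not> dbl w" using nd by (meson in_diffD)
    have D1: "Db (M - {#v#}) = 0" using ndv by (simp add: Db_def)
    have D2: "Db (M - {#v#} + {#fst d, snd d#}) \<le> 0 + 1 * indicator {d. dbl (fst d) \<or> dbl (snd d)} d" for d
      using ndv by (auto simp: Db_def indicator_def)
    have E: "measure_pmf.expectation (dau2 v) (\<lambda>d. Db (M - {#v#} + {#fst d, snd d#})) \<le>
      0 + 1 * measure_pmf.prob (dau2 v) {d. dbl (fst d) \<or> dbl (snd d)}"
      using D2 by (intro expectation_le_prob finite_dau2)
    have "measure_pmf.prob (dau2 v) {d. dbl (fst d) \<or> dbl (snd d)} \<le> 2 * (if wild v then me\<^sup>2 else me)"
    proof (rule prob_dau2)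
      have "{d. dbl d} \<subseteq> {d. \<exists>i\<in>Ssel \<union> T. d i \<noteq> v i}"
        using dbl_cong[of v] nd v by (metis (mono_tags, lifting) Collect_mono)
      then have "measure_pmf.prob (dau v) {d. dbl d} \<le> measure_pmf.prob (dau v) {d. \<exists>i\<in>Ssel \<union> T. d i \<noteq> v i}"
        by (intro measure_pmf.finite_measure_mono) auto
      then have "measure_pmf.prob (dau v) {d. dbl d} \<le> me" using prob_mut[of v] by linarith
      then show "measure_pmf.prob (dau v) {d. dbl d} \<le> (if wild v then me\<^sup>2 else me)"
        using prob_dbl_wild[of v] by auto
    qed
    then have "ra v * measure_pmf.expectation (dau2 v) (\<lambda>d. Db (M - {#v#} + {#fst d, snd d#})) \<le> ra v * (2 * (if wild v then me\<^sup>2 else me))"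
      using E nonneg by (intro mult_left_mono) auto
    then show ?thesis unfolding gen_def D0 D1 using nonneg(1)[of "sel_part Ssel v"]
      by (cases "wild v") (simp_all add: add_increasing)
  qed
  have "(\<Sum>v\<in>#M. gen Db M v) \<le> (\<Sum>v\<in>#M. ra v * (2 * me\<^sup>2) + (if wild v then 0 else ra v * (2 * me)))"
    using gen_le by (rule sum_mset_mono_real)
  also have "\<dots> = UA M * (2 * me\<^sup>2) + (\<Sum>v\<in>#M. if wild v then 0 else ra v * (2 * me))"
    by (simp add: sum_mset.distrib sum_mset_distrib_right)
  also have "(\<Sum>v\<in>#M. if wild v then 0 else ra v * (2 * me)) \<le> real (nw M) * (Rm * (2 * me))"
    by (rule sum_mset_nonwild) (rule mult_right_mono[OF Rm(1)], use me0 in simp)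
  also have "UA M * (2 * me\<^sup>2) \<le> Zr M * (2 * me\<^sup>2)"
    using UA_UB_bounds(4)[of M] by (intro mult_right_mono) (auto simp: Zr_alt)
  finally have "(\<Sum>v\<in>#M. gen Db M v) \<le> Zr M * (2 * me\<^sup>2) + real (nw M) * (Rm * (2 * me))" by simp
  also have "real (nw M) * (Rm * (2 * me)) \<le> Zr M * (4 * me * Rm * real (nw M) / (real (size M) * (a + b)))"
  proof -
    have "real (nw M) * (Rm * (2 * me)) = (real (size M) * (a + b) / 2) * (4 * me * Rm * real (nw M) / (real (size M) * (a + b)))"
    proof -
      have "r * (R * (2 * m)) = (k * Q / 2) * (4 * m * R * r / (k * Q))" if "k > 0" "Q > 0" for r R m k Q :: real
        using that by simp
      then show ?thesis using N q of_nat_0_less_iff by blast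
    qed
    also have "\<dots> \<le> Zr M * (4 * me * Rm * real (nw M) / (real (size M) * (a + b)))"
      using few_facts(2)[OF few] me0 Rm0 q by (intro mult_right_mono) auto
    finally show ?thesis .
  qed
  finally have "(\<Sum>v\<in>#M. gen Db M v) \<le> Zr M * (2 * me\<^sup>2 + 4 * me * Rm * real (nw M) / (real (size M) * (a + b)))"
    by (simp add: distrib_left)
  then have "(\<Sum>v\<in>#M. gen Db M v) / Zr M \<le> 2 * me\<^sup>2 + 4 * me * Rm * real (nw M) / (real (size M) * (a + b))"
    using Z by (simp add: pos_divide_le_eq mult.commute)
  then show ?thesis unfolding expectation_stp[OF Z] .
qed

end

section \<open>The approximating function\<close>

text \<open>A quantitative C2 class on the unit interval whose constant is additive under products;
  it yields derivative bounds for a power g ^ m that grow only polynomially in m.\<close>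
definition C2b :: "(real \<Rightarrow> real) \<Rightarrow> (real \<Rightarrow> real) \<Rightarrow> real \<Rightarrow> bool" where
  "C2b f f' L \<longleftrightarrow> L \<ge> 0 \<and> (\<forall>s\<in>{0..1}. \<bar>f s\<bar> \<le> 1 \<and> (f has_real_derivative f' s) (at s) \<and> \<bar>f' s\<bar> \<le> L \<and>
      (\<forall>t\<in>{0..1}. \<bar>f' s - f' t\<bar> \<le> L\<^sup>2 * \<bar>s - t\<bar>))"

lemma abs_mult_bound:
  fixes r t :: real
  assumes "\<bar>r\<bar> \<le> A" "\<bar>t\<bar> \<le> B"
  shows "\<bar>r * t\<bar> \<le> A * B"
proof -
  have "0 \<le> A" using assms(1) by linarith
  then show ?thesis unfolding abs_mult using assms by (intro mult_mono) auto
qed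

lemma lipschitz_of_DERIV:
  fixes f :: "real \<Rightarrow> real"
  assumes D: "\<And>s. s \<in> {0..1} \<Longrightarrow> (f has_real_derivative f' s) (at s)" and L: "\<And>s. s \<in> {0..1} \<Longrightarrow> \<bar>f' s\<bar> \<le> L"
    and st: "s \<in> {0..1}" "t \<in> {0..1}"
  shows "\<bar>f s - f t\<bar> \<le> L * \<bar>s - t\<bar>"
proof -
  have "norm (f s - f t) \<le> L * norm (s - t)"
  proof (rule field_differentiable_bound[of "{0..1}" f f'])
    show "(f has_field_derivative f' z) (at z within {0..1})" if "z \<in> {0..1}" for z
      using D[OF that] by (rule has_field_derivative_at_within)
  qed (use L st in auto)
  then show ?thesis by simp
qed

lemma C2b_lipschitz: "C2b f f' L \<Longrightarrow> s \<in> {0..1} \<Longrightarrow> t \<in> {0..1} \<Longrightarrow> \<bar>f s - f t\<bar> \<le> L * \<bar>s - t\<bar>"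
  by (rule lipschitz_of_DERIV[of f f']) (auto simp: C2b_def)

lemma C2b_taylor:
  assumes C: "C2b f f' L" and st: "s \<in> {0..1}" "t \<in> {0..1}"
  shows "\<bar>f t - f s - (t - s) * f' s\<bar> \<le> L\<^sup>2 * (t - s)\<^sup>2"
proof -
  let ?h = "\<lambda>r. f r - r * f' s"
  have "norm (?h t - ?h s) \<le> (L\<^sup>2 * \<bar>t - s\<bar>) * norm (t - s)"
  proof (rule field_differentiable_bound[of "{min s t..max s t}" ?h "\<lambda>r. f' r - f' s"])
    fix z assume z: "z \<in> {min s t..max s t}"
    then have z1: "z \<in> {0..1}" using st by auto
    have "(?h has_real_derivative f' z - f' s) (at z)"
      using C z1 by (auto simp: C2b_def intro!: derivative_eq_intros)
    then show "(?h has_field_derivative f' z - f' s) (at z within {min s t..max s t})"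
      by (rule has_field_derivative_at_within)
    have "\<bar>f' z - f' s\<bar> \<le> L\<^sup>2 * \<bar>z - s\<bar>" using C z1 st by (auto simp: C2b_def)
    also have "\<dots> \<le> L\<^sup>2 * \<bar>t - s\<bar>" using z by (intro mult_left_mono) auto
    finally show "norm (f' z - f' s) \<le> L\<^sup>2 * \<bar>t - s\<bar>" by simp
  qed auto
  then have "\<bar>?h t - ?h s\<bar> \<le> L\<^sup>2 * (\<bar>t - s\<bar> * \<bar>t - s\<bar>)" by (simp add: mult.assoc)
  then show ?thesis by (simp add: algebra_simps power2_eq_square flip: abs_mult)
qed

lemma C2b_mono:
  assumes "C2b f f' L" "L \<le> K"
  shows "C2b f f' K"
proof -
  have "L \<ge> 0" using assms by (simp add: C2b_def)
  have "L\<^sup>2 * r \<le> K\<^sup>2 * r" if "r \<ge> 0" for r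
    using assms \<open>L \<ge> 0\<close> that by (intro mult_right_mono power_mono) auto
  then show ?thesis using assms \<open>L \<ge> 0\<close> unfolding C2b_def by (smt (verit) abs_ge_zero)
qed

lemma C2b_mult:
  assumes f: "C2b f f' L" and g: "C2b g g' K"
  shows "C2b (\<lambda>s. f s * g s) (\<lambda>s. f' s * g s + f s * g' s) (L + K)"
  unfolding C2b_def
proof (intro conjI ballI)
  show "0 \<le> L + K" using f g by (simp add: C2b_def)
  fix s :: real assume s: "s \<in> {0..1}"
  have fs: "\<bar>f s\<bar> \<le> 1" "\<bar>f' s\<bar> \<le> L" "(f has_real_derivative f' s) (at s)" using f s by (auto simp: C2b_def)
  have gs: "\<bar>g s\<bar> \<le> 1" "\<bar>g' s\<bar> \<le> K" "(g has_real_derivative g' s) (at s)" using g s by (auto simp: C2b_def)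
  have L0: "L \<ge> 0" "K \<ge> 0" using f g by (auto simp: C2b_def)
  show "\<bar>f s * g s\<bar> \<le> 1" using fs gs by (simp add: abs_mult mult_le_one)
  show "((\<lambda>s. f s * g s) has_real_derivative f' s * g s + f s * g' s) (at s)"
    using fs gs by (auto intro!: derivative_eq_intros)
  have "\<bar>f' s * g s\<bar> \<le> L * 1" "\<bar>f s * g' s\<bar> \<le> 1 * K"
    using abs_mult_bound[OF fs(2) gs(1)] abs_mult_bound[OF fs(1) gs(2)] by simp_all
  then show "\<bar>f' s * g s + f s * g' s\<bar> \<le> L + K" by linarith
  fix t :: real assume t: "t \<in> {0..1}"
  have ft: "\<bar>f t\<bar> \<le> 1" "\<bar>f' t\<bar> \<le> L" and gt: "\<bar>g t\<bar> \<le> 1" "\<bar>g' t\<bar> \<le> K" using f g t by (auto simp: C2b_def)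
  have d: "\<bar>f' s - f' t\<bar> \<le> L\<^sup>2 * \<bar>s - t\<bar>" "\<bar>g' s - g' t\<bar> \<le> K\<^sup>2 * \<bar>s - t\<bar>" using f g s t by (auto simp: C2b_def)
  have l: "\<bar>f s - f t\<bar> \<le> L * \<bar>s - t\<bar>" "\<bar>g s - g t\<bar> \<le> K * \<bar>s - t\<bar>"
    using C2b_lipschitz[OF f s t] C2b_lipschitz[OF g s t] by auto
  have "f' s * g s + f s * g' s - (f' t * g t + f t * g' t) =
    (f' s - f' t) * g s + f' t * (g s - g t) + (f s - f t) * g' s + f t * (g' s - g' t)"
    by (simp add: algebra_simps)
  moreover have "\<bar>(f' s - f' t) * g s\<bar> \<le> (L\<^sup>2 * \<bar>s - t\<bar>) * 1" "\<bar>f' t * (g s - g t)\<bar> \<le> L * (K * \<bar>s - t\<bar>)"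
    "\<bar>(f s - f t) * g' s\<bar> \<le> (L * \<bar>s - t\<bar>) * K" "\<bar>f t * (g' s - g' t)\<bar> \<le> 1 * (K\<^sup>2 * \<bar>s - t\<bar>)"
    using abs_mult_bound[OF d(1) gs(1)] abs_mult_bound[OF ft(2) l(2)] abs_mult_bound[OF l(1) gs(2)]
      abs_mult_bound[OF ft(1) d(2)] by simp_all
  ultimately have "\<bar>f' s * g s + f s * g' s - (f' t * g t + f t * g' t)\<bar> \<le>
     L\<^sup>2 * \<bar>s - t\<bar> + L * (K * \<bar>s - t\<bar>) + (L * \<bar>s - t\<bar>) * K + K\<^sup>2 * \<bar>s - t\<bar>" by linarith
  also have "\<dots> = (L + K)\<^sup>2 * \<bar>s - t\<bar>" by (simp add: algebra_simps power2_eq_square)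
  finally show "\<bar>f' s * g s + f s * g' s - (f' t * g t + f t * g' t)\<bar> \<le> (L + K)\<^sup>2 * \<bar>s - t\<bar>" .
qed

lemma C2b_power:
  assumes g: "C2b g g' K"
  shows "C2b (\<lambda>s. g s ^ m) (\<lambda>s. real m * g s ^ (m - 1) * g' s) (real m * K)"
proof (induction m)
  case 0
  show ?case by (simp add: C2b_def)
next
  case (Suc m)
  have "(\<lambda>s. real m * g s ^ (m - 1) * g' s * g s + g s ^ m * g' s) = (\<lambda>s. real (Suc m) * g s ^ (Suc m - 1) * g' s)"
    by (cases m) (auto simp: algebra_simps)
  then show ?case using C2b_mult[OF Suc g] by (simp add: algebra_simps)
qed

lemma (in bp_model) expectation_dau2_prod:
  fixes f g :: "genome \<Rightarrow> real"
  shows "measure_pmf.expectation (dau2 v) (\<lambda>d. f (fst d) * g (snd d)) =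
    measure_pmf.expectation (dau v) f * measure_pmf.expectation (dau v) g"
proof -
  have fin: "finite (set_pmf (dau v))" by (rule finite_dau)
  have "measure_pmf.expectation (dau2 v) (\<lambda>d. f (fst d) * g (snd d)) =
    (\<Sum>d\<in>set_pmf (dau v) \<times> set_pmf (dau v). pmf (dau2 v) d * (f (fst d) * g (snd d)))"
    by (subst integral_measure_pmf_real[of "set_pmf (dau v) \<times> set_pmf (dau v)"]) (use fin in \<open>auto simp: mult.commute\<close>)
  also have "\<dots> = (\<Sum>d1\<in>set_pmf (dau v). \<Sum>d2\<in>set_pmf (dau v). (pmf (dau v) d1 * f d1) * (pmf (dau v) d2 * g d2))"
    unfolding sum.cartesian_product split_beta' by (intro sum.cong refl) (auto simp: pmf_pair mult_ac)
  also have "\<dots> = (\<Sum>d1\<in>set_pmf (dau v). pmf (dau v) d1 * f d1) * (\<Sum>d2\<in>set_pmf (dau v). pmf (dau v) d2 * g d2)"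
    by (simp add: sum_product)
  also have "\<dots> = measure_pmf.expectation (dau v) f * measure_pmf.expectation (dau v) g"
    using fin by (simp add: integral_measure_pmf_real[of "set_pmf (dau v)"] mult.commute)
  finally show ?thesis .
qed

lemma prod_one_minus_bounds:
  fixes e :: "'i \<Rightarrow> real"
  assumes "finite T" and e: "\<And>i. i \<in> T \<Longrightarrow> 0 \<le> e i \<and> e i \<le> 1"
  shows "1 - (\<Sum>i\<in>T. e i) \<le> (\<Prod>i\<in>T. 1 - e i)" "(\<Prod>i\<in>T. 1 - e i) \<le> 1 - (\<Sum>i\<in>T. e i) + (\<Sum>i\<in>T. e i)\<^sup>2"
    "0 \<le> (\<Prod>i\<in>T. 1 - e i)" "(\<Prod>i\<in>T. 1 - e i) \<le> 1"
proof -
  have "1 - (\<Sum>i\<in>T. e i) \<le> (\<Prod>i\<in>T. 1 - e i) \<and> (\<Prod>i\<in>T. 1 - e i) \<le> 1 - (\<Sum>i\<in>T. e i) + (\<Sum>i\<in>T. e i)\<^sup>2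
     \<and> 0 \<le> (\<Prod>i\<in>T. 1 - e i) \<and> (\<Prod>i\<in>T. 1 - e i) \<le> 1"
    using assms
  proof (induction T rule: finite_induct)
    case (insert j T)
    let ?s = "\<Sum>i\<in>T. e i" and ?p = "\<Prod>i\<in>T. 1 - e i"
    have ih: "1 - ?s \<le> ?p" "?p \<le> 1 - ?s + ?s\<^sup>2" "0 \<le> ?p" "?p \<le> 1" using insert by auto
    have ej: "0 \<le> e j" "e j \<le> 1" using insert by auto
    have s0: "?s \<ge> 0" using insert by (intro sum_nonneg) auto
    have 1: "(1 - e j) * ?p \<le> ?p" "0 \<le> (1 - e j) * ?p" using ih ej by (auto simp: mult_left_le_one_le)
    have "e j * ?p \<le> e j * 1" using ej ih by (intro mult_left_mono) auto
    then have 2: "1 - (e j + ?s) \<le> (1 - e j) * ?p" using ih by (simp add: algebra_simps)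
    have "e j * (1 - ?s) \<le> e j * ?p" using ej ih by (intro mult_left_mono) auto
    then have "(1 - e j) * ?p \<le> 1 - ?s + ?s\<^sup>2 - e j * (1 - ?s)" using ih by (simp add: algebra_simps)
    also have "\<dots> \<le> 1 - (e j + ?s) + (e j + ?s)\<^sup>2"
      using ej s0 by (simp add: algebra_simps power2_eq_square)
    finally show ?case using 1 2 ih insert by (simp del: power2_sum)
  qed auto
  then show "1 - (\<Sum>i\<in>T. e i) \<le> (\<Prod>i\<in>T. 1 - e i)" "(\<Prod>i\<in>T. 1 - e i) \<le> 1 - (\<Sum>i\<in>T. e i) + (\<Sum>i\<in>T. e i)\<^sup>2"
    "0 \<le> (\<Prod>i\<in>T. 1 - e i)" "(\<Prod>i\<in>T. 1 - e i) \<le> 1" by auto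
qed

locale bp_pgf = bp_sites +
  fixes x \<nu> \<delta> :: real
  assumes x: "0 \<le> x" "x < 1" and ne: "a - b \<noteq> a * (1 - x)" and nu: "\<nu> \<ge> 0"
    and dev: "\<bar>real n * (\<Sum>i\<in>T. 1 - pmf (\<mu> i (u i)) (u i)) - \<nu>\<bar> \<le> \<delta>"
begin

sublocale bd: bd_params a "a - b" "1 - x"
  by unfold_locales (use ab b0 x ne in auto)

definition phi :: "real \<Rightarrow> real" where "phi s = bd_phi a lam (1 - x) s"
definition cc :: real where "cc = 2 * a * \<nu> / lam"
definition kap :: real where "kap = (lam - a * (1 - x)) / (lam * (1 - x))"
definition H :: "real \<Rightarrow> real" where "H s = exp (cc * bd_I a lam (1 - x) s)"
definition Phi :: "nat \<Rightarrow> real \<Rightarrow> real" where "Phi m s = (1 - phi s) ^ m * H s"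
definition Phi' :: "nat \<Rightarrow> real \<Rightarrow> real" where
  "Phi' m s = real m * (1 - phi s) ^ (m - 1) * (kap * (phi s)\<^sup>2) * H s + (1 - phi s) ^ m * (cc * phi s * H s)"
definition L0 :: real where "L0 = 2 * \<bar>kap\<bar> + cc"

lemma cc0: "cc \<ge> 0" using nu a0 ab by (simp add: cc_def)
lemma L00: "L0 \<ge> 0" using cc0 by (simp add: L0_def)
lemma lam_cc: "lam * cc = 2 * a * \<nu>" using ab by (simp add: cc_def)
lemma phi_bounds: "s \<in> {0..1} \<Longrightarrow> 0 \<le> phi s \<and> phi s \<le> 1"
  using bd.phi_bounds[of s] by (auto simp: phi_def)
lemma H_bounds: "s \<in> {0..1} \<Longrightarrow> 0 \<le> H s \<and> H s \<le> 1"
  using bd.I_le_0[of s] cc0 by (auto simp: H_def mult_nonneg_nonpos)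

lemma DERIV_phi: "s \<in> {0..1} \<Longrightarrow> (phi has_real_derivative - (kap * (phi s)\<^sup>2)) (at s)"
  using bd.DERIV_phi[of s] unfolding phi_def[abs_def] kap_def by simp

lemma phi_lipschitz: "s \<in> {0..1} \<Longrightarrow> t \<in> {0..1} \<Longrightarrow> \<bar>phi s - phi t\<bar> \<le> \<bar>kap\<bar> * \<bar>s - t\<bar>"
proof (rule lipschitz_of_DERIV[OF DERIV_phi])
  fix r :: real assume "r \<in> {0..1}"
  then have "(phi r)\<^sup>2 \<le> 1" using phi_bounds[of r] by (simp add: power_le_one)
  then show "\<bar>- (kap * (phi r)\<^sup>2)\<bar> \<le> \<bar>kap\<bar>" by (simp add: abs_mult mult_left_le)
qed auto

lemma C2b_g: "C2b (\<lambda>s. 1 - phi s) (\<lambda>s. kap * (phi s)\<^sup>2) (2 * \<bar>kap\<bar>)"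
  unfolding C2b_def
proof (intro conjI ballI)
  fix s :: real assume s: "s \<in> {0..1}"
  show "\<bar>1 - phi s\<bar> \<le> 1" using phi_bounds[OF s] by auto
  show "((\<lambda>s. 1 - phi s) has_real_derivative kap * (phi s)\<^sup>2) (at s)"
    using DERIV_phi[OF s] by (auto intro!: derivative_eq_intros)
  have "(phi s)\<^sup>2 \<le> 1" using phi_bounds[OF s] by (simp add: power_le_one)
  then have "\<bar>kap * (phi s)\<^sup>2\<bar> \<le> \<bar>kap\<bar>" by (simp add: abs_mult mult_left_le)
  then show "\<bar>kap * (phi s)\<^sup>2\<bar> \<le> 2 * \<bar>kap\<bar>" by linarith
  fix t :: real assume t: "t \<in> {0..1}"
  have "kap * (phi s)\<^sup>2 - kap * (phi t)\<^sup>2 = kap * ((phi s + phi t) * (phi s - phi t))"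
    by (simp add: algebra_simps power2_eq_square)
  then have "\<bar>kap * (phi s)\<^sup>2 - kap * (phi t)\<^sup>2\<bar> = \<bar>kap\<bar> * (\<bar>phi s + phi t\<bar> * \<bar>phi s - phi t\<bar>)"
    by (simp add: abs_mult)
  also have "\<dots> \<le> \<bar>kap\<bar> * (2 * (\<bar>kap\<bar> * \<bar>s - t\<bar>))"
    using phi_lipschitz[OF s t] phi_bounds[OF s] phi_bounds[OF t] by (intro mult_left_mono mult_mono) auto
  also have "\<dots> \<le> (2 * \<bar>kap\<bar>)\<^sup>2 * \<bar>s - t\<bar>"
  proof -
    have "k * (2 * (k * r)) \<le> (2 * k)\<^sup>2 * r" if "r \<ge> 0" for k r :: real
      using that mult_nonneg_nonneg[of "k\<^sup>2" r] by (simp add: power2_eq_square mult_ac)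
    then show ?thesis by simp
  qed
  finally show "\<bar>kap * (phi s)\<^sup>2 - kap * (phi t)\<^sup>2\<bar> \<le> (2 * \<bar>kap\<bar>)\<^sup>2 * \<bar>s - t\<bar>" .
qed simp

lemma DERIV_H: "s \<in> {0..1} \<Longrightarrow> (H has_real_derivative cc * phi s * H s) (at s)"
  unfolding H_def[abs_def] phi_def using bd.DERIV_I[of s] by (auto intro!: derivative_eq_intros)

lemma C2b_H: "C2b H (\<lambda>s. cc * phi s * H s) L0"
  unfolding C2b_def
proof (intro conjI ballI)
  have b: "\<bar>cc * phi s * H s\<bar> \<le> cc" if "s \<in> {0..1}" for s
  proof -
    have "phi s * H s \<le> 1" using phi_bounds[OF that] H_bounds[OF that] by (intro mult_le_one) auto
    then have "cc * (phi s * H s) \<le> cc * 1" using cc0 by (rule mult_left_mono)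
    then show ?thesis using phi_bounds[OF that] H_bounds[OF that] cc0 by (simp add: mult.assoc)
  qed
  fix s :: real assume s: "s \<in> {0..1}"
  show "\<bar>H s\<bar> \<le> 1" using H_bounds[OF s] by auto
  show "(H has_real_derivative cc * phi s * H s) (at s)" by (rule DERIV_H[OF s])
  show "\<bar>cc * phi s * H s\<bar> \<le> L0" using b[OF s] by (simp add: L0_def)
  fix t :: real assume t: "t \<in> {0..1}"
  have Hl: "\<bar>H s - H t\<bar> \<le> cc * \<bar>s - t\<bar>" by (rule lipschitz_of_DERIV[OF DERIV_H b s t])
  have "cc * phi s * H s - cc * phi t * H t = cc * ((phi s - phi t) * H s + phi t * (H s - H t))"
    by (simp add: algebra_simps)
  moreover have "\<bar>(phi s - phi t) * H s + phi t * (H s - H t)\<bar> \<le> (\<bar>kap\<bar> * \<bar>s - t\<bar>) * 1 + 1 * (cc * \<bar>s - t\<bar>)"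
  proof -
    have "\<bar>(phi s - phi t) * H s\<bar> \<le> (\<bar>kap\<bar> * \<bar>s - t\<bar>) * 1" "\<bar>phi t * (H s - H t)\<bar> \<le> 1 * (cc * \<bar>s - t\<bar>)"
      using abs_mult_bound[OF phi_lipschitz[OF s t], of "H s" 1] abs_mult_bound[OF _ Hl, of "phi t" 1]
        H_bounds[OF s] phi_bounds[OF t] by simp_all
    then show ?thesis by linarith
  qed
  ultimately have "\<bar>cc * phi s * H s - cc * phi t * H t\<bar> \<le> cc * ((\<bar>kap\<bar> * \<bar>s - t\<bar>) * 1 + 1 * (cc * \<bar>s - t\<bar>))"
    using cc0 by (simp add: abs_mult mult_left_mono)
  also have "\<dots> = (cc * (\<bar>kap\<bar> + cc)) * \<bar>s - t\<bar>" by (simp add: algebra_simps)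
  also have "\<dots> \<le> L0\<^sup>2 * \<bar>s - t\<bar>"
  proof (rule mult_right_mono)
    show "cc * (\<bar>kap\<bar> + cc) \<le> L0\<^sup>2" unfolding power2_eq_square L0_def using cc0 by (intro mult_mono) auto
  qed simp
  finally show "\<bar>cc * phi s * H s - cc * phi t * H t\<bar> \<le> L0\<^sup>2 * \<bar>s - t\<bar>" .
qed (rule L00)

lemma C2b_Phi: "C2b (Phi m) (Phi' m) (real (m + 1) * L0)"
proof -
  have "C2b (Phi m) (Phi' m) (real m * (2 * \<bar>kap\<bar>) + L0)"
    unfolding Phi_def[abs_def] Phi'_def[abs_def] by (rule C2b_mult[OF C2b_power[OF C2b_g] C2b_H])
  moreover have "real m * (2 * \<bar>kap\<bar>) \<le> real m * L0" using cc0 by (intro mult_left_mono) (auto simp: L0_def)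
  ultimately show ?thesis by (elim C2b_mono) (simp add: algebra_simps)
qed

lemma Phi_bounds: "s \<in> {0..1} \<Longrightarrow> 0 \<le> Phi m s \<and> Phi m s \<le> 1"
  unfolding Phi_def using phi_bounds[of s] H_bounds[of s] by (auto intro!: mult_le_one power_le_one)

lemma Phi_pde:
  assumes s: "s \<in> {0..1}"
  shows "s * (lam * Phi' m s - 2 * a * \<nu> * phi s * Phi m s) +
     real m * (a * (Phi (m + 1) s - Phi m s) + b * (Phi (m - 1) s - Phi m s)) = 0"
proof (cases m)
  case 0
  then show ?thesis unfolding lam_cc[symmetric] by (simp add: Phi'_def Phi_def)
next
  case (Suc k)
  let ?g = "1 - phi s"
  have ode: "lam * s * (kap * (phi s)\<^sup>2) = (lam - a * phi s) * phi s"
    using bd.phi_ode[of s] s by (simp add: phi_def kap_def)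
  have "lam * Phi' m s - 2 * a * \<nu> * phi s * Phi m s = lam * (real m * ?g ^ k * (kap * (phi s)\<^sup>2) * H s)"
    unfolding lam_cc[symmetric] by (simp add: Phi'_def Phi_def Suc algebra_simps)
  then have "s * (lam * Phi' m s - 2 * a * \<nu> * phi s * Phi m s) = real m * ?g ^ k * H s * (lam * s * (kap * (phi s)\<^sup>2))"
    by (simp only: mult_ac)
  also have "\<dots> = real m * ?g ^ k * H s * ((lam - a * phi s) * phi s)" by (simp only: ode)
  finally have 1: "s * (lam * Phi' m s - 2 * a * \<nu> * phi s * Phi m s) = real m * (?g ^ k * H s * ((lam - a * phi s) * phi s))"
    by (simp only: mult_ac)
  have "a * (Phi (m + 1) s - Phi m s) + b * (Phi (m - 1) s - Phi m s) = ?g ^ k * H s * (a * (?g * ?g - ?g) + b * (1 - ?g))"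
    by (simp add: Phi_def Suc algebra_simps)
  also have "a * (?g * ?g - ?g) + b * (1 - ?g) = - ((lam - a * phi s) * phi s)" by (simp add: algebra_simps)
  finally show ?thesis unfolding 1 distrib_left[symmetric] by simp
qed

end

lemma sum_mset_abs_le:
  fixes f g :: "'a \<Rightarrow> real"
  assumes "\<And>v. v \<in># M \<Longrightarrow> \<bar>f v\<bar> \<le> g v"
  shows "\<bar>\<Sum>v\<in>#M. f v\<bar> \<le> (\<Sum>v\<in>#M. g v)"
proof -
  have "(\<Sum>v\<in>#M. f v) \<le> (\<Sum>v\<in>#M. g v)" using assms by (intro sum_mset_mono_real) (auto simp: abs_le_iff)
  moreover have "(\<Sum>v\<in>#M. - f v) \<le> (\<Sum>v\<in>#M. g v)" using assms by (intro sum_mset_mono_real) (auto simp: abs_le_iff)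
  moreover have "(\<Sum>v\<in>#M. - f v) = - (\<Sum>v\<in>#M. f v)" by (induction M) auto
  ultimately show ?thesis by (simp add: abs_le_iff)
qed

context bp_pgf begin

lemma E00: "E0 \<ge> 0"
  using me0 npos by (simp add: me_def field_simps)

lemma kap_le: "\<bar>kap\<bar> \<le> L0" using cc0 by (simp add: L0_def)

lemma sum_mu0_T: "(\<Sum>i\<in>T. mu0 i) \<le> me"
proof -
  have "(\<Sum>i\<in>T. mu0 i) \<le> (\<Sum>i\<in>Ssel \<union> T. mu0 i)"
    using finT finSel mu0_nonneg by (intro sum_mono2) auto
  then show ?thesis using sum_mu0 by linarith
qed

lemma division_factor:
  assumes v: "wild v" and s: "s \<in> {0..1}" and t: "t \<in> {0..1}" and st: "\<bar>t - s\<bar> \<le> 1 / real n"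
  defines "p \<equiv> measure_pmf.expectation (dau2 v) (\<lambda>d. (1 - phi t) ^ (ct (fst d) + ct (snd d)))"
  shows "\<bar>p - 1\<bar> \<le> 2 * me" "\<bar>p - 1 + 2 * phi s * \<nu> / real n\<bar> \<le> 3 * me\<^sup>2 + 2 * \<bar>kap\<bar> * me / real n + 2 * \<delta> / real n"
proof -
  define pi where "pi = measure_pmf.expectation (dau v) (\<lambda>d. (1 - phi t) ^ ct d)"
  have p: "p = pi\<^sup>2"
    unfolding p_def pi_def power_add
    using expectation_dau2_prod[of v "\<lambda>d. (1 - phi t) ^ ct d" "\<lambda>d. (1 - phi t) ^ ct d"] by (simp add: power2_eq_square)
  have pt: "0 \<le> phi t" "phi t \<le> 1" using phi_bounds[OF t] by auto
  have ps: "0 \<le> phi s" "phi s \<le> 1" using phi_bounds[OF s] by auto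
  define m0 where "m0 = (\<Sum>i\<in>T. mu0 i)"
  define S0 where "S0 = m0 * phi t"
  have m0: "0 \<le> m0" "m0 \<le> me" using sum_mu0_T mu0_nonneg by (auto simp: m0_def intro!: sum_nonneg)
  have S0: "0 \<le> S0" "S0 \<le> me" using m0 pt mult_mono[of m0 me "phi t" 1] me0 by (auto simp: S0_def)
  have pi_eq: "pi = (\<Prod>i\<in>T. 1 - mu0 i * phi t)"
    unfolding pi_def using expectation_dau_ct[OF v, of "1 - phi t"] pt by simp
  have e: "0 \<le> mu0 i * phi t \<and> mu0 i * phi t \<le> 1" for i
    using mu0_nonneg[of i] pt by (auto simp: mu0_def intro!: mult_le_one)
  have S0_eq: "(\<Sum>i\<in>T. mu0 i * phi t) = S0" by (simp add: S0_def m0_def sum_distrib_right)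
  have pi: "1 - S0 \<le> pi" "pi \<le> 1 - S0 + S0\<^sup>2" "0 \<le> pi" "pi \<le> 1"
    using prod_one_minus_bounds[OF finT, of "\<lambda>i. mu0 i * phi t"] e unfolding pi_eq S0_eq by auto
  have S02: "S0\<^sup>2 \<le> me\<^sup>2" using S0 by (intro power_mono) auto
  have "\<bar>pi - 1\<bar> \<le> me" using pi S0 by auto
  have "p - 1 = (pi - 1) * (pi + 1)" by (simp add: p power2_eq_square algebra_simps)
  then have "\<bar>p - 1\<bar> = \<bar>pi - 1\<bar> * \<bar>pi + 1\<bar>" by (simp add: abs_mult)
  also have "\<dots> \<le> me * 2" using \<open>\<bar>pi - 1\<bar> \<le> me\<close> pi by (intro mult_mono) (auto simp: me0)
  finally show "\<bar>p - 1\<bar> \<le> 2 * me" by simp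
  have sq: "(pi - 1)\<^sup>2 \<le> me\<^sup>2" using \<open>\<bar>pi - 1\<bar> \<le> me\<close> by (metis abs_ge_zero power2_abs power_mono)
  have m0n: "\<bar>m0 - \<nu> / real n\<bar> \<le> \<delta> / real n"
  proof -
    have "m0 - \<nu> / real n = (real n * m0 - \<nu>) / real n" using npos by (simp add: field_simps)
    then have "\<bar>m0 - \<nu> / real n\<bar> = \<bar>real n * m0 - \<nu>\<bar> / real n" by (simp add: abs_divide)
    also have "\<dots> \<le> \<delta> / real n" using dev unfolding m0_def mu0_def by (intro divide_right_mono) auto
    finally show ?thesis .
  qed
  have "S0 - phi s * \<nu> / real n = m0 * (phi t - phi s) + phi s * (m0 - \<nu> / real n)"
    by (simp add: S0_def algebra_simps)
  moreover have "\<bar>m0 * (phi t - phi s)\<bar> \<le> me * (\<bar>kap\<bar> * (1 / real n))"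
  proof (rule abs_mult_bound)
    have "\<bar>phi t - phi s\<bar> \<le> \<bar>kap\<bar> * \<bar>t - s\<bar>" by (rule phi_lipschitz[OF t s])
    also have "\<dots> \<le> \<bar>kap\<bar> * (1 / real n)" using st by (intro mult_left_mono) auto
    finally show "\<bar>phi t - phi s\<bar> \<le> \<bar>kap\<bar> * (1 / real n)" .
  qed (use m0 in auto)
  moreover have "\<bar>phi s * (m0 - \<nu> / real n)\<bar> \<le> 1 * (\<delta> / real n)"
    by (rule abs_mult_bound[OF _ m0n]) (use ps in auto)
  ultimately have S0d: "\<bar>S0 - phi s * \<nu> / real n\<bar> \<le> \<bar>kap\<bar> * me / real n + \<delta> / real n" by (simp add: mult_ac)
  have "p - 1 + 2 * phi s * \<nu> / real n = (pi - 1)\<^sup>2 + 2 * (pi - 1 + S0) - 2 * (S0 - phi s * \<nu> / real n)"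
    by (simp add: p power2_eq_square algebra_simps)
  moreover have "\<bar>pi - 1 + S0\<bar> \<le> me\<^sup>2" using pi S02 by auto
  ultimately have "\<bar>p - 1 + 2 * phi s * \<nu> / real n\<bar> \<le> me\<^sup>2 + 2 * me\<^sup>2 + 2 * (\<bar>kap\<bar> * me / real n + \<delta> / real n)"
  proof -
    have "\<bar>A + 2 * B - 2 * C\<bar> \<le> r + 2 * t + 2 * w" if "0 \<le> A" "A \<le> r" "\<bar>B\<bar> \<le> t" "\<bar>C\<bar> \<le> w" for A B C r t w :: real
      using that by linarith
    from this[OF zero_le_power2 sq \<open>\<bar>pi - 1 + S0\<bar> \<le> me\<^sup>2\<close> S0d] show ?thesis unfolding \<open>p - 1 + _ = _\<close> .
  qed
  then show "\<bar>p - 1 + 2 * phi s * \<nu> / real n\<bar> \<le> 3 * me\<^sup>2 + 2 * \<bar>kap\<bar> * me / real n + 2 * \<delta> / real n"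
    by (simp add: algebra_simps)
qed

definition Fm :: "genome multiset \<Rightarrow> real" where "Fm M = Phi (mc M) (real (size M) / real n)"

definition Psi :: "genome multiset \<Rightarrow> real" where "Psi M = (1 - (b / a) ^ size M) * Fm M"

lemma in_unit: "N \<le> n \<Longrightarrow> real N / real n \<in> {0..1}" using npos by simp

lemma Phi_add: "Phi (m + k) s = (1 - phi s) ^ k * Phi m s"
  by (simp add: Phi_def power_add)

lemma gen_Fm_wild:
  assumes v: "v \<in># M" "wild v" and sz: "size M < n"
  defines "s \<equiv> real (size M) / real n" and "m \<equiv> mc M"
  defines "L \<equiv> real (m + 1) * L0"
  shows "\<bar>gen Fm M v - (lam * Phi' m s - 2 * a * \<nu> * phi s * Phi m s) / real n\<bar> \<le>
    (a + b) * (3 * (L + E0)\<^sup>2 / (real n)\<^sup>2 + 2 * \<delta> / real n)"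
proof -
  let ?N = "size M"
  define h where "h = 1 / real n"
  have N: "?N > 0" using v(1) by (metis nonempty_has_size empty_iff set_mset_empty)
  have h0: "h > 0" using npos by (simp add: h_def)
  have sp: "real (?N + 1) / real n = s + h" by (simp add: s_def h_def add_divide_distrib)
  have sm: "real (?N - 1) / real n = s - h" using N by (simp add: s_def h_def diff_divide_distrib of_nat_diff)
  have s1: "s \<in> {0..1}" "s + h \<in> {0..1}" "s - h \<in> {0..1}"
    using in_unit[of ?N] in_unit[of "?N + 1"] in_unit[of "?N - 1"] sz unfolding sp sm s_def by auto
  have L: "L \<ge> 0" using L00 by (simp add: L_def)
  have kL: "\<bar>kap\<bar> \<le> L"
  proof -
    have "1 * L0 \<le> real (m + 1) * L0" using L00 by (intro mult_right_mono) auto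
    then show ?thesis using kap_le by (simp add: L_def)
  qed
  define p where "p = measure_pmf.expectation (dau2 v) (\<lambda>d. (1 - phi (s + h)) ^ (ct (fst d) + ct (snd d)))"
  define P0 P1 Pm D where "P0 = Phi m s" and "P1 = Phi m (s + h)" and "Pm = Phi m (s - h)" and "D = Phi' m s"
  have A4: "\<bar>p - 1\<bar> \<le> 2 * me" and A5: "\<bar>p - 1 + 2 * phi s * \<nu> / real n\<bar> \<le> 3 * me\<^sup>2 + 2 * \<bar>kap\<bar> * me / real n + 2 * \<delta> / real n"
  proof -
    have st: "\<bar>(s + h) - s\<bar> \<le> 1 / real n" using h0 by (simp add: h_def)
    show "\<bar>p - 1\<bar> \<le> 2 * me" unfolding p_def by (rule division_factor(1)[OF v(2) s1(1,2) st])
    show "\<bar>p - 1 + 2 * phi s * \<nu> / real n\<bar> \<le> 3 * me\<^sup>2 + 2 * \<bar>kap\<bar> * me / real n + 2 * \<delta> / real n"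
      unfolding p_def by (rule division_factor(2)[OF v(2) s1(1,2) st])
  qed
  have mcv: "mc (M - {#v#}) = m" using mc_Diff(1)[OF v(1)] ct_wild[OF v(2)] by (simp add: m_def)
  have "Fm (M - {#v#} + {#fst d, snd d#}) = P1 * (1 - phi (s + h)) ^ (ct (fst d) + ct (snd d))" for d
    unfolding Fm_def size_Diff(2)[OF v(1)] mc_Diff(2)[OF v(1)] mcv sp add.assoc[of m] Phi_add P1_def by simp
  then have up: "measure_pmf.expectation (dau2 v) (\<lambda>d. Fm (M - {#v#} + {#fst d, snd d#})) = P1 * p"
    unfolding p_def by simp
  have dn: "Fm (M - {#v#}) = Pm" unfolding Fm_def size_Diff(1)[OF v(1)] mcv sm Pm_def ..
  have z: "Fm M = P0" by (simp add: Fm_def P0_def m_def s_def)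
  have C: "C2b (Phi m) (Phi' m) L" unfolding L_def by (rule C2b_Phi)
  have A1: "\<bar>P1 - P0 - h * D\<bar> \<le> L\<^sup>2 * h\<^sup>2" using C2b_taylor[OF C s1(1,2)] by (simp add: P1_def P0_def D_def)
  have A2: "\<bar>Pm - P0 + h * D\<bar> \<le> L\<^sup>2 * h\<^sup>2" using C2b_taylor[OF C s1(1,3)] by (simp add: Pm_def P0_def D_def)
  have A3: "\<bar>P1 - P0\<bar> \<le> L * h" using C2b_lipschitz[OF C s1(2,1)] h0 by (simp add: P1_def P0_def)
  have P0: "\<bar>P0\<bar> \<le> 1" using Phi_bounds[OF s1(1), of m] by (simp add: P0_def)
  have me: "me = E0 * h" by (simp add: me_def h_def)
  define X where "X = (P1 - P0 - h * D) + (P1 - P0) * (p - 1) + P0 * (p - 1 + 2 * phi s * \<nu> / real n)"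
  have geq: "gen Fm M v = a * (P1 * p - P0) + b * (Pm - P0)"
    unfolding gen_def up dn z using rates_wild[OF v(2)] by simp
  have eq: "gen Fm M v - (lam * D - 2 * a * \<nu> * phi s * P0) / real n = a * X + b * (Pm - P0 + h * D)"
    unfolding geq X_def h_def using npos by (simp add: field_simps)
  have "\<bar>X\<bar> \<le> L\<^sup>2 * h\<^sup>2 + (L * h) * (2 * me) + 1 * (3 * me\<^sup>2 + 2 * \<bar>kap\<bar> * me / real n + 2 * \<delta> / real n)"
    using A1 abs_mult_bound[OF A3 A4] abs_mult_bound[OF P0 A5] unfolding X_def by linarith
  also have "\<dots> = (L\<^sup>2 + 2 * L * E0 + 3 * E0\<^sup>2 + 2 * \<bar>kap\<bar> * E0) * h\<^sup>2 + 2 * \<delta> / real n"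
    unfolding me by (simp add: h_def power2_eq_square algebra_simps add_divide_distrib)
  also have "\<dots> \<le> 3 * (L + E0)\<^sup>2 * h\<^sup>2 + 2 * \<delta> / real n"
  proof -
    have "\<bar>kap\<bar> * E0 \<le> L * E0" using kL E00 by (intro mult_right_mono) auto
    moreover have "L\<^sup>2 \<ge> 0" "L * E0 \<ge> 0" using L E00 by auto
    ultimately have "L\<^sup>2 + 2 * (L * E0) + 3 * E0\<^sup>2 + 2 * (\<bar>kap\<bar> * E0) \<le> 3 * L\<^sup>2 + 6 * (L * E0) + 3 * E0\<^sup>2"
      by linarith
    also have "\<dots> = 3 * (L + E0)\<^sup>2" by (simp add: power2_eq_square algebra_simps)
    finally have "L\<^sup>2 + 2 * L * E0 + 3 * E0\<^sup>2 + 2 * \<bar>kap\<bar> * E0 \<le> 3 * (L + E0)\<^sup>2" by (simp add: mult.assoc)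
    then show ?thesis by (intro add_right_mono mult_right_mono) auto
  qed
  finally have X: "\<bar>X\<bar> \<le> 3 * (L + E0)\<^sup>2 * h\<^sup>2 + 2 * \<delta> / real n" .
  have dpos: "\<delta> \<ge> 0" using dev by linarith
  have "L\<^sup>2 * h\<^sup>2 \<le> 3 * (L + E0)\<^sup>2 * h\<^sup>2"
  proof (rule mult_right_mono)
    have "L\<^sup>2 \<le> (L + E0)\<^sup>2" using L E00 by (intro power_mono) auto
    then show "L\<^sup>2 \<le> 3 * (L + E0)\<^sup>2" using zero_le_power2[of "L + E0"] by linarith
  qed simp
  then have Y: "\<bar>Pm - P0 + h * D\<bar> \<le> 3 * (L + E0)\<^sup>2 * h\<^sup>2 + 2 * \<delta> / real n"
    using A2 dpos divide_nonneg_nonneg[of "2 * \<delta>" "real n"] by linarith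
  have "\<bar>a * X + b * (Pm - P0 + h * D)\<bar> \<le> a * (3 * (L + E0)\<^sup>2 * h\<^sup>2 + 2 * \<delta> / real n) + b * (3 * (L + E0)\<^sup>2 * h\<^sup>2 + 2 * \<delta> / real n)"
    using abs_mult_bound[OF _ X, of a a] abs_mult_bound[OF _ Y, of b b] a0 b0 by linarith
  then show ?thesis using eq unfolding D_def P0_def by (simp add: h_def power_divide distrib_right)
qed

lemma gen_Fm_nonwild:
  assumes v: "v \<in># M" "\<not> dbl v" and sz: "size M < n"
  defines "s \<equiv> real (size M) / real n" and "m \<equiv> mc M"
  shows "\<bar>gen Fm M v - real (ct v) * (a * (Phi (m + 1) s - Phi m s) + b * (Phi (m - 1) s - Phi m s))\<bar> \<le>
    2 * Rm * (E0 + real (m + 2) * L0) / real n"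
proof -
  let ?N = "size M"
  define h where "h = 1 / real n"
  have N: "?N > 0" using v(1) by (metis nonempty_has_size empty_iff set_mset_empty)
  have h0: "h > 0" using npos by (simp add: h_def)
  have sp: "real (?N + 1) / real n = s + h" by (simp add: s_def h_def add_divide_distrib)
  have sm: "real (?N - 1) / real n = s - h" using N by (simp add: s_def h_def diff_divide_distrib of_nat_diff)
  have s1: "s \<in> {0..1}" "s + h \<in> {0..1}" "s - h \<in> {0..1}"
    using in_unit[of ?N] in_unit[of "?N + 1"] in_unit[of "?N - 1"] sz unfolding sp sm s_def by auto
  define c where "c = ct v"
  have c: "c \<le> 1" using ct_not_dbl[OF v(2)] by (auto simp: c_def split: if_splits)
  have cm: "c \<le> m" using mc_Diff(1)[OF v(1)] by (simp add: c_def m_def)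
  define L where "L = real (m + 2) * L0"
  have Lip: "\<bar>Phi k r - Phi k s\<bar> \<le> L * h" if "k \<le> m + 1" "r \<in> {0..1}" "\<bar>r - s\<bar> \<le> h" for k r
  proof -
    have "\<bar>Phi k r - Phi k s\<bar> \<le> (real (k + 1) * L0) * \<bar>r - s\<bar>" by (rule C2b_lipschitz[OF C2b_Phi that(2) s1(1)])
    also have "\<dots> \<le> L * h" unfolding L_def using that L00 by (intro mult_mono) auto
    finally show ?thesis .
  qed
  have mcv: "mc (M - {#v#}) = m - c" using mc_Diff(1)[OF v(1)] by (simp add: m_def c_def)
  define E2 where "E2 = measure_pmf.expectation (dau2 v) (\<lambda>d. Fm (M - {#v#} + {#fst d, snd d#}))"
  have "\<bar>E2 - Phi (m + c) (s + h)\<bar> \<le> 1 * measure_pmf.prob (dau2 v) {d. (\<exists>i\<in>Ssel \<union> T. fst d i \<noteq> v i) \<or> (\<exists>i\<in>Ssel \<union> T. snd d i \<noteq> v i)}"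
    unfolding E2_def
  proof (rule expectation_diff_le_prob[OF finite_dau2])
    fix d :: "genome \<times> genome"
    have F: "Fm (M - {#v#} + {#fst d, snd d#}) = Phi (m - c + ct (fst d) + ct (snd d)) (s + h)"
      unfolding Fm_def size_Diff(2)[OF v(1)] mc_Diff(2)[OF v(1)] mcv sp ..
    show "\<bar>Fm (M - {#v#} + {#fst d, snd d#}) - Phi (m + c) (s + h)\<bar> \<le>
      1 * indicator {d. (\<exists>i\<in>Ssel \<union> T. fst d i \<noteq> v i) \<or> (\<exists>i\<in>Ssel \<union> T. snd d i \<noteq> v i)} d"
    proof (cases "(\<exists>i\<in>Ssel \<union> T. fst d i \<noteq> v i) \<or> (\<exists>i\<in>Ssel \<union> T. snd d i \<noteq> v i)")
      case True
      then show ?thesis using Phi_bounds[OF s1(2), of "m - c + ct (fst d) + ct (snd d)"] Phi_bounds[OF s1(2), of "m + c"]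
        unfolding F by (auto simp: indicator_def abs_le_iff)
    next
      case False
      then have "ct (fst d) = c" "ct (snd d) = c" using ct_cong[of "fst d" v] ct_cong[of "snd d" v] by (auto simp: c_def)
      then have "m - c + ct (fst d) + ct (snd d) = m + c" using cm by simp
      then show ?thesis unfolding F using False by simp
    qed
  qed
  also have "\<dots> \<le> 2 * me" using prob_dau2[OF prob_mut[of v]] by simp
  finally have up1: "\<bar>E2 - Phi (m + c) (s + h)\<bar> \<le> 2 * me" .
  have up2: "\<bar>Phi (m + c) (s + h) - Phi (m + c) s\<bar> \<le> L * h" using c h0 s1 by (intro Lip) auto
  have dn: "\<bar>Fm (M - {#v#}) - Phi (m - c) s\<bar> \<le> L * h"
    unfolding Fm_def size_Diff(1)[OF v(1)] mcv sm using h0 s1 by (intro Lip) auto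
  have z: "Fm M = Phi m s" by (simp add: Fm_def m_def s_def)
  have tgt: "real c * (a * (Phi (m + 1) s - Phi m s) + b * (Phi (m - 1) s - Phi m s)) =
    ra v * (Phi (m + c) s - Phi m s) + rb v * (Phi (m - c) s - Phi m s)"
  proof (cases "c = 0")
    case False
    then have "c = 1" using c by simp
    then show ?thesis using ct_pos_unsel[OF v(2)] by (simp add: c_def)
  qed simp
  have "gen Fm M v - real c * (a * (Phi (m + 1) s - Phi m s) + b * (Phi (m - 1) s - Phi m s)) =
     ra v * (E2 - Phi (m + c) s) + rb v * (Fm (M - {#v#}) - Phi (m - c) s)"
    unfolding tgt gen_def E2_def[symmetric] z by (simp add: algebra_simps)
  moreover have "\<bar>ra v * (E2 - Phi (m + c) s)\<bar> \<le> Rm * (2 * me + L * h)"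
    by (rule abs_mult_bound) (use up1 up2 Rm nonneg in auto)
  moreover have "\<bar>rb v * (Fm (M - {#v#}) - Phi (m - c) s)\<bar> \<le> Rm * (L * h)"
    by (rule abs_mult_bound) (use dn Rm nonneg in auto)
  ultimately have "\<bar>gen Fm M v - real c * (a * (Phi (m + 1) s - Phi m s) + b * (Phi (m - 1) s - Phi m s))\<bar> \<le>
     Rm * (2 * me + L * h) + Rm * (L * h)" by linarith
  also have "\<dots> = 2 * Rm * (E0 + L) / real n" using npos by (simp add: me_def h_def field_simps)
  finally show ?thesis unfolding c_def L_def .
qed

lemma rho: "0 \<le> b / a" "b / a < 1" using ab b0 a0 by auto

lemma surv_bounds: "0 \<le> 1 - (b / a) ^ k" "1 - (b / a) ^ k \<le> 1"
  using rho by (auto intro!: power_le_one)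

lemma Fm_bounds: "size M \<le> n \<Longrightarrow> 0 \<le> Fm M \<and> Fm M \<le> 1"
  unfolding Fm_def by (rule Phi_bounds[OF in_unit])

lemma Psi_bounds: "size M \<le> n \<Longrightarrow> 0 \<le> Psi M \<and> Psi M \<le> 1"
  unfolding Psi_def using Fm_bounds surv_bounds[of "size M"] by (auto intro!: mult_le_one)

lemma Psi_step_small:
  assumes few: "few M" and sz: "size M < n" and R: "nw M = 0"
  shows "\<bar>measure_pmf.expectation (stp M) Psi - Psi M\<bar> \<le> 2 * me + L0 / real n"
proof -
  let ?N = "size M"
  define h where "h = 1 / real n"
  define s where "s = real ?N / real n"
  define r where "r = b / a"
  have N: "?N > 0" using few by (simp add: few_def)
  have Z: "Zr M > 0" by (rule few_facts(3)[OF few])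
  have h0: "h > 0" using npos by (simp add: h_def)
  have sp: "real (?N + 1) / real n = s + h" by (simp add: s_def h_def add_divide_distrib)
  have sm: "real (?N - 1) / real n = s - h" using N by (simp add: s_def h_def diff_divide_distrib of_nat_diff)
  have s1: "s \<in> {0..1}" "s + h \<in> {0..1}" "s - h \<in> {0..1}"
    using in_unit[of ?N] in_unit[of "?N + 1"] in_unit[of "?N - 1"] sz unfolding sp sm s_def by auto
  have m0: "mc M = 0"
    using nw_eq_0D[OF R] mc_le_nw[of M] dbl_wild R by auto
  define P0 where "P0 = Phi 0 s"
  have Lip: "\<bar>Phi 0 t - P0\<bar> \<le> L0 * \<bar>t - s\<bar>" if "t \<in> {0..1}" for t
    unfolding P0_def using C2b_lipschitz[OF C2b_Phi[of 0] that s1(1)] by simp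
  have P0: "0 \<le> P0" "P0 \<le> 1" using Phi_bounds[OF s1(1), of 0] by (auto simp: P0_def)
  have "\<bar>gen Psi M v\<bar> \<le> (ra v + rb v) * (2 * me + L0 * h)" if v: "v \<in># M" for v
  proof -
    have w: "wild v" by (rule nw_eq_0D[OF R v])
    have mcv: "mc (M - {#v#}) = 0" using mc_Diff(1)[OF v] m0 by simp
    define E2 where "E2 = measure_pmf.expectation (dau2 v) (\<lambda>d. Psi (M - {#v#} + {#fst d, snd d#}))"
    have "\<bar>E2 - (1 - r ^ (?N + 1)) * Phi 0 (s + h)\<bar> \<le> 1 * measure_pmf.prob (dau2 v) {d. \<not> wild (fst d) \<or> \<not> wild (snd d)}"
      unfolding E2_def
    proof (rule expectation_diff_le_prob[OF finite_dau2])
      fix d :: "genome \<times> genome"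
      have F: "Psi (M - {#v#} + {#fst d, snd d#}) = (1 - r ^ (?N + 1)) * Phi (ct (fst d) + ct (snd d)) (s + h)"
        unfolding Psi_def Fm_def size_Diff(2)[OF v] mc_Diff(2)[OF v] mcv sp r_def by simp
      have b: "0 \<le> (1 - r ^ (?N + 1)) * Phi k (s + h) \<and> (1 - r ^ (?N + 1)) * Phi k (s + h) \<le> 1" for k
        using Phi_bounds[OF s1(2), of k] surv_bounds[of "?N + 1"] unfolding r_def by (auto intro!: mult_le_one)
      show "\<bar>Psi (M - {#v#} + {#fst d, snd d#}) - (1 - r ^ (?N + 1)) * Phi 0 (s + h)\<bar> \<le> 1 * indicator {d. \<not> wild (fst d) \<or> \<not> wild (snd d)} d"
      proof (cases "\<not> wild (fst d) \<or> \<not> wild (snd d)")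
        case True
        then show ?thesis unfolding F using b[of "ct (fst d) + ct (snd d)"] b[of 0]
          by (simp add: indicator_def abs_le_iff del: power_Suc)
      next
        case False
        then show ?thesis unfolding F by (simp add: ct_wild)
      qed
    qed
    also have "\<dots> \<le> 2 * me" using prob_nonwild2[OF w] by simp
    finally have u1: "\<bar>E2 - (1 - r ^ (?N + 1)) * Phi 0 (s + h)\<bar> \<le> 2 * me" .
    have "\<bar>(1 - r ^ (?N + 1)) * (Phi 0 (s + h) - P0)\<bar> \<le> 1 * (L0 * h)"
      using surv_bounds[of "?N + 1"] Lip[OF s1(2)] h0 unfolding r_def by (intro abs_mult_bound) auto
    then have u2: "\<bar>E2 - (1 - r ^ (?N + 1)) * P0\<bar> \<le> 2 * me + L0 * h"
      using u1 by (simp add: right_diff_distrib)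
    have "\<bar>(1 - r ^ (?N - 1)) * (Phi 0 (s - h) - P0)\<bar> \<le> 1 * (L0 * h)"
      using surv_bounds[of "?N - 1"] Lip[OF s1(3)] h0 unfolding r_def by (intro abs_mult_bound) auto
    then have d2: "\<bar>Psi (M - {#v#}) - (1 - r ^ (?N - 1)) * P0\<bar> \<le> 2 * me + L0 * h"
      using me0 unfolding Psi_def Fm_def size_Diff(1)[OF v] mcv sm r_def by (simp add: right_diff_distrib)
    have harm: "a * ((1 - r ^ (?N + 1)) - (1 - r ^ ?N)) + b * ((1 - r ^ (?N - 1)) - (1 - r ^ ?N)) = 0"
    proof -
      obtain k where k: "?N = Suc k" using N gr0_implies_Suc by blast
      have "a * r = b" using a0 by (simp add: r_def)
      then have "b = a * r" by simp
      then show ?thesis unfolding k by (simp add: algebra_simps)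
    qed
    have PsiM: "Psi M = (1 - r ^ ?N) * P0" by (simp add: Psi_def Fm_def m0 P0_def s_def r_def)
    have "gen Psi M v = a * (E2 - (1 - r ^ (?N + 1)) * P0) + b * (Psi (M - {#v#}) - (1 - r ^ (?N - 1)) * P0)
      + P0 * (a * ((1 - r ^ (?N + 1)) - (1 - r ^ ?N)) + b * ((1 - r ^ (?N - 1)) - (1 - r ^ ?N)))"
      unfolding gen_def E2_def[symmetric] PsiM using rates_wild[OF w] by (simp add: algebra_simps)
    then have "gen Psi M v = a * (E2 - (1 - r ^ (?N + 1)) * P0) + b * (Psi (M - {#v#}) - (1 - r ^ (?N - 1)) * P0)"
      unfolding harm by simp
    moreover have "\<bar>a * (E2 - (1 - r ^ (?N + 1)) * P0)\<bar> \<le> a * (2 * me + L0 * h)"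
      using u2 a0 by (intro abs_mult_bound) auto
    moreover have "\<bar>b * (Psi (M - {#v#}) - (1 - r ^ (?N - 1)) * P0)\<bar> \<le> b * (2 * me + L0 * h)"
      using d2 b0 by (intro abs_mult_bound) auto
    ultimately have "\<bar>gen Psi M v\<bar> \<le> a * (2 * me + L0 * h) + b * (2 * me + L0 * h)" by linarith
    then show ?thesis using rates_wild[OF w] by (simp add: distrib_right)
  qed
  then have "\<bar>\<Sum>v\<in>#M. gen Psi M v\<bar> \<le> (\<Sum>v\<in>#M. (ra v + rb v) * (2 * me + L0 * h))" by (rule sum_mset_abs_le)
  also have "\<dots> = Zr M * (2 * me + L0 * h)" unfolding total_rate_def by (rule sum_mset_distrib_right[symmetric])
  finally have "\<bar>\<Sum>v\<in>#M. gen Psi M v\<bar> / Zr M \<le> 2 * me + L0 * h" using Z by (simp add: pos_divide_le_eq mult.commute)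
  then show ?thesis unfolding expectation_stp[OF Z] using Z by (simp add: abs_divide h_def)
qed

lemma sum_mset_wild_ct:
  "(\<Sum>v\<in>#M. if wild v then c else real (ct v) * d) = (real (size M) - real (nw M)) * c + real (mc M) * (d :: real)"
proof (induction M)
  case (add v M)
  have "nw (add_mset v M) = nw M + (if wild v then 0 else 1)" "mc (add_mset v M) = mc M + ct v"
    by (simp_all add: nw_def mc_def)
  then show ?case using add ct_wild[of v] by (simp add: algebra_simps)
qed (simp add: nw_def mc_def)

lemma sum_mset_wild:
  "(\<Sum>v\<in>#M. if wild v then c else d) = (real (size M) - real (nw M)) * c + real (nw M) * (d :: real)"
proof (induction M)
  case (add v M)
  have "nw (add_mset v M) = nw M + (if wild v then 0 else 1)" by (simp add: nw_def)
  then show ?case using add by (simp add: algebra_simps)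
qed (simp add: nw_def)

lemma Fm_step:
  assumes few: "few M" and sz: "size M < n" and nd: "\<forall>v\<in>#M. \<not> dbl v"
  defines "R \<equiv> real (nw M)" and "C \<equiv> L0 + E0"
  shows "\<bar>measure_pmf.expectation (stp M) Fm - Fm M\<bar> \<le> 6 * C\<^sup>2 * (R + 1)\<^sup>2 / (real n)\<^sup>2 + 4 * \<delta> / real n
     + 12 * C * Rm * R * (R + 1) / (real (size M) * (a + b) * real n)"
proof -
  define N where "N = real (size M)"
  define m where "m = mc M"
  define s where "s = N / real n"
  have N: "N > 0" using few by (simp add: few_def N_def)
  have n0: "real n > 0" using npos by simp
  have Z: "Zr M > 0" by (rule few_facts(3)[OF few])
  have q: "a + b > 0" using a0 b0 by simp
  have s1: "s \<in> {0..1}" unfolding s_def N_def using in_unit[of "size M"] sz by simp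
  have C0: "C \<ge> 0" "L0 \<le> C" "E0 \<le> C" using L00 E00 by (auto simp: C_def)
  have mR: "real m \<le> R" using mc_le_nw[OF nd] by (simp add: m_def R_def)
  have R0: "R \<ge> 0" by (simp add: R_def)
  have d0: "\<delta> \<ge> 0" using dev by linarith
  define L where "L = real (m + 1) * L0"
  define W0 where "W0 = (lam * Phi' m s - 2 * a * \<nu> * phi s * Phi m s) / real n"
  define th where "th = a * (Phi (m + 1) s - Phi m s) + b * (Phi (m - 1) s - Phi m s)"
  define eW where "eW = 3 * (L + E0)\<^sup>2 / (real n)\<^sup>2 + 2 * \<delta> / real n"
  define eN where "eN = 2 * Rm * (E0 + real (m + 2) * L0) / real n"
  define t where "t v = (if wild v then W0 else real (ct v) * th)" for v
  have "\<bar>gen Fm M v - t v\<bar> \<le> (if wild v then (a + b) * eW else eN)" if v: "v \<in># M" for v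
  proof (cases "wild v")
    case True
    then show ?thesis using gen_Fm_wild[OF v True sz] unfolding t_def W0_def eW_def L_def m_def s_def N_def by simp
  next
    case False
    then show ?thesis using gen_Fm_nonwild[OF v _ sz] nd v unfolding t_def th_def eN_def m_def s_def N_def by simp
  qed
  then have "\<bar>\<Sum>v\<in>#M. gen Fm M v - t v\<bar> \<le> (\<Sum>v\<in>#M. if wild v then (a + b) * eW else eN)" by (rule sum_mset_abs_le)
  also have "\<dots> = (N - R) * ((a + b) * eW) + R * eN" unfolding sum_mset_wild N_def R_def ..
  also have "\<dots> \<le> N * ((a + b) * eW) + R * eN"
    using R0 q d0 by (intro add_right_mono mult_right_mono) (auto simp: eW_def)
  finally have 1: "\<bar>\<Sum>v\<in>#M. gen Fm M v - t v\<bar> \<le> N * ((a + b) * eW) + R * eN" .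
  have pde: "N * W0 + real m * th = 0"
    using Phi_pde[OF s1, of m] unfolding W0_def th_def by (simp add: s_def)
  have "(\<Sum>v\<in>#M. t v) = (N - R) * W0 + real m * th"
    unfolding t_def sum_mset_wild_ct N_def R_def m_def ..
  then have 2: "(\<Sum>v\<in>#M. t v) = - (R * W0)" using pde by (simp add: algebra_simps)
  have W0: "\<bar>W0\<bar> \<le> 2 * lam * L / real n"
  proof -
    have "\<bar>lam * Phi' m s\<bar> \<le> lam * L"
      using C2b_Phi[of m] s1 ab by (intro abs_mult_bound) (auto simp: C2b_def L_def)
    moreover have "\<bar>2 * a * \<nu> * phi s * Phi m s\<bar> \<le> lam * L"
    proof -
      have "\<bar>phi s * Phi m s\<bar> \<le> 1 * 1" using phi_bounds[OF s1] Phi_bounds[OF s1, of m] by (intro abs_mult_bound) auto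
      then have "\<bar>(lam * cc) * (phi s * Phi m s)\<bar> \<le> (lam * cc) * 1" using ab cc0 by (intro abs_mult_bound) auto
      also have "(lam * cc) * 1 \<le> lam * L"
      proof -
        have "cc \<le> L0" by (simp add: L0_def)
        also have "L0 \<le> L" using L00 mult_right_mono[of 1 "real (m + 1)" L0] by (simp add: L_def)
        finally show ?thesis using ab by simp
      qed
      finally show ?thesis unfolding lam_cc by (simp add: mult.assoc)
    qed
    ultimately have "\<bar>lam * Phi' m s - 2 * a * \<nu> * phi s * Phi m s\<bar> \<le> 2 * lam * L" by linarith
    then show ?thesis unfolding W0_def abs_divide using n0 by (simp add: divide_right_mono)
  qed
  have "(\<Sum>v\<in>#M. gen Fm M v) = (\<Sum>v\<in>#M. gen Fm M v - t v) + (\<Sum>v\<in>#M. t v)"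
    by (simp add: sum_mset.distrib[symmetric])
  moreover have "\<bar>R * W0\<bar> \<le> R * (2 * lam * L / real n)" using W0 R0 by (intro abs_mult_bound) auto
  ultimately have 3: "\<bar>\<Sum>v\<in>#M. gen Fm M v\<bar> \<le> N * ((a + b) * eW) + R * (eN + 2 * lam * L / real n)"
    using 1 2 by (simp add: distrib_left)
  have LE: "L + E0 \<le> (R + 1) * C"
  proof -
    have "L \<le> (R + 1) * L0" unfolding L_def using mR L00 by (intro mult_right_mono) auto
    moreover have "1 * E0 \<le> (R + 1) * E0" using R0 E00 by (intro mult_right_mono) auto
    ultimately show ?thesis by (simp add: C_def distrib_left)
  qed
  have L_ge: "L \<ge> 0" using L00 by (simp add: L_def)
  have eW_le: "eW \<le> 3 * C\<^sup>2 * (R + 1)\<^sup>2 / (real n)\<^sup>2 + 2 * \<delta> / real n"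
  proof -
    have "(L + E0)\<^sup>2 \<le> ((R + 1) * C)\<^sup>2" using LE L_ge E00 by (intro power_mono) auto
    then have "3 * (L + E0)\<^sup>2 / (real n)\<^sup>2 \<le> 3 * ((R + 1) * C)\<^sup>2 / (real n)\<^sup>2" by (intro divide_right_mono) auto
    then show ?thesis by (simp add: eW_def power_mult_distrib mult_ac)
  qed
  have eN_le: "eN + 2 * lam * L / real n \<le> 6 * C * Rm * (R + 1) / real n"
  proof -
    have "E0 + real (m + 2) * L0 \<le> 2 * ((R + 1) * C)"
    proof -
      have "real (m + 2) * L0 \<le> (2 * (R + 1)) * L0" using mR R0 L00 by (intro mult_right_mono) auto
      moreover have "1 * E0 \<le> (2 * (R + 1)) * E0" using R0 E00 by (intro mult_right_mono) auto
      ultimately show ?thesis by (simp add: C_def algebra_simps)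
    qed
    then have "2 * Rm * (E0 + real (m + 2) * L0) \<le> 2 * Rm * (2 * ((R + 1) * C))" using Rm0 by (intro mult_left_mono) auto
    moreover have "2 * lam * L \<le> 2 * Rm * ((R + 1) * C)"
      using LE E00 L_ge RmA b0 ab Rm0 R0 C0 by (intro mult_mono) auto
    moreover have "2 * Rm * (2 * ((R + 1) * C)) + 2 * Rm * ((R + 1) * C) = 6 * C * Rm * (R + 1)" by (simp add: algebra_simps)
    ultimately have "2 * Rm * (E0 + real (m + 2) * L0) + 2 * lam * L \<le> 6 * C * Rm * (R + 1)" by linarith
    then have "(2 * Rm * (E0 + real (m + 2) * L0) + 2 * lam * L) / real n \<le> 6 * C * Rm * (R + 1) / real n"
      by (intro divide_right_mono) auto
    then show ?thesis unfolding eN_def add_divide_distrib .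
  qed
  have "\<bar>\<Sum>v\<in>#M. gen Fm M v\<bar> \<le> N * ((a + b) * (3 * C\<^sup>2 * (R + 1)\<^sup>2 / (real n)\<^sup>2 + 2 * \<delta> / real n)) + R * (6 * C * Rm * (R + 1) / real n)"
    by (rule order_trans[OF 3]) (use eW_le eN_le N q R0 in \<open>intro add_mono mult_left_mono; simp\<close>)
  also have "\<dots> = (N * (a + b) / 2) * (6 * C\<^sup>2 * (R + 1)\<^sup>2 / (real n)\<^sup>2 + 4 * \<delta> / real n
     + 12 * C * Rm * R * (R + 1) / (N * (a + b) * real n))"
  proof -
    have "N * (Q * (3 * X / k + 2 * \<delta> / n')) + R * (6 * Y * S1 / n') =
      (N * Q / 2) * (6 * X / k + 4 * \<delta> / n' + 12 * Y * R * S1 / (N * Q * n'))"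
      if "Q > 0" "n' > 0" "k > 0" for Q X k Y S1 n' :: real
      using that N by (simp add: field_simps)
    from this[OF q n0, of "(real n)\<^sup>2" "C\<^sup>2 * (R + 1)\<^sup>2" "C * Rm" "R + 1"] n0 show ?thesis by (simp add: mult.assoc)
  qed
  also have "\<dots> \<le> Zr M * (6 * C\<^sup>2 * (R + 1)\<^sup>2 / (real n)\<^sup>2 + 4 * \<delta> / real n
     + 12 * C * Rm * R * (R + 1) / (N * (a + b) * real n))"
    using few_facts(2)[OF few] C0 Rm0 R0 N a0 b0 d0 unfolding N_def
    by (intro mult_right_mono add_nonneg_nonneg divide_nonneg_nonneg mult_nonneg_nonneg) auto
  finally have "\<bar>\<Sum>v\<in>#M. gen Fm M v\<bar> / Zr M \<le> 6 * C\<^sup>2 * (R + 1)\<^sup>2 / (real n)\<^sup>2 + 4 * \<delta> / real n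
     + 12 * C * Rm * R * (R + 1) / (N * (a + b) * real n)"
    using Z by (simp add: pos_divide_le_eq mult.commute)
  then show ?thesis unfolding expectation_stp[OF Z] N_def using Z by (simp add: abs_divide)
qed

lemma Psi_step_large:
  assumes few: "few M" and sz: "size M < n" and nd: "\<forall>v\<in>#M. \<not> dbl v"
  defines "R \<equiv> real (nw M)" and "C \<equiv> L0 + E0"
  shows "\<bar>measure_pmf.expectation (stp M) Psi - Psi M\<bar> \<le> 6 * C\<^sup>2 * (R + 1)\<^sup>2 / (real n)\<^sup>2 + 4 * \<delta> / real n
     + 12 * C * Rm * R * (R + 1) / (real (size M) * (a + b) * real n) + 2 * (b / a) ^ (size M - 1)"
proof -
  have Z: "Zr M > 0" by (rule few_facts(3)[OF few])
  have fin: "finite (set_pmf (stp M))" by (rule finite_stp[OF Z])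
  have close: "\<bar>Psi M' - Fm M'\<bar> \<le> (b / a) ^ (size M - 1)" if "size M' \<le> n" "size M - 1 \<le> size M'" for M'
  proof -
    have "Psi M' - Fm M' = - ((b / a) ^ size M' * Fm M')" by (simp add: Psi_def algebra_simps)
    then have "\<bar>Psi M' - Fm M'\<bar> = \<bar>(b / a) ^ size M' * Fm M'\<bar>" by simp
    also have "\<dots> \<le> (b / a) ^ (size M - 1) * 1"
    proof (rule abs_mult_bound)
      show "\<bar>Fm M'\<bar> \<le> 1" using Fm_bounds[OF that(1)] by auto
      show "\<bar>(b / a) ^ size M'\<bar> \<le> (b / a) ^ (size M - 1)" using rho that(2) by (auto intro!: power_decreasing)
    qed
    finally show ?thesis by simp
  qed
  have "measure_pmf.expectation (stp M) Psi - measure_pmf.expectation (stp M) Fm = measure_pmf.expectation (stp M) (\<lambda>M'. Psi M' - Fm M')"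
    by (subst Bochner_Integration.integral_diff) (auto intro!: integrable_measure_pmf_finite fin)
  moreover have "\<bar>measure_pmf.expectation (stp M) (\<lambda>M'. Psi M' - Fm M') - 0\<bar> \<le> (b / a) ^ (size M - 1) * measure_pmf.prob (stp M) UNIV"
  proof (rule expectation_diff_le_prob[OF fin])
    fix M' assume "M' \<in> set_pmf (stp M)"
    then show "\<bar>Psi M' - Fm M' - 0\<bar> \<le> (b / a) ^ (size M - 1) * indicator UNIV M'"
      using close[of M'] size_stp[OF Z, of M'] sz by auto
  qed
  ultimately have "\<bar>measure_pmf.expectation (stp M) Psi - measure_pmf.expectation (stp M) Fm\<bar> \<le> (b / a) ^ (size M - 1)" by simp
  moreover have "\<bar>Psi M - Fm M\<bar> \<le> (b / a) ^ (size M - 1)" using close[of M] sz by auto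
  ultimately show ?thesis using Fm_step[OF few sz nd] unfolding R_def C_def by linarith
qed

end

section \<open>The error potential\<close>

lemma sum_ln_ratio_le: "n > 0 \<Longrightarrow> (\<Sum>k=1..n. ln (real n / real k)) \<le> real n"
proof (induction n rule: nat_induct_non_zero)
  case (Suc n)
  have "(\<Sum>k=1..Suc n. ln (real (Suc n) / real k)) = (\<Sum>k=1..n. ln (real (Suc n) / real k))" by simp
  also have "\<dots> = (\<Sum>k=1..n. ln (real n / real k) + ln (1 + 1 / real n))"
  proof (intro sum.cong refl)
    fix k assume k: "k \<in> {1..n}"
    have "1 + 1 / real n = real (Suc n) / real n" using Suc by (simp add: field_simps)
    then show "ln (real (Suc n) / real k) = ln (real n / real k) + ln (1 + 1 / real n)"
      using k Suc by (simp add: ln_div)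
  qed
  also have "\<dots> = (\<Sum>k=1..n. ln (real n / real k)) + real n * ln (1 + 1 / real n)"
    by (simp add: sum.distrib)
  also have "real n * ln (1 + 1 / real n) \<le> real n * (1 / real n)"
    by (intro mult_left_mono ln_add_one_self_le_self) auto
  finally show ?case using Suc by simp
qed simp

text \<open>All error scales are powers of y = n^(1/8): good states have at most y mutants, and none before the
  population reaches size y^7.\<close>
locale bp_big = bp_pgf +
  fixes y Cr :: real
  assumes y8: "y ^ 8 = real n" and y1: "y > 1" and big: "8 * Rm / (a - b) + 1 \<le> y ^ 3"
    and Cr: "\<And>k. k \<ge> 1 \<Longrightarrow> (b / a) ^ (k - 1) * real k ^ 3 \<le> Cr"
begin

definition fs :: "nat \<Rightarrow> real" where "fs k = (1 + ln (real n / real k)) / real n"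
definition K1 :: real where "K1 = 4 * E0 * Kc + 2 * E0 + L0"
definition K2 :: real where
  "K2 = 24 * (L0 + E0)\<^sup>2 + 24 * (L0 + E0) * Rm / (a + b) + 2 * Cr + 2 * E0\<^sup>2 + 4 * E0 * Rm / (a + b) + 1"
definition Bc :: real where "Bc = K1 / ln y + K2 / y\<^sup>2 + 4 * \<delta>"

lemma lny: "ln y > 0" using y1 by simp

lemma lamp: "lam > 0" using ab by simp

lemma Cr0: "Cr \<ge> 1" using Cr[of 1] by simp

lemma d0: "\<delta> \<ge> 0" using dev by linarith

lemma K1_nonneg: "K1 \<ge> 0" using E00 Kc L00 by (simp add: K1_def)
lemma K2_nonneg: "K2 \<ge> 0" using E00 L00 Rm0 a0 b0 Cr0 by (simp add: K2_def)
lemma Bc_nonneg: "Bc \<ge> 0" using K1_nonneg K2_nonneg lny d0 by (simp add: Bc_def)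

lemma y_pow_mono: "i \<le> j \<Longrightarrow> y ^ i \<le> y ^ j" using y1 by (intro power_increasing) auto

lemma fs_ge: "0 < k \<Longrightarrow> k \<le> n \<Longrightarrow> 1 / real n \<le> fs k"
  unfolding fs_def by (intro divide_right_mono) auto

lemma fs_nonneg: "0 < k \<Longrightarrow> k \<le> n \<Longrightarrow> fs k \<ge> 0"
  using fs_ge[of k] by (meson order_trans zero_le_divide_1_iff of_nat_0_le_iff)

definition good :: "genome multiset \<Rightarrow> bool" where
  "good M \<longleftrightarrow> 0 < size M \<and> size M < n \<and> (\<forall>v\<in>#M. \<not> dbl v) \<and> Wp M < ln y"

lemma good_pos:
  assumes g: "good M" and R: "nw M > 0"
  shows "real (nw M) \<le> y" "y ^ 7 \<le> real (size M)"
proof -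
  have N: "0 < size M" "size M < n" using g by (auto simp: good_def)
  have W: "ln (real (nw M)) + Kc * ln (real n / real (size M)) < ln y"
    using g R by (simp add: good_def Wp_def Wf_def)
  have l0: "ln (real n / real (size M)) \<ge> 0" using N by (intro ln_ge_zero) auto
  have l1: "ln (real (nw M)) \<ge> 0" using R by simp
  have Kl: "Kc * ln (real n / real (size M)) \<ge> 1 * ln (real n / real (size M))"
    using Kc l0 by (intro mult_right_mono) auto
  have "ln (real (nw M)) < ln y" using W Kl l0 by linarith
  then show "real (nw M) \<le> y" using R y1 by simp
  have "ln (real n / real (size M)) < ln y" using W Kl l1 by linarith
  then have "real n / real (size M) < y" using N y1 by (subst (asm) ln_less_cancel_iff) auto
  then have "y ^ 8 < y * real (size M)" using N by (simp add: y8 pos_divide_less_eq del: One_nat_def)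
  then have "y * y ^ 7 < y * real (size M)" by (simp add: power_Suc[symmetric] del: power_Suc)
  then show "y ^ 7 \<le> real (size M)" using y1 by simp
qed

lemma good_few:
  assumes g: "good M"
  shows "few M"
proof (cases "nw M = 0")
  case True
  then show ?thesis using g lamp by (simp add: good_def few_def)
next
  case False
  then have R: "nw M > 0" by simp
  have Rl: "8 * Rm + lam \<le> y ^ 3 * lam"
  proof -
    have "(8 * Rm / lam + 1) * lam \<le> y ^ 3 * lam" using big lamp by (intro mult_right_mono) auto
    moreover have "(8 * Rm / lam + 1) * lam = 8 * Rm + lam" using lamp by (simp add: distrib_right)
    ultimately show ?thesis by simp
  qed
  have "real (nw M) * (8 * Rm + lam) \<le> y * (y ^ 3 * lam)"
    using good_pos(1)[OF g R] Rl Rm0 lamp y1 by (intro mult_mono) auto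
  also have "\<dots> = y ^ 4 * lam" by (simp add: power_numeral_reduce)
  also have "\<dots> \<le> real (size M) * lam"
    using good_pos(2)[OF g R] y_pow_mono[of 4 7] lamp by (intro mult_right_mono) auto
  finally show ?thesis using g by (simp add: good_def few_def)
qed

lemma good_size_lam:
  assumes g: "good M" and R: "nw M > 0"
  shows "8 * (a + b) \<le> real (size M) * lam"
proof -
  have "8 * Rm / lam \<le> y ^ 3" using big by simp
  then have 1: "8 * Rm \<le> y ^ 3 * lam" using lamp by (simp add: pos_divide_le_eq)
  have "lam \<le> Rm" using RmA b0 by simp
  then have "8 \<le> 8 * Rm / lam" using lamp by (simp add: le_divide_eq)
  then have y3: "y ^ 3 \<ge> 2" using big by linarith
  have "8 * (a + b) \<le> 2 * (8 * Rm)" using RmA ab by simp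
  also have "\<dots> \<le> y ^ 3 * (y ^ 3 * lam)" by (rule mult_mono[OF y3 1]) (use Rm0 y1 in auto)
  also have "\<dots> = y ^ 6 * lam" by (simp add: power_numeral_reduce)
  also have "\<dots> \<le> real (size M) * lam"
    using good_pos(2)[OF g R] y_pow_mono[of 6 7] lamp by (intro mult_right_mono) auto
  finally show ?thesis .
qed

lemma step_W:
  assumes g: "good M"
  shows "measure_pmf.expectation (stp M) Wp - Wp M \<le> 4 * E0 * Kc * fs (size M)"
proof -
  have N: "0 < size M" "size M < n" using g by (auto simp: good_def)
  have l0: "ln (real n / real (size M)) \<ge> 0" using N by (intro ln_ge_zero) auto
  have "measure_pmf.expectation (stp M) Wp - Wp M \<le> 4 * me * (1 + Kc * ln (real n / real (size M)))"
  proof (cases "nw M = 0")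
    case True
    then show ?thesis using Wp_step_0[OF good_few[OF g] N(2)] by simp
  next
    case False
    then have "measure_pmf.expectation (stp M) Wp - Wp M \<le> 4 * me * 1"
      using Wp_step_pos[OF good_few[OF g] N(2)] good_size_lam[OF g] by simp
    also have "\<dots> \<le> 4 * me * (1 + Kc * ln (real n / real (size M)))"
      using me0 l0 Kc by (intro mult_left_mono) auto
    finally show ?thesis .
  qed
  also have "\<dots> \<le> 4 * me * (Kc * (1 + ln (real n / real (size M))))"
    using me0 Kc by (intro mult_left_mono) (auto simp: distrib_left)
  also have "\<dots> = 4 * E0 * Kc * fs (size M)" by (simp add: me_def fs_def)
  finally show ?thesis .
qed

lemma step_Db:
  assumes g: "good M"
  shows "measure_pmf.expectation (stp M) Db - Db M \<le> (2 * E0\<^sup>2 + 4 * E0 * Rm / (a + b)) / y\<^sup>2 * fs (size M)"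
proof -
  have N: "0 < size M" "size M < n" and nd: "\<forall>v\<in>#M. \<not> dbl v" using g by (auto simp: good_def)
  have q: "a + b > 0" using a0 b0 by simp
  have n0: "real n > 0" using npos by simp
  have y2: "y\<^sup>2 > 0" using y1 by simp
  have RN: "real (nw M) / real (size M) \<le> 1 / y\<^sup>2"
  proof (cases "nw M = 0")
    case False
    then have R: "nw M > 0" by simp
    have "real (nw M) * y\<^sup>2 \<le> y * y\<^sup>2" using good_pos(1)[OF g R] by (intro mult_right_mono) auto
    also have "\<dots> = y ^ 3" by (simp add: power_numeral_reduce)
    also have "\<dots> \<le> real (size M)" using good_pos(2)[OF g R] y_pow_mono[of 3 7] by simp
    finally show ?thesis using N y2 by (simp add: field_simps)
  qed simp
  have n2: "1 / real n \<le> 1 / y\<^sup>2" unfolding y8[symmetric] using y_pow_mono[of 2 8] y1 by (intro divide_left_mono) auto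
  have "measure_pmf.expectation (stp M) Db - Db M \<le> 2 * me\<^sup>2 + 4 * me * Rm * real (nw M) / (real (size M) * (a + b))"
    by (rule Db_step[OF good_few[OF g] nd])
  also have "\<dots> = (1 / real n) * (2 * E0\<^sup>2 * (1 / real n) + 4 * E0 * Rm / (a + b) * (real (nw M) / real (size M)))"
  proof -
    have "2 * (E / k)\<^sup>2 + 4 * (E / k) * R * r / (N * Q) = (1 / k) * (2 * E\<^sup>2 * (1 / k) + 4 * E * R / Q * (r / N))"
      if "k > 0" "N > 0" "Q > 0" for E k R r N Q :: real
      using that by (simp add: power2_eq_square field_simps)
    from this[OF n0 _ q, of "real (size M)"] N(1) show ?thesis unfolding me_def by simp
  qed
  also have "\<dots> \<le> (1 / real n) * (2 * E0\<^sup>2 * (1 / y\<^sup>2) + 4 * E0 * Rm / (a + b) * (1 / y\<^sup>2))"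
    using n2 RN E00 Rm0 q n0 by (intro mult_left_mono add_mono) auto
  also have "\<dots> = (1 / real n) * ((2 * E0\<^sup>2 + 4 * E0 * Rm / (a + b)) / y\<^sup>2)" by (simp add: add_divide_distrib)
  also have "\<dots> \<le> fs (size M) * ((2 * E0\<^sup>2 + 4 * E0 * Rm / (a + b)) / y\<^sup>2)"
    using fs_ge[of "size M"] N E00 Rm0 a0 b0 by (intro mult_right_mono) auto
  finally show ?thesis by (simp add: mult.commute)
qed

lemma step_Psi:
  assumes g: "good M"
  shows "\<bar>measure_pmf.expectation (stp M) Psi - Psi M\<bar> \<le>
    ((2 * E0 + L0) / ln y + (24 * (L0 + E0)\<^sup>2 + 24 * (L0 + E0) * Rm / (a + b) + 2 * Cr) / y\<^sup>2 + 4 * \<delta>) * fs (size M)"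
proof -
  have N: "0 < size M" "size M < n" and nd: "\<forall>v\<in>#M. \<not> dbl v" using g by (auto simp: good_def)
  have q: "a + b > 0" using a0 b0 by simp
  have n0: "real n > 0" using npos by simp
  define X where "X = (24 * (L0 + E0)\<^sup>2 + 24 * (L0 + E0) * Rm / (a + b) + 2 * Cr) / y\<^sup>2"
  define C where "C = L0 + E0"
  have X0: "X \<ge> 0" unfolding X_def using L00 E00 Rm0 a0 b0 Cr0 by simp
  have C0: "C \<ge> 0" using L00 E00 by (simp add: C_def)
  have f0: "fs (size M) \<ge> 0" using fs_nonneg N by simp
  have fam: "few M" by (rule good_few[OF g])
  show ?thesis
  proof (cases "real (size M) < y ^ 4")
    case True
    have R0: "nw M = 0"
    proof (rule ccontr)
      assume "nw M \<noteq> 0"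
      then have "y ^ 7 \<le> real (size M)" using good_pos(2)[OF g] by simp
      then show False using True y_pow_mono[of 4 7] by simp
    qed
    have "4 * ln y \<le> ln (real n / real (size M))"
    proof -
      have "y ^ 4 * real (size M) \<le> y ^ 4 * y ^ 4" using True y1 by (intro mult_left_mono) auto
      also have "\<dots> = real n" unfolding y8[symmetric] by (simp add: power_add[symmetric])
      finally have "y ^ 4 \<le> real n / real (size M)" using N by (simp add: pos_le_divide_eq)
      then have "ln (y ^ 4) \<le> ln (real n / real (size M))" using y1 N by (subst ln_le_cancel_iff) auto
      then show ?thesis using y1 by (simp add: ln_realpow)
    qed
    then have "ln y \<le> 1 + ln (real n / real (size M))" using lny by linarith
    then have "1 \<le> (1 + ln (real n / real (size M))) / ln y" using lny by simp
    then have "(1 / real n) * 1 \<le> (1 / real n) * ((1 + ln (real n / real (size M))) / ln y)"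
      using n0 by (intro mult_left_mono) auto
    then have fl: "1 / real n \<le> fs (size M) / ln y" by (simp add: fs_def)
    have "\<bar>measure_pmf.expectation (stp M) Psi - Psi M\<bar> \<le> 2 * me + L0 / real n"
      by (rule Psi_step_small[OF fam N(2) R0])
    also have "\<dots> = (2 * E0 + L0) * (1 / real n)" by (simp add: me_def add_divide_distrib)
    also have "\<dots> \<le> (2 * E0 + L0) * (fs (size M) / ln y)" using fl E00 L00 by (intro mult_left_mono) auto
    also have "\<dots> \<le> ((2 * E0 + L0) / ln y + X + 4 * \<delta>) * fs (size M)"
      using X0 d0 f0 by (simp add: distrib_right)
    finally show ?thesis unfolding X_def .
  next
    case False
    then have N4: "y ^ 4 \<le> real (size M)" by simp
    define R where "R = real (nw M)"
    have Ry: "0 \<le> R" "R \<le> y"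
      using good_pos(1)[OF g] y1 unfolding R_def by (cases "nw M = 0"; simp)+
    have t1: "6 * C\<^sup>2 * (R + 1)\<^sup>2 / (real n)\<^sup>2 \<le> 24 * C\<^sup>2 / y\<^sup>2 / real n"
    proof -
      have "(R + 1)\<^sup>2 \<le> (2 * y)\<^sup>2" using Ry y1 by (intro power_mono) auto
      then have "6 * C\<^sup>2 * (R + 1)\<^sup>2 \<le> 6 * C\<^sup>2 * (2 * y)\<^sup>2" by (intro mult_left_mono) auto
      also have "\<dots> = 24 * C\<^sup>2 * y\<^sup>2" by (simp add: power_mult_distrib)
      finally have "6 * C\<^sup>2 * (R + 1)\<^sup>2 / (real n)\<^sup>2 \<le> 24 * C\<^sup>2 * y\<^sup>2 / (real n)\<^sup>2" by (intro divide_right_mono) auto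
      also have "\<dots> = 24 * C\<^sup>2 * (y\<^sup>2 / real n) / real n" by (simp add: power2_eq_square)
      also have "\<dots> \<le> 24 * C\<^sup>2 * (1 / y\<^sup>2) / real n"
      proof (intro divide_right_mono mult_left_mono)
        have "y\<^sup>2 * y\<^sup>2 \<le> real n" unfolding y8[symmetric] power_add[symmetric] using y_pow_mono[of 4 8] by simp
        then show "y\<^sup>2 / real n \<le> 1 / y\<^sup>2" using y1 n0 by (simp add: field_simps)
      qed auto
      finally show ?thesis by simp
    qed
    have t2: "12 * C * Rm * R * (R + 1) / (real (size M) * (a + b) * real n) \<le> 24 * C * Rm / (a + b) / y\<^sup>2 / real n"
    proof -
      have "R * (R + 1) \<le> y * (2 * y)" using Ry y1 by (intro mult_mono) auto
      then have "R * (R + 1) * y\<^sup>2 \<le> y * (2 * y) * y\<^sup>2" by (intro mult_right_mono) auto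
      also have "\<dots> = 2 * y ^ 4" by (simp add: power_numeral_reduce)
      also have "\<dots> \<le> 2 * real (size M)" using N4 by simp
      finally have "R * (R + 1) / real (size M) \<le> 2 / y\<^sup>2" using N y1 by (simp add: field_simps)
      then have "12 * C * Rm / (a + b) * (R * (R + 1) / real (size M)) / real n \<le> 12 * C * Rm / (a + b) * (2 / y\<^sup>2) / real n"
        using C0 Rm0 q by (intro divide_right_mono mult_left_mono) auto
      then show ?thesis by (simp add: mult_ac)
    qed
    have t3: "2 * (b / a) ^ (size M - 1) \<le> 2 * Cr / y\<^sup>2 / real n"
    proof -
      have "(b / a) ^ (size M - 1) * y ^ 12 \<le> (b / a) ^ (size M - 1) * real (size M) ^ 3"
      proof (rule mult_left_mono)
        have "y ^ 12 = (y ^ 4) ^ 3" by (simp add: power_mult[symmetric])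
        also have "\<dots> \<le> real (size M) ^ 3" using N4 y1 by (intro power_mono) auto
        finally show "y ^ 12 \<le> real (size M) ^ 3" .
      qed (use rho in auto)
      also have "\<dots> \<le> Cr" using Cr[of "size M"] N by simp
      finally have "(b / a) ^ (size M - 1) * y ^ 10 \<le> Cr"
        using mult_left_mono[OF y_pow_mono[of 10 12], of "(b / a) ^ (size M - 1)"] rho by auto
      then have "(b / a) ^ (size M - 1) * (y\<^sup>2 * real n) \<le> Cr" unfolding y8[symmetric] by (simp add: power_add[symmetric])
      moreover have "2 * r \<le> 2 * c / Y / k" if "r * (Y * k) \<le> c" "Y > 0" "k > 0" for r c Y k :: real
        using that by (simp add: field_simps)
      ultimately show ?thesis using y1 n0 by simp
    qed
    have "\<bar>measure_pmf.expectation (stp M) Psi - Psi M\<bar> \<le> 6 * C\<^sup>2 * (R + 1)\<^sup>2 / (real n)\<^sup>2 + 4 * \<delta> / real n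
     + 12 * C * Rm * R * (R + 1) / (real (size M) * (a + b) * real n) + 2 * (b / a) ^ (size M - 1)"
      unfolding C_def R_def by (rule Psi_step_large[OF fam N(2) nd])
    also have "\<dots> \<le> 24 * C\<^sup>2 / y\<^sup>2 / real n + 4 * \<delta> / real n + 24 * C * Rm / (a + b) / y\<^sup>2 / real n + 2 * Cr / y\<^sup>2 / real n"
      by (intro add_mono t1 t2 t3 order_refl)
    also have "\<dots> = (X + 4 * \<delta>) * (1 / real n)" by (simp add: X_def C_def add_divide_distrib distrib_right)
    also have "\<dots> \<le> (X + 4 * \<delta>) * fs (size M)" using fs_ge[of "size M"] N X0 d0 by (intro mult_left_mono) auto
    also have "\<dots> \<le> ((2 * E0 + L0) / ln y + X + 4 * \<delta>) * fs (size M)"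
      using f0 E00 L00 lny by (intro mult_right_mono) auto
    finally show ?thesis unfolding X_def .
  qed
qed

definition Qp :: "genome multiset \<Rightarrow> real" where
  "Qp M = Wp M / ln y + Db M + Bc * Gr fs (size M) + (b / a) ^ n"

definition pay :: "genome multiset \<Rightarrow> real" where "pay M = x ^ mc M"

lemma pay_bounds: "0 \<le> pay M \<and> pay M \<le> 1" using x by (simp add: pay_def power_le_one)

lemma Gr_nonneg: "Gr fs N \<ge> 0"
  unfolding Gr_def using rho1 lamp a0 b0 fs_nonneg by (intro mult_nonneg_nonneg sum_nonneg) auto

lemma Wp_nonneg: "size M \<le> n \<Longrightarrow> Wp M \<ge> 0"
  using Wf_nonneg[of "size M" "nw M"] nw_le_size[of M] by (cases "size M = 0") (auto simp: Wp_def Wf_def)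

lemma Psi_terminal: "size M = n \<Longrightarrow> \<bar>pay M - Psi M\<bar> \<le> (b / a) ^ n"
proof -
  assume sz: "size M = n"
  have "phi 1 = 1 - x" using bd.phi_1 by (simp add: phi_def)
  moreover have "H 1 = 1" using bd.I_1 by (simp add: H_def)
  ultimately have "Fm M = pay M" using sz npos by (simp add: Fm_def Phi_def pay_def)
  then have "pay M - Psi M = (b / a) ^ n * pay M" using sz by (simp add: Psi_def algebra_simps)
  also have "\<bar>\<dots>\<bar> \<le> (b / a) ^ n * 1" using rho pay_bounds[of M] by (intro abs_mult_bound) auto
  finally show ?thesis by simp
qed

theorem chain_estimate:
  assumes "size M \<le> n"
  shows "\<bar>bp_val n pay M - Psi M\<bar> \<le> Qp M"
proof (rule potential_bound[where St = "{M. size M \<le> n}" and K = stp and C = 1 and \<eta> = "1 / (y\<^sup>2 * real n)"])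
  show "1 / (y\<^sup>2 * real n) > 0" using y1 npos by simp
  show "M \<in> {M. size M \<le> n}" using assms by simp
  have vb: "0 \<le> bp_val n pay M" "bp_val n pay M \<le> 1" for M using bp_val_bounds[of pay n M] pay_bounds by auto
  fix M :: "genome multiset" assume "M \<in> {M. size M \<le> n}"
  then have sz: "size M \<le> n" by simp
  show D1: "\<bar>bp_val n pay M - Psi M\<bar> \<le> 1" using vb[of M] Psi_bounds[OF sz] by (auto simp: abs_le_iff)
  have parts: "Wp M / ln y \<ge> 0" "Db M \<ge> 0" "Bc * Gr fs (size M) \<ge> 0" "(b / a) ^ n \<ge> 0"
    using Wp_nonneg[OF sz] lny Bc_nonneg Gr_nonneg rho by (auto simp: Db_def)
  then show "Qp M \<ge> 0" unfolding Qp_def by linarith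
  assume big: "\<not> \<bar>bp_val n pay M - Psi M\<bar> \<le> Qp M"
  have ne_n: "size M \<noteq> n"
  proof
    assume eq: "size M = n"
    then have "\<bar>bp_val n pay M - Psi M\<bar> \<le> (b / a) ^ n" using Psi_terminal[OF eq] bp_val_terminal[OF eq] by simp
    then show False using big parts unfolding Qp_def by linarith
  qed
  have ne_0: "size M \<noteq> 0"
  proof
    assume "size M = 0"
    then have "bp_val n pay M = 0" "Psi M = 0" using bp_val_dead[of M n pay] npos by (auto simp: Psi_def)
    then show False using big parts unfolding Qp_def by simp
  qed
  have nd: "\<forall>v\<in>#M. \<not> dbl v"
  proof (rule ccontr)
    assume "\<not> (\<forall>v\<in>#M. \<not> dbl v)"
    then have "Db M = 1" by (simp add: Db_def)
    then show False using big parts D1 unfolding Qp_def by linarith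
  qed
  have W: "Wp M < ln y"
  proof (rule ccontr)
    assume "\<not> Wp M < ln y"
    then have "Wp M / ln y \<ge> 1" using lny by simp
    then show False using big parts D1 unfolding Qp_def by linarith
  qed
  have g: "good M" unfolding good_def using ne_0 ne_n sz nd W by (metis le_neq_implies_less not_gr_zero)
  have few: "few M" by (rule good_few[OF g])
  have Z: "Zr M > 0" by (rule few_facts(3)[OF few])
  have fin: "finite (set_pmf (stp M))" by (rule finite_stp[OF Z])
  have sub: "set_pmf (stp M) \<subseteq> {M. size M \<le> n}" using size_stp(1)[OF Z] ne_n sz by fastforce
  let ?E = "\<lambda>F. measure_pmf.expectation (stp M) F"
  have int: "integrable (measure_pmf (stp M)) F" for F :: "genome multiset \<Rightarrow> real"
    by (rule integrable_measure_pmf_finite[OF fin])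
  have step: "bp_val n pay M = ?E (bp_val n pay)"
    using pay_bounds by (intro bp_val_step ne_n ne_0 Z) auto
  have "bp_val n pay M - Psi M = ?E (\<lambda>M'. bp_val n pay M' - Psi M') + (?E Psi - Psi M)"
    unfolding step by (subst Bochner_Integration.integral_diff[OF int int]) simp
  moreover have "\<bar>?E (\<lambda>M'. bp_val n pay M' - Psi M')\<bar> \<le> ?E (\<lambda>M'. \<bar>bp_val n pay M' - Psi M'\<bar>)"
    by (rule integral_abs_bound)
  ultimately have 1: "\<bar>bp_val n pay M - Psi M\<bar> \<le> ?E (\<lambda>M'. \<bar>bp_val n pay M' - Psi M'\<bar>) + \<bar>?E Psi - Psi M\<bar>" by linarith
  have EQ: "?E Qp = ?E Wp / ln y + ?E Db + Bc * ?E (\<lambda>M. Gr fs (size M)) + (b / a) ^ n"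
  proof -
    have "?E Qp = ?E (\<lambda>M. Wp M / ln y + Db M + Bc * Gr fs (size M)) + (b / a) ^ n"
      unfolding Qp_def by (subst Bochner_Integration.integral_add[OF int int]) simp
    also have "?E (\<lambda>M. Wp M / ln y + Db M + Bc * Gr fs (size M)) = ?E (\<lambda>M. Wp M / ln y + Db M) + ?E (\<lambda>M. Bc * Gr fs (size M))"
      by (rule Bochner_Integration.integral_add[OF int int])
    also have "?E (\<lambda>M. Wp M / ln y + Db M) = ?E (\<lambda>M. Wp M / ln y) + ?E Db"
      by (rule Bochner_Integration.integral_add[OF int int])
    finally show ?thesis by simp
  qed
  have "?E Qp - Qp M = (?E Wp - Wp M) / ln y + (?E Db - Db M) + Bc * (?E (\<lambda>M. Gr fs (size M)) - Gr fs (size M))"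
    unfolding EQ Qp_def by (simp add: diff_divide_distrib algebra_simps)
  also have "\<dots> \<le> (4 * E0 * Kc * fs (size M)) / ln y + (2 * E0\<^sup>2 + 4 * E0 * Rm / (a + b)) / y\<^sup>2 * fs (size M) + Bc * (- fs (size M))"
    using step_W[OF g] step_Db[OF g] Gr_step[OF few sz, of fs] fs_nonneg Bc_nonneg lny
    by (intro add_mono divide_right_mono mult_left_mono) auto
  finally have 2: "?E Qp - Qp M \<le> (4 * E0 * Kc / ln y + (2 * E0\<^sup>2 + 4 * E0 * Rm / (a + b)) / y\<^sup>2 - Bc) * fs (size M)"
    by (simp add: algebra_simps)
  have "\<bar>?E Psi - Psi M\<bar> + (?E Qp - Qp M) \<le>
    ((2 * E0 + L0) / ln y + (24 * (L0 + E0)\<^sup>2 + 24 * (L0 + E0) * Rm / (a + b) + 2 * Cr) / y\<^sup>2 + 4 * \<delta>) * fs (size M)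
    + (4 * E0 * Kc / ln y + (2 * E0\<^sup>2 + 4 * E0 * Rm / (a + b)) / y\<^sup>2 - Bc) * fs (size M)"
    by (rule add_mono[OF step_Psi[OF g] 2])
  also have "\<dots> = - (1 / y\<^sup>2) * fs (size M)"
    unfolding distrib_right[symmetric] Bc_def K1_def K2_def by (simp add: add_divide_distrib)
  also have "\<dots> \<le> - (1 / y\<^sup>2) * (1 / real n)"
    using fs_ge[of "size M"] sz ne_0 by (intro mult_left_mono_neg) auto
  finally have 3: "\<bar>?E Psi - Psi M\<bar> + (?E Qp - Qp M) \<le> - (1 / (y\<^sup>2 * real n))" by simp
  have "?E (\<lambda>M'. \<bar>bp_val n pay M' - Psi M'\<bar> - Qp M') = ?E (\<lambda>M'. \<bar>bp_val n pay M' - Psi M'\<bar>) - ?E Qp"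
    by (rule Bochner_Integration.integral_diff[OF int int])
  then show "finite (set_pmf (stp M)) \<and> set_pmf (stp M) \<subseteq> {M. size M \<le> n} \<and>
     \<bar>bp_val n pay M - Psi M\<bar> - Qp M \<le> ?E (\<lambda>M'. \<bar>bp_val n pay M' - Psi M'\<bar> - Qp M') - 1 / (y\<^sup>2 * real n)"
    using fin sub 1 3 by linarith
qed

lemma Gr_le: "Gr fs N \<le> 4 * (a + b) / lam"
proof -
  have "(\<Sum>k=1..n. fs k * rho1 ^ (N - k)) \<le> (\<Sum>k=1..n. fs k * 1)"
    using rho1 fs_nonneg by (intro sum_mono mult_left_mono) (auto intro!: power_le_one)
  also have "\<dots> = (\<Sum>k=1..n. 1 + ln (real n / real k)) / real n"
    by (simp add: fs_def sum_divide_distrib)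
  also have "\<dots> \<le> (real n + real n) / real n"
    using sum_ln_ratio_le[OF npos] by (intro divide_right_mono) (auto simp: sum.distrib)
  also have "\<dots> = 2" using npos by simp
  finally have "(\<Sum>k=1..n. fs k * rho1 ^ (N - k)) \<le> 2" .
  then have "2 * (a + b) / lam * (\<Sum>k=1..n. fs k * rho1 ^ (N - k)) \<le> 2 * (a + b) / lam * 2"
    using lamp a0 b0 by (intro mult_left_mono) auto
  then show ?thesis unfolding Gr_def by simp
qed

lemma initial_estimate:
  "\<bar>bp_val n pay {#u#} - (1 - b / a) * exp (cc * bd_I a lam (1 - x) 0)\<bar> \<le> Bc * (4 * (a + b) / lam) + (b / a) ^ n + L0 / real n"
proof -
  have wu: "wild u" by (simp add: wild_def)
  have 1: "\<bar>bp_val n pay {#u#} - Psi {#u#}\<bar> \<le> Qp {#u#}" using npos by (intro chain_estimate) simp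
  have "nw {#u#} = 0" "Db {#u#} = 0" using wu dbl_wild[OF wu] by (auto simp: nw_def Db_def)
  then have "Qp {#u#} = Bc * Gr fs 1 + (b / a) ^ n" by (simp add: Qp_def Wp_def Wf_def)
  also have "\<dots> \<le> Bc * (4 * (a + b) / lam) + (b / a) ^ n"
    using Gr_le Bc_nonneg by (intro add_right_mono mult_left_mono) auto
  finally have 2: "Qp {#u#} \<le> Bc * (4 * (a + b) / lam) + (b / a) ^ n" .
  have "mc {#u#} = 0" using ct_wild[OF wu] by (simp add: mc_def)
  then have "Psi {#u#} = (1 - b / a) * Phi 0 (1 / real n)" by (simp add: Psi_def Fm_def)
  moreover have "exp (cc * bd_I a lam (1 - x) 0) = Phi 0 0" by (simp add: Phi_def H_def)
  moreover have "\<bar>(1 - b / a) * (Phi 0 (1 / real n) - Phi 0 0)\<bar> \<le> 1 * (L0 * (1 / real n))"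
  proof (rule abs_mult_bound)
    show "\<bar>Phi 0 (1 / real n) - Phi 0 0\<bar> \<le> L0 * (1 / real n)"
      using C2b_lipschitz[OF C2b_Phi[of 0], of "1 / real n" 0] npos by simp
  qed (use rho in auto)
  ultimately have "\<bar>Psi {#u#} - (1 - b / a) * exp (cc * bd_I a lam (1 - x) 0)\<bar> \<le> L0 / real n"
    by (simp add: right_diff_distrib)
  then show ?thesis using 1 2 by linarith
qed

end

section \<open>Limits of generating functions\<close>

lemma (in bp_sites) mc_eq_sum_B_count: "mc M = (\<Sum>i\<in>T. B_count u M i)"
proof (induction M)
  case (add v M)
  have "ct v = (\<Sum>i\<in>T. if v i \<noteq> u i then 1 else 0)"
    unfolding ct_def using finT by (simp add: sum.If_cases Int_def)
  moreover have "B_count u (add_mset v M) i = (if v i \<noteq> u i then 1 else 0) + B_count u M i" for i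
    by (simp add: B_count_def)
  ultimately show ?case using add by (simp add: mc_def sum.distrib)
qed (simp add: mc_def B_count_def)

lemma bounded_geometric_cube:
  fixes r :: real
  assumes "0 \<le> r" "r < 1"
  obtains C where "\<And>k. k \<ge> 1 \<Longrightarrow> r ^ (k - 1) * real k ^ 3 \<le> C"
proof -
  define s where "s = root 3 r"
  have s: "0 \<le> s" "s < 1" "s ^ 3 = r" using assms by (auto simp: s_def real_root_lt_1_iff)
  have "(\<lambda>k. real k * s ^ k + s ^ k) \<longlonglongrightarrow> 0 + 0"
    using s by (intro tendsto_add powser_times_n_limit_0 LIMSEQ_realpow_zero) auto
  then have "Bseq (\<lambda>k. real k * s ^ k + s ^ k)" by (intro convergent_imp_Bseq convergentI)
  then obtain B where B: "\<And>k. norm (real k * s ^ k + s ^ k) \<le> B" by (auto simp: Bseq_def)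
  show thesis
  proof (rule that[of "B ^ 3"])
    fix k :: nat assume "k \<ge> 1"
    then obtain j where j: "k = Suc j" by (metis Suc_le_D One_nat_def)
    have "r ^ (k - 1) * real k ^ 3 = (real j * s ^ j + s ^ j) ^ 3"
    proof -
      have "r ^ j = (s ^ j) ^ 3" using s(3) by (metis power_mult mult.commute)
      moreover have "real j * s ^ j + s ^ j = s ^ j * real (Suc j)" by (simp add: algebra_simps)
      ultimately show ?thesis unfolding j by (simp only: diff_Suc_1 power_mult_distrib)
    qed
    also have "\<dots> \<le> B ^ 3"
    proof (rule power_mono)
      show "real j * s ^ j + s ^ j \<le> B" using B[of j] by simp
      show "0 \<le> real j * s ^ j + s ^ j" using s by simp
    qed
    finally show "r ^ (k - 1) * real k ^ 3 \<le> B ^ 3" .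
  qed
qed

lemma bp_pgf_limit:
  fixes a b Rm E0 x \<nu> \<epsilon> :: real
  assumes ab: "b < a" "0 \<le> b" and aR: "a \<le> Rm" and E0: "0 \<le> E0" and x: "0 \<le> x" "x < 1"
    and ne: "a - b \<noteq> a * (1 - x)" and nu: "\<nu> \<ge> 0" and eps: "\<epsilon> > 0"
  shows "\<exists>n0 \<delta>. \<delta> > 0 \<and> (\<forall>n\<ge>n0. \<forall>\<alpha> \<beta> Ssel S \<mu> T u. bp_pgf \<alpha> \<beta> Ssel S \<mu> T u a b Rm E0 n x \<nu> \<delta> \<longrightarrow>
     \<bar>(\<integral>M. (\<Prod>i\<in>T. x ^ B_count u M i) \<partial>measure_spmf (bp_hit \<alpha> \<beta> Ssel S \<mu> n {#u#})) -
      (1 - b / a) * exp (2 * a * \<nu> / (a - b) * bd_I a (a - b) (1 - x) 0)\<bar> \<le> \<epsilon>)"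
proof -
  obtain Cr where Cr: "\<And>k. k \<ge> 1 \<Longrightarrow> (b / a) ^ (k - 1) * real k ^ 3 \<le> Cr"
    using bounded_geometric_cube[of "b / a"] ab by auto
  define g where "g = 2 * a * \<nu> / (a - b)"
  define l where "l = 2 * \<bar>((a - b) - a * (1 - x)) / ((a - b) * (1 - x))\<bar> + g"
  define c1 where "c1 = 4 * E0 * (8 * Rm / (a - b)) + 2 * E0 + l"
  define c2 where "c2 = 24 * (l + E0)\<^sup>2 + 24 * (l + E0) * Rm / (a + b) + 2 * Cr + 2 * E0\<^sup>2 + 4 * E0 * Rm / (a + b) + 1"
  define q where "q = 4 * (a + b) / (a - b)"
  have q: "q > 0" using ab by (simp add: q_def)
  define \<delta> where "\<delta> = \<epsilon> / (8 * q)"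
  have d: "\<delta> > 0" "4 * \<delta> * q = \<epsilon> / 2" using q eps by (auto simp: \<delta>_def)
  define Y where "Y n = root 8 (real n)" for n :: nat
  have Yt: "filterlim Y at_top sequentially"
  proof (unfold filterlim_at_top, intro allI)
    fix Z :: real
    have "Z \<le> Y k" if "nat \<lceil>\<bar>Z\<bar> ^ 8\<rceil> \<le> k" for k
    proof -
      have "\<bar>Z\<bar> ^ 8 \<le> real k" using that by linarith
      then have "root 8 (\<bar>Z\<bar> ^ 8) \<le> Y k" unfolding Y_def by simp
      moreover have "root 8 (\<bar>Z\<bar> ^ 8) = \<bar>Z\<bar>" by (rule real_root_power_cancel) auto
      ultimately show ?thesis by linarith
    qed
    then show "\<forall>\<^sub>F k in sequentially. Z \<le> Y k" unfolding eventually_sequentially by blast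
  qed
  have "(\<lambda>n. (c1 / ln (Y n) + c2 / (Y n)\<^sup>2) * q + (b / a) ^ n + l / real n) \<longlonglongrightarrow> (0 + 0) * q + 0 + 0"
  proof (intro tendsto_add tendsto_mult tendsto_const)
    show "(\<lambda>n. c1 / ln (Y n)) \<longlonglongrightarrow> 0"
      by (rule tendsto_divide_0[OF tendsto_const filterlim_at_top_imp_at_infinity[OF filterlim_compose[OF ln_at_top Yt]]])
    show "(\<lambda>n. c2 / (Y n)\<^sup>2) \<longlonglongrightarrow> 0"
      by (rule tendsto_divide_0[OF tendsto_const filterlim_at_top_imp_at_infinity[OF filterlim_pow_at_top[OF _ Yt]]]) simp
    show "(\<lambda>n. (b / a) ^ n) \<longlonglongrightarrow> 0" using ab by (intro LIMSEQ_realpow_zero) auto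
    show "(\<lambda>n. l / real n) \<longlonglongrightarrow> 0"
      by (rule tendsto_divide_0[OF tendsto_const filterlim_at_top_imp_at_infinity[OF filterlim_real_sequentially]])
  qed
  then have "\<forall>\<^sub>F n in sequentially. (c1 / ln (Y n) + c2 / (Y n)\<^sup>2) * q + (b / a) ^ n + l / real n < \<epsilon> / 2"
    by (rule order_tendstoD(2)) (use eps in simp)
  moreover have "\<forall>\<^sub>F n in sequentially. Y n > 1" using Yt by (simp add: filterlim_at_top_dense)
  moreover have "\<forall>\<^sub>F n in sequentially. Y n ^ 3 \<ge> 8 * Rm / (a - b) + 1"
    using filterlim_pow_at_top[OF _ Yt, of 3] by (simp add: filterlim_at_top)
  ultimately have "\<forall>\<^sub>F n in sequentially. (c1 / ln (Y n) + c2 / (Y n)\<^sup>2) * q + (b / a) ^ n + l / real n < \<epsilon> / 2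
     \<and> Y n > 1 \<and> Y n ^ 3 \<ge> 8 * Rm / (a - b) + 1"
    by eventually_elim auto
  then obtain n0 where n0: "\<And>n. n \<ge> n0 \<Longrightarrow> (c1 / ln (Y n) + c2 / (Y n)\<^sup>2) * q + (b / a) ^ n + l / real n < \<epsilon> / 2
     \<and> Y n > 1 \<and> Y n ^ 3 \<ge> 8 * Rm / (a - b) + 1"
    unfolding eventually_sequentially by auto
  show ?thesis
  proof (intro exI[of _ n0] exI[of _ \<delta>] conjI allI impI)
    show "\<delta> > 0" by (rule d)
    fix n \<alpha> \<beta> Ssel S \<mu> T u
    assume n: "n0 \<le> n" and A: "bp_pgf \<alpha> \<beta> Ssel S \<mu> T u a b Rm E0 n x \<nu> \<delta>"
    interpret bp_pgf \<alpha> \<beta> Ssel S \<mu> T u a b Rm E0 n x \<nu> \<delta> by (rule A)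
    interpret bp_big \<alpha> \<beta> Ssel S \<mu> T u a b Rm E0 n x \<nu> \<delta> "Y n" Cr
    proof unfold_locales
      show "Y n ^ 8 = real n" by (simp add: Y_def)
    qed (use n0[OF n] Cr in auto)
    have "(\<integral>M. (\<Prod>i\<in>T. x ^ B_count u M i) \<partial>measure_spmf (bp_hit \<alpha> \<beta> Ssel S \<mu> n {#u#})) = bp_val n pay {#u#}"
      unfolding bp_val_def pay_def mc_eq_sum_B_count power_sum ..
    moreover have "\<bar>bp_val n pay {#u#} - (1 - b / a) * exp (2 * a * \<nu> / (a - b) * bd_I a (a - b) (1 - x) 0)\<bar> \<le>
       (c1 / ln (Y n) + c2 / (Y n)\<^sup>2 + 4 * \<delta>) * q + (b / a) ^ n + l / real n"
      using initial_estimate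
      unfolding Bc_def K1_def K2_def L0_def kap_def cc_def Kc_def c1_def c2_def l_def g_def q_def .
    moreover have "(c1 / ln (Y n) + c2 / (Y n)\<^sup>2 + 4 * \<delta>) * q + (b / a) ^ n + l / real n \<le> \<epsilon>"
      using n0[OF n] d unfolding distrib_right[of _ "4 * \<delta>" q] by linarith
    ultimately show "\<bar>(\<integral>M. (\<Prod>i\<in>T. x ^ B_count u M i) \<partial>measure_spmf (bp_hit \<alpha> \<beta> Ssel S \<mu> n {#u#})) -
      (1 - b / a) * exp (2 * a * \<nu> / (a - b) * bd_I a (a - b) (1 - x) 0)\<bar> \<le> \<epsilon>" by simp
  qed
qed

text \<open>The coefficients are read off one after the other from values of the generating function at
  small arguments; a bounded mass excludes any contribution of the tail.\<close>
lemma pgf_close_imp_coeffs_close: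
  fixes L :: "nat \<Rightarrow> real"
  assumes L: "\<And>k. L k \<ge> 0" "L sums 1" and x0: "0 < x0" "x0 \<le> 1" and eps: "\<epsilon> > 0"
  shows "\<exists>X d. finite X \<and> X \<subseteq> {0<..<x0} \<and> d > 0 \<and>
    (\<forall>p. (\<forall>k. p k \<ge> 0) \<and> p sums 1 \<and> (\<forall>x\<in>X. \<bar>(\<Sum>k. p k * x ^ k) - (\<Sum>k. L k * x ^ k)\<bar> < d) \<longrightarrow> (\<forall>j<K. \<bar>p j - L j\<bar> < \<epsilon>))"
  using eps
proof (induction K arbitrary: \<epsilon>)
  case 0
  show ?case by (intro exI[of _ "{}"] exI[of _ 1]) auto
next
  case (Suc K)
  define x where "x = min (x0 / 2) (\<epsilon> / 8)"
  have x: "0 < x" "x < x0" "x \<le> \<epsilon> / 8" "x < 1" using x0 Suc.prems by (auto simp: x_def min_def)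
  have xK: "x ^ K > 0" "x ^ K \<le> 1" using x by (auto intro!: power_le_one)
  define e where "e = \<epsilon> * x ^ K / (4 * real (Suc K))"
  have e: "e > 0" using Suc.prems xK by (simp add: e_def)
  have eK: "real K * e \<le> \<epsilon> * x ^ K / 4"
    using Suc.prems xK by (simp add: e_def field_simps)
  have ee: "e \<le> \<epsilon>"
  proof -
    have "e \<le> \<epsilon> * x ^ K / 1" unfolding e_def using Suc.prems xK by (intro divide_left_mono) auto
    also have "\<dots> \<le> \<epsilon> * 1" using Suc.prems xK by (simp add: mult_left_le)
    finally show ?thesis by simp
  qed
  obtain X d where X: "finite X" "X \<subseteq> {0<..<x0}" "d > 0"
    and IH: "\<forall>p. (\<forall>k. p k \<ge> 0) \<and> p sums 1 \<and> (\<forall>x\<in>X. \<bar>(\<Sum>k. p k * x ^ k) - (\<Sum>k. L k * x ^ k)\<bar> < d) \<longrightarrow> (\<forall>j<K. \<bar>p j - L j\<bar> < e)"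
    using Suc.IH[OF e] by (elim exE conjE)
  define d' where "d' = min d (\<epsilon> * x ^ K / 4)"
  show ?case
  proof (intro exI[of _ "insert x X"] exI[of _ d'] conjI allI impI)
    show "finite (insert x X)" "insert x X \<subseteq> {0<..<x0}" using X x by auto
    show "d' > 0" using X Suc.prems xK by (simp add: d'_def)
    fix p :: "nat \<Rightarrow> real" and j
    assume p: "(\<forall>k. p k \<ge> 0) \<and> p sums 1 \<and> (\<forall>x\<in>insert x X. \<bar>(\<Sum>k. p k * x ^ k) - (\<Sum>k. L k * x ^ k)\<bar> < d')"
      and j: "j < Suc K"
    have lo: "\<forall>j<K. \<bar>p j - L j\<bar> < e" using p by (intro IH[THEN spec, THEN mp]) (auto simp: d'_def)
    have summ: "summable (\<lambda>k. f k * x ^ k)" if "\<And>k. f k \<ge> 0" "f sums 1" for f :: "nat \<Rightarrow> real"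
    proof (rule summable_comparison_test'[of f 0])
      show "summable f" using that by (simp add: sums_iff)
      show "norm (f k * x ^ k) \<le> f k" for k
        using that(1)[of k] x by (simp add: mult_left_le power_le_one)
    qed
    have split: "\<exists>r. 0 \<le> r \<and> r \<le> x \<and> (\<Sum>k. f k * x ^ k) = (\<Sum>k<K. f k * x ^ k) + x ^ K * (f K + r)"
      if f: "\<And>k. f k \<ge> 0" "f sums 1" for f :: "nat \<Rightarrow> real"
    proof -
      have s: "summable (\<lambda>k. f k * x ^ k)" by (rule summ[OF f])
      have sf: "summable f" "suminf f = 1" using f by (auto simp: sums_iff)
      define r where "r = (\<Sum>k. f (k + Suc K) * x ^ Suc k)"
      have s2: "summable (\<lambda>k. f (k + Suc K))" by (rule summable_ignore_initial_segment[OF sf(1)])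
      have le: "f (k + Suc K) * x ^ Suc k \<le> x * f (k + Suc K)" for k
      proof -
        have "x ^ Suc k \<le> x * 1" using x by (simp add: mult_left_le power_le_one)
        then have "f (k + Suc K) * x ^ Suc k \<le> f (k + Suc K) * (x * 1)" using f(1) by (intro mult_left_mono) auto
        then show ?thesis by (simp add: mult.commute)
      qed
      have s3: "summable (\<lambda>k. f (k + Suc K) * x ^ Suc k)"
        by (rule summable_comparison_test'[OF summable_mult[OF s2, of x], of 0]) (use le f x in auto)
      have "r \<le> (\<Sum>k. x * f (k + Suc K))" unfolding r_def by (rule suminf_le[OF le s3 summable_mult[OF s2]])
      also have "\<dots> = x * (\<Sum>k. f (k + Suc K))" by (rule suminf_mult[OF s2])
      also have "\<dots> \<le> x * 1"
      proof (rule mult_left_mono)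
        have "(\<Sum>k. f (k + Suc K)) = 1 - (\<Sum>k<Suc K. f k)"
          using suminf_minus_initial_segment[OF sf(1), of "Suc K"] sf(2) by simp
        then show "(\<Sum>k. f (k + Suc K)) \<le> 1" using f(1) sum_nonneg[of "{..<Suc K}" f] by simp
      qed (use x in auto)
      finally have "r \<le> x" by simp
      moreover have "r \<ge> 0" unfolding r_def using f x by (intro suminf_nonneg[OF s3]) auto
      moreover have "(\<Sum>k. f k * x ^ k) = (\<Sum>k<K. f k * x ^ k) + x ^ K * (f K + r)"
      proof -
        have "(\<Sum>k. f k * x ^ k) = (\<Sum>k. f (k + Suc K) * x ^ (k + Suc K)) + (\<Sum>k<Suc K. f k * x ^ k)"
          by (rule suminf_split_initial_segment[OF s])
        also have "(\<Sum>k. f (k + Suc K) * x ^ (k + Suc K)) = (\<Sum>k. x ^ K * (f (k + Suc K) * x ^ Suc k))"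
          by (simp add: power_add mult_ac)
        also have "\<dots> = x ^ K * r" unfolding r_def by (rule suminf_mult[OF s3])
        finally show ?thesis by (simp add: algebra_simps)
      qed
      ultimately show ?thesis by blast
    qed
    obtain r where r: "0 \<le> r" "r \<le> x" "(\<Sum>k. p k * x ^ k) = (\<Sum>k<K. p k * x ^ k) + x ^ K * (p K + r)" using split[of p] p by blast
    obtain t where t: "0 \<le> t" "t \<le> x" "(\<Sum>k. L k * x ^ k) = (\<Sum>k<K. L k * x ^ k) + x ^ K * (L K + t)" using split[of L] L by blast
    have "\<bar>(\<Sum>k<K. p k * x ^ k) - (\<Sum>k<K. L k * x ^ k)\<bar> \<le> (\<Sum>k<K. \<bar>(p k - L k) * x ^ k\<bar>)"
      unfolding sum_subtractf[symmetric] left_diff_distrib[symmetric] by (rule sum_abs)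
    also have "\<dots> \<le> (\<Sum>k<K. e)"
    proof (rule sum_mono)
      fix k assume "k \<in> {..<K}"
      then have "\<bar>p k - L k\<bar> \<le> e" using lo by auto
      moreover have "\<bar>x ^ k\<bar> \<le> 1" using x by (simp add: power_le_one)
      ultimately show "\<bar>(p k - L k) * x ^ k\<bar> \<le> e" using abs_mult_bound[of "p k - L k" e "x ^ k" 1] by simp
    qed
    also have "\<dots> = real K * e" by simp
    finally have A: "\<bar>(\<Sum>k<K. p k * x ^ k) - (\<Sum>k<K. L k * x ^ k)\<bar> \<le> \<epsilon> * x ^ K / 4" using eK by simp
    have B: "\<bar>(\<Sum>k. p k * x ^ k) - (\<Sum>k. L k * x ^ k)\<bar> < \<epsilon> * x ^ K / 4" using p by (auto simp: d'_def)
    have "x ^ K * ((p K - L K) + (r - t)) = ((\<Sum>k. p k * x ^ k) - (\<Sum>k. L k * x ^ k)) - ((\<Sum>k<K. p k * x ^ k) - (\<Sum>k<K. L k * x ^ k))"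
      unfolding r(3) t(3) by (simp add: algebra_simps)
    then have "\<bar>x ^ K * ((p K - L K) + (r - t))\<bar> \<le> \<epsilon> * x ^ K / 4 + \<epsilon> * x ^ K / 4" using A B by linarith
    then have "x ^ K * \<bar>(p K - L K) + (r - t)\<bar> \<le> x ^ K * (\<epsilon> / 2)" using xK by (simp add: abs_mult mult.commute)
    then have "\<bar>(p K - L K) + (r - t)\<bar> \<le> \<epsilon> / 2" using xK by simp
    moreover have "\<bar>r - t\<bar> \<le> \<epsilon> / 8" using r t x by linarith
    ultimately have "\<bar>p K - L K\<bar> < \<epsilon>" using Suc.prems by linarith
    then show "\<bar>p j - L j\<bar> < \<epsilon>" using j lo[rule_format, of j] ee by (cases "j = K") auto
  qed
qed

lemma pgf_close_imp_l1_close: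
  fixes L :: "nat \<Rightarrow> real"
  assumes L: "\<And>k. L k \<ge> 0" "L sums 1" and x0: "0 < x0" "x0 \<le> 1" and eps: "\<epsilon> > 0"
  shows "\<exists>X d. finite X \<and> X \<subseteq> {0<..<x0} \<and> d > 0 \<and>
    (\<forall>p. (\<forall>k. p k \<ge> 0) \<and> p sums 1 \<and> (\<forall>x\<in>X. \<bar>(\<Sum>k. p k * x ^ k) - (\<Sum>k. L k * x ^ k)\<bar> < d) \<longrightarrow> (\<Sum>k. \<bar>p k - L k\<bar>) \<le> \<epsilon>)"
proof -
  have "(\<lambda>K. \<Sum>k<K. L k) \<longlonglongrightarrow> 1" using L by (simp add: sums_def)
  then have "\<forall>\<^sub>F K in sequentially. (\<Sum>k<K. L k) > 1 - \<epsilon> / 4" using eps by (intro order_tendstoD(1)) auto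
  then obtain K where K: "(\<Sum>k<K. L k) > 1 - \<epsilon> / 4" by (auto simp: eventually_sequentially)
  define e where "e = \<epsilon> / (4 * real (Suc K))"
  have e: "e > 0" "real K * e \<le> \<epsilon> / 4" using eps by (auto simp: e_def field_simps)
  obtain X d where X: "finite X" "X \<subseteq> {0<..<x0}" "d > 0"
    and cl: "\<forall>p. (\<forall>k. p k \<ge> 0) \<and> p sums 1 \<and> (\<forall>x\<in>X. \<bar>(\<Sum>k. p k * x ^ k) - (\<Sum>k. L k * x ^ k)\<bar> < d) \<longrightarrow> (\<forall>j<K. \<bar>p j - L j\<bar> < e)"
    using pgf_close_imp_coeffs_close[OF L x0 e(1), of K] by (elim exE conjE)
  show ?thesis
  proof (intro exI[of _ X] exI[of _ d] conjI X allI impI)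
    fix p :: "nat \<Rightarrow> real"
    assume p: "(\<forall>k. p k \<ge> 0) \<and> p sums 1 \<and> (\<forall>x\<in>X. \<bar>(\<Sum>k. p k * x ^ k) - (\<Sum>k. L k * x ^ k)\<bar> < d)"
    have lo: "\<forall>j<K. \<bar>p j - L j\<bar> < e" by (rule cl[THEN spec, THEN mp, OF p])
    have sp: "summable p" "suminf p = 1" and sL: "summable L" "suminf L = 1" using p L by (auto simp: sums_iff)
    have s: "summable (\<lambda>k. \<bar>p k - L k\<bar>)"
    proof (rule summable_comparison_test'[of "\<lambda>k. p k + L k" 0])
      show "summable (\<lambda>k. p k + L k)" using sp sL by (intro summable_add) auto
      show "norm \<bar>p k - L k\<bar> \<le> p k + L k" for k using p L(1)[of k] by (simp add: abs_le_iff)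
    qed
    have head: "(\<Sum>k<K. \<bar>p k - L k\<bar>) \<le> \<epsilon> / 4"
    proof -
      have "(\<Sum>k<K. \<bar>p k - L k\<bar>) \<le> (\<Sum>k<K. e)" using lo by (intro sum_mono) (auto simp: less_imp_le)
      then show ?thesis using e by simp
    qed
    have tl: "(\<Sum>k. f (k + K)) = 1 - (\<Sum>k<K. f k)" if "summable f" "suminf f = 1" for f :: "nat \<Rightarrow> real"
      using suminf_minus_initial_segment[OF that(1), of K] that(2) by simp
    have "(\<Sum>k. \<bar>p (k + K) - L (k + K)\<bar>) \<le> (\<Sum>k. p (k + K) + L (k + K))"
    proof (rule suminf_le)
      show "\<bar>p (k + K) - L (k + K)\<bar> \<le> p (k + K) + L (k + K)" for k using p L(1)[of "k + K"] by (simp add: abs_le_iff)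
      show "summable (\<lambda>k. \<bar>p (k + K) - L (k + K)\<bar>)" using s by (simp add: summable_iff_shift[of "\<lambda>k. \<bar>p k - L k\<bar>"])
      show "summable (\<lambda>k. p (k + K) + L (k + K))" using sp sL by (intro summable_add) (simp_all add: summable_iff_shift)
    qed
    also have "\<dots> = (1 - (\<Sum>k<K. p k)) + (1 - (\<Sum>k<K. L k))"
      using sp sL by (subst suminf_add[symmetric]) (simp_all add: summable_iff_shift tl)
    also have "(\<Sum>k<K. L k) - (\<Sum>k<K. p k) \<le> \<epsilon> / 4"
    proof -
      have "(\<Sum>k<K. L k) - (\<Sum>k<K. p k) \<le> (\<Sum>k<K. \<bar>p k - L k\<bar>)"
        unfolding sum_subtractf[symmetric] by (intro sum_mono) auto
      then show ?thesis using head by linarith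
    qed
    then have "(1 - (\<Sum>k<K. p k)) + (1 - (\<Sum>k<K. L k)) \<le> 3 * \<epsilon> / 4" using K by linarith
    finally have tail: "(\<Sum>k. \<bar>p (k + K) - L (k + K)\<bar>) \<le> 3 * \<epsilon> / 4" .
    have "(\<Sum>k. \<bar>p k - L k\<bar>) = (\<Sum>k. \<bar>p (k + K) - L (k + K)\<bar>) + (\<Sum>k<K. \<bar>p k - L k\<bar>)"
      by (rule suminf_split_initial_segment[OF s])
    then show "(\<Sum>k. \<bar>p k - L k\<bar>) \<le> \<epsilon>" using head tail by linarith
  qed
qed

section \<open>The empirical site frequency measure\<close>

lemma spmf_integrable_bounded:
  fixes f :: "'a \<Rightarrow> real"
  assumes "\<And>M. \<bar>f M\<bar> \<le> B"
  shows "integrable (measure_spmf p) f"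
  using assms by (intro measure_spmf.integrable_const_bound[where B = B]) auto

lemma spmf_chebyshev_pairwise:
  fixes X :: "'i \<Rightarrow> 'a \<Rightarrow> real" and l :: "'i \<Rightarrow> real"
  assumes I: "finite I" and X: "\<And>i M. i \<in> I \<Longrightarrow> 0 \<le> X i M \<and> X i M \<le> 1" and l: "\<And>i. i \<in> I \<Longrightarrow> 0 \<le> l i \<and> l i \<le> 1"
    and m0: "\<bar>weight_spmf p - h\<bar> \<le> e" and m1: "\<And>i. i \<in> I \<Longrightarrow> \<bar>(\<integral>M. X i M \<partial>measure_spmf p) - h * l i\<bar> \<le> e"
    and m2: "\<And>i j. i \<in> I \<Longrightarrow> j \<in> I \<Longrightarrow> i \<noteq> j \<Longrightarrow> \<bar>(\<integral>M. X i M * X j M \<partial>measure_spmf p) - h * (l i * l j)\<bar> \<le> e"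
    and t: "t > 0"
  shows "measure (measure_spmf p) {M. t \<le> \<bar>\<Sum>i\<in>I. X i M - l i\<bar>} \<le> (real (card I) + 4 * e * (real (card I))\<^sup>2) / t\<^sup>2"
proof -
  let ?P = "measure_spmf p"
  define D where "D i M = X i M - l i" for i M
  have D: "\<bar>D i M\<bar> \<le> 1" if "i \<in> I" for i M using X[OF that, of M] l[OF that] by (auto simp: D_def abs_le_iff)
  have e0: "e \<ge> 0" using m0 by linarith
  have sq: "(\<Sum>i\<in>I. D i M)\<^sup>2 = (\<Sum>i\<in>I. \<Sum>j\<in>I. D i M * D j M)" for M
    by (simp add: power2_eq_square sum_product)
  have DD: "\<bar>D i M * D j M\<bar> \<le> 1" if "i \<in> I" "j \<in> I" for i j M
    using abs_mult_bound[OF D[OF that(1)] D[OF that(2)]] by simp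
  have intDD: "integrable ?P (\<lambda>M. D i M * D j M)" if "i \<in> I" "j \<in> I" for i j
    using DD[OF that] by (rule spmf_integrable_bounded)
  have diag: "(\<integral>M. D i M * D i M \<partial>?P) \<le> 1" if i: "i \<in> I" for i
  proof -
    have "(\<integral>M. D i M * D i M \<partial>?P) \<le> (\<integral>M. 1 \<partial>?P)"
      using DD[OF i i] by (intro integral_mono intDD i spmf_integrable_bounded[where B = 1]) (auto simp: abs_le_iff)
    also have "\<dots> \<le> 1" by (simp add: measure_spmf.subprob_measure_le_1)
    finally show ?thesis .
  qed
  have off: "(\<integral>M. D i M * D j M \<partial>?P) \<le> 4 * e" if ij: "i \<in> I" "j \<in> I" "i \<noteq> j" for i j
  proof -
    have XX: "\<bar>X i M * X j M\<bar> \<le> 1" for M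
      using abs_mult_bound[of "X i M" 1 "X j M" 1] X[OF ij(1), of M] X[OF ij(2), of M] by simp
    have bX: "\<bar>X i M\<bar> \<le> 1" "\<bar>X j M\<bar> \<le> 1" for M using X[OF ij(1), of M] X[OF ij(2), of M] by auto
    note int = spmf_integrable_bounded[of _ 1 p]
    have iC: "integrable ?P (\<lambda>M. l i * l j)" by (rule spmf_integrable_bounded[where B = "\<bar>l i * l j\<bar>"]) simp
    have iX: "integrable ?P (\<lambda>M. l j * X i M)" "integrable ?P (\<lambda>M. l i * X j M)"
      using int[OF bX(1)] int[OF bX(2)] by auto
    have "(\<integral>M. D i M * D j M \<partial>?P) = (\<integral>M. (X i M * X j M - l j * X i M) - (l i * X j M - l i * l j) \<partial>?P)"
      by (intro Bochner_Integration.integral_cong) (auto simp: D_def algebra_simps)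
    also have "\<dots> = (\<integral>M. X i M * X j M - l j * X i M \<partial>?P) - (\<integral>M. l i * X j M - l i * l j \<partial>?P)"
      by (rule Bochner_Integration.integral_diff[OF Bochner_Integration.integrable_diff[OF int[OF XX] iX(1)]
            Bochner_Integration.integrable_diff[OF iX(2) iC]])
    also have "(\<integral>M. X i M * X j M - l j * X i M \<partial>?P) = (\<integral>M. X i M * X j M \<partial>?P) - l j * (\<integral>M. X i M \<partial>?P)"
      by (subst Bochner_Integration.integral_diff[OF int[OF XX] iX(1)]) simp
    also have "(\<integral>M. l i * X j M - l i * l j \<partial>?P) = l i * (\<integral>M. X j M \<partial>?P) - l i * l j * weight_spmf p"
      by (subst Bochner_Integration.integral_diff[OF iX(2) iC]) (simp add: weight_spmf_def)
    finally have eq: "(\<integral>M. D i M * D j M \<partial>?P) = (\<integral>M. X i M * X j M \<partial>?P) - l j * (\<integral>M. X i M \<partial>?P) - (l i * (\<integral>M. X j M \<partial>?P) - l i * l j * weight_spmf p)" .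
    have b1: "\<bar>l j * ((\<integral>M. X i M \<partial>?P) - h * l i)\<bar> \<le> 1 * e" using l[OF ij(2)] by (intro abs_mult_bound m1 ij) auto
    have b2: "\<bar>l i * ((\<integral>M. X j M \<partial>?P) - h * l j)\<bar> \<le> 1 * e" using l[OF ij(1)] by (intro abs_mult_bound m1 ij) auto
    have b3: "\<bar>(l i * l j) * (weight_spmf p - h)\<bar> \<le> 1 * e"
      using l[OF ij(1)] l[OF ij(2)] by (intro abs_mult_bound[OF _ m0]) (auto simp: mult_le_one)
    have "(\<integral>M. D i M * D j M \<partial>?P) = ((\<integral>M. X i M * X j M \<partial>?P) - h * (l i * l j)) - l j * ((\<integral>M. X i M \<partial>?P) - h * l i)
       - l i * ((\<integral>M. X j M \<partial>?P) - h * l j) + (l i * l j) * (weight_spmf p - h)"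
      unfolding eq by (simp add: algebra_simps)
    then show ?thesis using b1 b2 b3 m2[OF ij] by linarith
  qed
  have bnd: "(\<integral>M. D i M * D j M \<partial>?P) \<le> (if i = j then 1 else 0) + 4 * e" if "i \<in> I" "j \<in> I" for i j
    using diag[OF that(1)] off[OF that] e0 by (cases "i = j") auto
  have intS: "integrable ?P (\<lambda>M. (\<Sum>i\<in>I. D i M)\<^sup>2)"
    unfolding sq by (intro Bochner_Integration.integrable_sum intDD)
  have "(\<integral>M. (\<Sum>i\<in>I. D i M)\<^sup>2 \<partial>?P) = (\<Sum>i\<in>I. \<Sum>j\<in>I. \<integral>M. D i M * D j M \<partial>?P)"
    unfolding sq by (subst Bochner_Integration.integral_sum, intro Bochner_Integration.integrable_sum intDD, assumption+)
      (intro sum.cong refl Bochner_Integration.integral_sum intDD)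
  also have "\<dots> \<le> (\<Sum>i\<in>I. \<Sum>j\<in>I. (if i = j then 1 else 0) + 4 * e)"
    by (intro sum_mono bnd)
  also have "\<dots> = real (card I) + 4 * e * (real (card I))\<^sup>2"
    using I by (simp add: sum.distrib power2_eq_square algebra_simps)
  finally have 1: "(\<integral>M. (\<Sum>i\<in>I. D i M)\<^sup>2 \<partial>?P) \<le> real (card I) + 4 * e * (real (card I))\<^sup>2" .
  let ?A = "{M. t \<le> \<bar>\<Sum>i\<in>I. X i M - l i\<bar>}"
  have "measure ?P ?A = (\<integral>M. indicator ?A M \<partial>?P)" by simp
  also have "\<dots> \<le> (\<integral>M. (\<Sum>i\<in>I. D i M)\<^sup>2 / t\<^sup>2 \<partial>?P)"
  proof (rule integral_mono)
    show "integrable ?P (indicator ?A :: _ \<Rightarrow> real)" by (rule spmf_integrable_bounded[where B = 1]) auto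
    show "integrable ?P (\<lambda>M. (\<Sum>i\<in>I. D i M)\<^sup>2 / t\<^sup>2)" using intS by simp
    fix M
    show "indicator ?A M \<le> (\<Sum>i\<in>I. D i M)\<^sup>2 / t\<^sup>2"
    proof (cases "M \<in> ?A")
      case True
      then have "t \<le> \<bar>\<Sum>i\<in>I. D i M\<bar>" by (simp add: D_def)
      then have "t\<^sup>2 \<le> \<bar>\<Sum>i\<in>I. D i M\<bar>\<^sup>2" using t by (intro power_mono) auto
      then have "t\<^sup>2 \<le> (\<Sum>i\<in>I. D i M)\<^sup>2" by simp
      then show ?thesis using True t by simp
    qed simp
  qed
  also have "\<dots> = (\<integral>M. (\<Sum>i\<in>I. D i M)\<^sup>2 \<partial>?P) / t\<^sup>2" by simp
  also have "\<dots> \<le> (real (card I) + 4 * e * (real (card I))\<^sup>2) / t\<^sup>2" using 1 by (intro divide_right_mono) auto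
  finally show ?thesis .
qed

lemma emp_meas_pgf:
  assumes "finite S"
  shows "(\<lambda>k. emp_meas S u M k * x ^ k) sums ((\<Sum>i\<in>S. x ^ B_count u M i) / real (card S))"
proof -
  have "emp_meas S u M k * x ^ k = (\<Sum>i\<in>S. if k = B_count u M i then x ^ k else 0) / real (card S)" for k
  proof -
    have "real (card {i \<in> S. B_count u M i = k}) = (\<Sum>i\<in>S. if k = B_count u M i then 1 else 0)"
      using assms by (simp add: sum.If_cases Int_def eq_commute)
    then have "real (card {i \<in> S. B_count u M i = k}) * x ^ k = (\<Sum>i\<in>S. if k = B_count u M i then x ^ k else 0)"
      by (simp add: sum_distrib_right if_distrib[of "\<lambda>r. r * x ^ k"] cong: if_cong)
    then show ?thesis by (simp add: emp_meas_def)
  qed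
  moreover have "(\<lambda>k. (\<Sum>i\<in>S. if k = B_count u M i then x ^ k else 0) / real (card S)) sums ((\<Sum>i\<in>S. x ^ B_count u M i) / real (card S))"
    by (intro sums_divide sums_sum sums_single)
  ultimately show ?thesis by simp
qed

lemma one_minus_pmf_nuc: "1 - pmf p c = (\<Sum>psi\<in>UNIV - {c}. pmf p psi)" for p :: "nuc pmf"
proof -
  have "(\<Sum>psi\<in>UNIV. pmf p psi) = 1" by (rule sum_pmf_eq_1) (auto intro: finite_nuc)
  then show ?thesis using sum.remove[of UNIV c "pmf p"] finite_nuc by simp
qed

lemma finite_range_sel_part: "finite Ssel \<Longrightarrow> finite (range (sel_part Ssel))"
proof -
  assume f: "finite Ssel"
  have "range (sel_part Ssel) \<subseteq> PiE_dflt Ssel NA (\<lambda>_. UNIV)" by (auto simp: sel_part_def PiE_dflt_def)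
  then show ?thesis using finite_PiE_dflt[OF f, of "\<lambda>_. UNIV" NA] finite_nuc by (auto intro: finite_subset)
qed


lemma tendsto_outflow:
  fixes f :: "nat \<Rightarrow> nuc pmf" and t :: "nuc \<Rightarrow> real"
  assumes "\<And>psi. psi \<noteq> c \<Longrightarrow> (\<lambda>m. real (n m) * pmf (f m) psi) \<longlonglongrightarrow> t psi"
  shows "(\<lambda>m. real (n m) * (1 - pmf (f m) c)) \<longlonglongrightarrow> (\<Sum>psi\<in>UNIV - {c}. t psi)"
  unfolding one_minus_pmf_nuc sum_distrib_left using assms by (intro tendsto_sum) auto

theorem mainTheorem7:
  fixes Ssel :: "nat set" and J :: "'j set"
    and \<alpha> \<beta> :: "genome \<Rightarrow> real"
    and u0 :: genome and uJ :: "'j \<Rightarrow> nuc"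
    and \<theta> :: "'j \<Rightarrow> nuc \<Rightarrow> nuc \<Rightarrow> real" and q :: "'j \<Rightarrow> real"
    and \<theta>sel :: "nat \<Rightarrow> nuc \<Rightarrow> nuc \<Rightarrow> real"
    and n :: "nat \<Rightarrow> nat"
    and Sneut :: "nat \<Rightarrow> nat set" and Spart :: "nat \<Rightarrow> 'j \<Rightarrow> nat set"
    and \<mu> :: "nat \<Rightarrow> nat \<Rightarrow> nuc \<Rightarrow> nuc pmf" and \<mu>J :: "nat \<Rightarrow> 'j \<Rightarrow> nuc \<Rightarrow> nuc pmf"
    and u :: "nat \<Rightarrow> genome"
  assumes Ssel_fin: "finite Ssel" and Ssel_ne: "Ssel \<noteq> {}"
    and J_fin: "finite J"
    and rates_nonneg: "\<And>x. \<alpha> x \<ge> 0" "\<And>x. \<beta> x \<ge> 0"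
    and supercrit: "\<alpha> (sel_part Ssel u0) > \<beta> (sel_part Ssel u0)"
    and Sneut_fin: "\<And>m. finite (Sneut m)"
    and Sneut_disj: "\<And>m. Sneut m \<inter> Ssel = {}"
    and part_cover: "\<And>m. (\<Union>j\<in>J. Spart m j) = Sneut m"
    and part_disj: "\<And>m j j'. j \<in> J \<Longrightarrow> j' \<in> J \<Longrightarrow> j \<noteq> j' \<Longrightarrow> Spart m j \<inter> Spart m j' = {}"
    and mu_part: "\<And>m j i. j \<in> J \<Longrightarrow> i \<in> Spart m j \<Longrightarrow> \<mu> m i = \<mu>J m j"
    and u_part: "\<And>m j i. j \<in> J \<Longrightarrow> i \<in> Spart m j \<Longrightarrow> u m i = uJ j"
    and u_sel: "\<And>m i. i \<in> Ssel \<Longrightarrow> u m i = u0 i"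
    and Sneut_lim: "filterlim (\<lambda>m. card (Sneut m)) at_top sequentially"
    and n_lim: "filterlim n at_top sequentially"
    and mu_lim: "\<And>j chi psi. j \<in> J \<Longrightarrow> chi \<noteq> psi \<Longrightarrow>
                   (\<lambda>m. real (n m) * pmf (\<mu>J m j chi) psi) \<longlonglongrightarrow> \<theta> j chi psi"
    and mu_sel_lim: "\<And>i chi psi. i \<in> Ssel \<Longrightarrow> chi \<noteq> psi \<Longrightarrow>
                   (\<lambda>m. real (n m) * pmf (\<mu> m i chi) psi) \<longlonglongrightarrow> \<theta>sel i chi psi"
    and q_lim: "\<And>j. j \<in> J \<Longrightarrow> (\<lambda>m. real (card (Spart m j)) / real (card (Sneut m))) \<longlonglongrightarrow> q j"
  shows "\<forall>\<epsilon>>0. (\<lambda>m. bp_cond_prob \<alpha> \<beta> Ssel (Ssel \<union> Sneut m) (\<mu> m) (n m) (u m)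
            {M. (\<Sum>k. \<bar>emp_meas (Ssel \<union> Sneut m) (u m) M k
                     - (\<Sum>j\<in>J. q j * gen_LD
                          (\<alpha> (sel_part Ssel u0) - \<beta> (sel_part Ssel u0))
                          (\<alpha> (sel_part Ssel u0)) (\<beta> (sel_part Ssel u0))
                          (2 * \<alpha> (sel_part Ssel u0) / (\<alpha> (sel_part Ssel u0) - \<beta> (sel_part Ssel u0))
                             * (\<Sum>psi\<in>UNIV - {uJ j}. \<theta> j (uJ j) psi)) k)\<bar>) > \<epsilon>})
          \<longlonglongrightarrow> 0"
proof (intro allI impI)
  fix \<epsilon> :: real assume eps: "\<epsilon> > 0"
  define a where "a = \<alpha> (sel_part Ssel u0)"
  define b where "b = \<beta> (sel_part Ssel u0)"
  have ab: "b < a" "0 \<le> b" using supercrit rates_nonneg by (auto simp: a_def b_def)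
  define h where "h = 1 - b / a"
  have h: "h > 0" "h \<le> 1" using ab by (auto simp: h_def)
  define S where "S m = Ssel \<union> Sneut m" for m
  define p where "p m = bp_hit \<alpha> \<beta> Ssel (S m) (\<mu> m) (n m) {#u m#}" for m
  define \<nu> where "\<nu> j = (\<Sum>psi\<in>UNIV - {uJ j}. \<theta> j (uJ j) psi)" for j
  define Lam where "Lam j = gen_LD (a - b) a b (2 * a / (a - b) * \<nu> j)" for j
  define L where "L k = (\<Sum>j\<in>J. q j * Lam j k)" for k
  have finS: "finite (S m)" for m using Ssel_fin Sneut_fin by (simp add: S_def)
  have cardS: "card (S m) = card Ssel + card (Sneut m)" for m
    unfolding S_def using Ssel_fin Sneut_fin Sneut_disj by (subst card_Un_disjoint) auto
  have cS: "card Ssel > 0" using Ssel_fin Ssel_ne by (simp add: card_gt_0_iff)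
  have cS0: "real (card (S m)) > 0" for m using cS by (simp add: cardS)
  have Nlim: "filterlim (\<lambda>m. real (card (Sneut m))) at_top sequentially"
    by (rule filterlim_compose[OF filterlim_real_sequentially Sneut_lim])
  have Slim: "filterlim (\<lambda>m. real (card (S m))) at_top sequentially"
    by (rule filterlim_at_top_mono[OF Nlim]) (simp add: cardS)
  have finPart: "finite (Spart m j)" if "j \<in> J" for m j
    using part_cover[of m] that Sneut_fin[of m] by (metis UN_upper finite_subset)
  have sub: "Spart m j \<subseteq> Sneut m" if "j \<in> J" for m j using part_cover[of m] that by auto
  have th0: "\<theta> j chi psi \<ge> 0" if "j \<in> J" "chi \<noteq> psi" for j chi psi
    by (rule tendsto_lowerbound[OF mu_lim[OF that]]) auto
  have thsel0: "\<theta>sel i chi psi \<ge> 0" if "i \<in> Ssel" "chi \<noteq> psi" for i chi psi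
    by (rule tendsto_lowerbound[OF mu_sel_lim[OF that]]) auto
  have nu0: "\<nu> j \<ge> 0" if "j \<in> J" for j unfolding \<nu>_def using th0[OF that] by (intro sum_nonneg) auto
  have q0: "q j \<ge> 0" if "j \<in> J" for j
    by (rule tendsto_lowerbound[OF q_lim[OF that]]) auto
  have cardN: "(\<Sum>j\<in>J. real (card (Spart m j))) = real (card (Sneut m))" for m
    unfolding part_cover[of m, symmetric]
    using J_fin finPart part_disj by (subst card_UN_disjoint) auto
  have q1: "(\<Sum>j\<in>J. q j) = 1"
  proof -
    have "(\<lambda>m. \<Sum>j\<in>J. real (card (Spart m j)) / real (card (Sneut m))) \<longlonglongrightarrow> (\<Sum>j\<in>J. q j)"
      by (intro tendsto_sum q_lim)
    moreover have "\<forall>\<^sub>F m in sequentially. (\<Sum>j\<in>J. real (card (Spart m j)) / real (card (Sneut m))) = 1"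
      using filterlim_at_top_dense[THEN iffD1, OF Nlim, rule_format, of 0]
      by eventually_elim (simp add: sum_divide_distrib[symmetric] cardN)
    ultimately have "(\<lambda>m. 1) \<longlonglongrightarrow> (\<Sum>j\<in>J. q j)" by (rule Lim_transform_eventually)
    then show ?thesis using LIMSEQ_unique tendsto_const by blast
  qed
  have Lam_nonneg: "Lam j k \<ge> 0" for j k by (simp add: Lam_def gen_LD_nonneg)
  have c0: "2 * a / (a - b) * \<nu> j \<ge> 0" if "j \<in> J" for j using nu0[OF that] ab by simp
  have Lam_sums: "Lam j sums 1" if "j \<in> J" for j
    unfolding Lam_def using gen_LD_sums_1[OF ab c0[OF that]] .
  have L0: "L k \<ge> 0" for k unfolding L_def using q0 Lam_nonneg by (intro sum_nonneg) auto
  have L1: "L sums 1"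
  proof -
    have "(\<lambda>k. \<Sum>j\<in>J. q j * Lam j k) sums (\<Sum>j\<in>J. q j * 1)" by (intro sums_sum sums_mult Lam_sums)
    then show ?thesis using q1 by (simp add: L_def[abs_def])
  qed
  define x0 where "x0 = (if b > 0 then b / a else 1)"
  have x0: "0 < x0" "x0 \<le> 1" using ab by (auto simp: x0_def)
  define G where "G x j = exp (2 * a / (a - b) * \<nu> j * bd_I a (a - b) (1 - x) 0)" for x j
  have xne: "a - b \<noteq> a * (1 - x)" if "0 < x" "x < x0" for x
  proof (cases "b > 0")
    case True
    then have "x * a < b" using that ab by (simp add: x0_def pos_less_divide_eq)
    then show ?thesis by (simp add: algebra_simps)
  next
    case False
    then have "b = 0" using ab by simp
    then show ?thesis using that ab by simp
  qed
  have L_pgf: "(\<Sum>k. L k * x ^ k) = (\<Sum>j\<in>J. q j * G x j)" if x: "0 < x" "x < x0" for x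
  proof -
    have x1: "0 \<le> x" "x < 1" using x x0 by auto
    have "(\<lambda>k. \<Sum>j\<in>J. q j * (Lam j k * x ^ k)) sums (\<Sum>j\<in>J. q j * G x j)"
      unfolding Lam_def G_def using gen_LD_pgf[OF ab x1 c0 xne[OF x]] by (intro sums_sum sums_mult) auto
    then show ?thesis unfolding L_def by (simp add: sums_iff sum_distrib_right mult.assoc)
  qed
  have G01: "0 \<le> G x j \<and> G x j \<le> 1" if x: "0 < x" "x < x0" and j: "j \<in> J" for x j
  proof -
    interpret bd_params a "a - b" "1 - x" by unfold_locales (use ab x x0 xne[OF x] in auto)
    have "2 * a / (a - b) * \<nu> j * bd_I a (a - b) (1 - x) 0 \<le> 0"
      using I_le_0[of 0] by (intro mult_nonneg_nonpos[OF c0[OF j]]) simp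
    then show ?thesis unfolding G_def by simp
  qed
  define Rm where "Rm = (\<Sum>w\<in>range (sel_part Ssel). \<alpha> w + \<beta> w)"
  have Rm: "\<alpha> (sel_part Ssel v) \<le> Rm" "\<beta> (sel_part Ssel v) \<le> Rm" for v
  proof -
    have "\<alpha> (sel_part Ssel v) + \<beta> (sel_part Ssel v) \<le> Rm"
      unfolding Rm_def using finite_range_sel_part[OF Ssel_fin] rates_nonneg
      by (intro member_le_sum) auto
    then show "\<alpha> (sel_part Ssel v) \<le> Rm" "\<beta> (sel_part Ssel v) \<le> Rm"
      using rates_nonneg[of "sel_part Ssel v"] by linarith+
  qed
  have selu: "sel_part Ssel (u m) = sel_part Ssel u0" for m using u_sel by (auto simp: sel_part_def)
  define tS where "tS i c = (\<Sum>psi\<in>UNIV - {c}. \<theta>sel i c psi)" for i c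
  define tJ where "tJ j c = (\<Sum>psi\<in>UNIV - {c}. \<theta> j c psi)" for j c
  have tS0: "tS i c \<ge> 0" if "i \<in> Ssel" for i c unfolding tS_def using thsel0[OF that] by (intro sum_nonneg) auto
  have tJ0: "tJ j c \<ge> 0" if "j \<in> J" for j c unfolding tJ_def using th0[OF that] by (intro sum_nonneg) auto
  define E1 where "E1 = (\<Sum>i\<in>Ssel. \<Sum>c\<in>UNIV. tS i c + 1) + (\<Sum>j\<in>J. \<Sum>c\<in>UNIV. tJ j c + 1)"
  have E1_S: "tS i c + 1 \<le> E1" if i: "i \<in> Ssel" for i c
  proof -
    have "tS i c + 1 \<le> (\<Sum>c\<in>UNIV. tS i c + 1)" using tS0[OF i] finite_nuc
      by (intro member_le_sum[where f = "\<lambda>c. tS i c + 1"]) (auto intro: add_nonneg_nonneg)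
    also have "\<dots> \<le> (\<Sum>i\<in>Ssel. \<Sum>c\<in>UNIV. tS i c + 1)" using Ssel_fin i tS0
      by (intro member_le_sum[where f = "\<lambda>i. \<Sum>c\<in>UNIV. tS i c + 1"]) (auto intro!: sum_nonneg add_nonneg_nonneg)
    also have "\<dots> \<le> E1" unfolding E1_def using tJ0 by (auto intro!: sum_nonneg add_nonneg_nonneg)
    finally show ?thesis .
  qed
  have E1_J: "tJ j c + 1 \<le> E1" if j: "j \<in> J" for j c
  proof -
    have "tJ j c + 1 \<le> (\<Sum>c\<in>UNIV. tJ j c + 1)" using tJ0[OF j] finite_nuc
      by (intro member_le_sum[where f = "\<lambda>c. tJ j c + 1"]) (auto intro: add_nonneg_nonneg)
    also have "\<dots> \<le> (\<Sum>j\<in>J. \<Sum>c\<in>UNIV. tJ j c + 1)" using J_fin j tJ0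
      by (intro member_le_sum[where f = "\<lambda>j. \<Sum>c\<in>UNIV. tJ j c + 1"]) (auto intro!: sum_nonneg add_nonneg_nonneg)
    also have "\<dots> \<le> E1" unfolding E1_def using tS0 by (auto intro!: sum_nonneg add_nonneg_nonneg)
    finally show ?thesis .
  qed
  have limS: "(\<lambda>m. real (n m) * (1 - pmf (\<mu> m i c) c)) \<longlonglongrightarrow> tS i c" if "i \<in> Ssel" for i c
    unfolding tS_def using mu_sel_lim[OF that] by (intro tendsto_outflow) auto
  have limJ: "(\<lambda>m. real (n m) * (1 - pmf (\<mu>J m j c) c)) \<longlonglongrightarrow> tJ j c" if "j \<in> J" for j c
    unfolding tJ_def using mu_lim[OF that] by (intro tendsto_outflow) auto
  have evS: "\<forall>\<^sub>F m in sequentially. \<forall>i\<in>Ssel. \<forall>c\<in>UNIV. real (n m) * (1 - pmf (\<mu> m i c) c) \<le> E1"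
  proof (intro eventually_ball_finite Ssel_fin finite_nuc ballI)
    fix i c assume i: "i \<in> Ssel"
    have "\<forall>\<^sub>F m in sequentially. real (n m) * (1 - pmf (\<mu> m i c) c) < tS i c + 1"
      by (rule order_tendstoD(2)[OF limS[OF i]]) simp
    then show "\<forall>\<^sub>F m in sequentially. real (n m) * (1 - pmf (\<mu> m i c) c) \<le> E1"
      by eventually_elim (use E1_S[OF i, of c] in linarith)
  qed
  have evJ: "\<forall>\<^sub>F m in sequentially. \<forall>j\<in>J. \<forall>c\<in>UNIV. real (n m) * (1 - pmf (\<mu>J m j c) c) \<le> E1"
  proof (intro eventually_ball_finite J_fin finite_nuc ballI)
    fix j c assume j: "j \<in> J"
    have "\<forall>\<^sub>F m in sequentially. real (n m) * (1 - pmf (\<mu>J m j c) c) < tJ j c + 1"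
      by (rule order_tendstoD(2)[OF limJ[OF j]]) simp
    then show "\<forall>\<^sub>F m in sequentially. real (n m) * (1 - pmf (\<mu>J m j c) c) \<le> E1"
      by eventually_elim (use E1_J[OF j, of c] in linarith)
  qed
  have evn: "\<forall>\<^sub>F m in sequentially. n m > 0" 
    using filterlim_at_top[THEN iffD1, OF n_lim, rule_format, of 1] by (simp add: Suc_le_eq)
  have evmut: "\<forall>\<^sub>F m in sequentially. n m > 0 \<and> (\<forall>i\<in>S m. \<forall>c. real (n m) * (1 - pmf (\<mu> m i c) c) \<le> E1)"
    using evS evJ evn
  proof eventually_elim
    case (elim m)
    have "real (n m) * (1 - pmf (\<mu> m i c) c) \<le> E1" if iS: "i \<in> S m" for i c
    proof (cases "i \<in> Ssel")
      case True then show ?thesis using elim(1) by auto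
    next
      case False
      then obtain j where "j \<in> J" "i \<in> Spart m j" using iS part_cover[of m] by (auto simp: S_def)
      then show ?thesis using elim(2) mu_part[of j i m] by auto
    qed
    then show ?case using elim(3) by auto
  qed
  have E10: "E1 \<ge> 0"
    unfolding E1_def using tS0 tJ0 by (auto intro!: sum_nonneg add_nonneg_nonneg)
  define E0 where "E0 = real (card Ssel + 2) * E1"
  have E00: "E0 \<ge> 0" using E10 by (simp add: E0_def)
  have key: "\<forall>e>0. \<forall>\<^sub>F m in sequentially. \<forall>T. PT m T \<longrightarrow>
     \<bar>(\<integral>M. (\<Prod>i\<in>T. x ^ B_count (u m) M i) \<partial>measure_spmf (p m)) - h * exp (2 * a / (a - b) * N * bd_I a (a - b) (1 - x) 0)\<bar> \<le> e"
    if x: "0 < x" "x < x0" and N: "N \<ge> 0"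
      and sT: "\<And>m T. PT m T \<Longrightarrow> T \<subseteq> Sneut m \<and> card T \<le> 2"
      and PT: "\<And>d. d > 0 \<Longrightarrow> \<forall>\<^sub>F m in sequentially. \<forall>T. PT m T \<longrightarrow>
         \<bar>real (n m) * (\<Sum>i\<in>T. 1 - pmf (\<mu> m i (u m i)) (u m i)) - N\<bar> \<le> d"
    for x N and PT :: "nat \<Rightarrow> nat set \<Rightarrow> bool"
  proof (intro allI impI)
    fix e :: real assume e: "e > 0"
    have x1: "0 \<le> x" "x < 1" using x x0 by auto
    have aR: "a \<le> Rm" using Rm(1)[of u0] by (simp add: a_def)
    obtain n0 d where d: "d > 0" and
      B: "\<And>n \<alpha> \<beta> Ssel S \<mu> T u. n0 \<le> n \<Longrightarrow> bp_pgf \<alpha> \<beta> Ssel S \<mu> T u a b Rm E0 n x N d \<Longrightarrow>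
       \<bar>(\<integral>M. (\<Prod>i\<in>T. x ^ B_count u M i) \<partial>measure_spmf (bp_hit \<alpha> \<beta> Ssel S \<mu> n {#u#})) -
      (1 - b / a) * exp (2 * a * N / (a - b) * bd_I a (a - b) (1 - x) 0)\<bar> \<le> e"
      using bp_pgf_limit[OF ab aR E00 x1 xne[OF x] N e] by (elim exE conjE) blast
    have "\<forall>\<^sub>F m in sequentially. n0 \<le> n m" using n_lim by (simp add: filterlim_at_top)
    with evmut PT[OF d] show "\<forall>\<^sub>F m in sequentially. \<forall>T. PT m T \<longrightarrow>
     \<bar>(\<integral>M. (\<Prod>i\<in>T. x ^ B_count (u m) M i) \<partial>measure_spmf (p m)) - h * exp (2 * a / (a - b) * N * bd_I a (a - b) (1 - x) 0)\<bar> \<le> e"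
    proof eventually_elim
      case (elim m)
      show ?case
      proof (intro allI impI)
        fix T assume T: "PT m T"
        have TS: "T \<subseteq> Sneut m" "card T \<le> 2" using sT[OF T] by auto
        have finT: "finite T" using TS(1) Sneut_fin finite_subset by blast
        have "bp_pgf \<alpha> \<beta> Ssel (S m) (\<mu> m) T (u m) a b Rm E0 (n m) x N d"
        proof unfold_locales
          show "finite (S m)" by (rule finS)
          show "Ssel \<subseteq> S m" "T \<subseteq> S m" using TS by (auto simp: S_def)
          show "T \<inter> Ssel = {}" using TS Sneut_disj[of m] by auto
          show "\<alpha> (sel_part Ssel (u m)) = a" "\<beta> (sel_part Ssel (u m)) = b" by (auto simp: selu a_def b_def)
          show "n m > 0" using elim(1) by simp
          show "(\<Sum>i\<in>Ssel \<union> T. 1 - pmf (\<mu> m i (v i)) (v i)) \<le> E0 / real (n m)" for v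
          proof -
            have "(\<Sum>i\<in>Ssel \<union> T. 1 - pmf (\<mu> m i (v i)) (v i)) \<le> (\<Sum>i\<in>Ssel \<union> T. E1 / real (n m))"
            proof (rule sum_mono)
              fix i assume "i \<in> Ssel \<union> T"
              then have "i \<in> S m" using TS by (auto simp: S_def)
              then have "real (n m) * (1 - pmf (\<mu> m i (v i)) (v i)) \<le> E1" using elim(1) by auto
              then show "1 - pmf (\<mu> m i (v i)) (v i) \<le> E1 / real (n m)" using elim(1) by (simp add: pos_le_divide_eq mult.commute)
            qed
            also have "\<dots> = real (card (Ssel \<union> T)) * (E1 / real (n m))" by simp
            also have "\<dots> \<le> real (card Ssel + 2) * (E1 / real (n m))"
              using card_Un_le[of Ssel T] TS E10 by (intro mult_right_mono) auto
            finally show ?thesis by (simp add: E0_def)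
          qed
          show "\<bar>real (n m) * (\<Sum>i\<in>T. 1 - pmf (\<mu> m i (u m i)) (u m i)) - N\<bar> \<le> d" using elim(2) T by blast
        qed (use rates_nonneg ab Rm x1 xne[OF x] N in auto)
        from B[OF elim(3) this]
        show "\<bar>(\<integral>M. (\<Prod>i\<in>T. x ^ B_count (u m) M i) \<partial>measure_spmf (p m)) - h * exp (2 * a / (a - b) * N * bd_I a (a - b) (1 - x) 0)\<bar> \<le> e"
          unfolding p_def h_def by (simp add: mult_ac)
      qed
    qed
  qed
  have outJ: "\<forall>\<^sub>F m in sequentially. \<forall>i\<in>Spart m j. \<bar>real (n m) * (1 - pmf (\<mu> m i (u m i)) (u m i)) - \<nu> j\<bar> \<le> d"
    if j: "j \<in> J" and d: "d > 0" for j d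
  proof -
    have "(\<lambda>m. real (n m) * (1 - pmf (\<mu>J m j (uJ j)) (uJ j))) \<longlonglongrightarrow> \<nu> j"
      using limJ[OF j, of "uJ j"] by (simp add: tJ_def \<nu>_def)
    then have "\<forall>\<^sub>F m in sequentially. dist (real (n m) * (1 - pmf (\<mu>J m j (uJ j)) (uJ j))) (\<nu> j) < d"
      using d by (rule tendstoD)
    then show ?thesis
      by eventually_elim (use mu_part[OF j] u_part[OF j] in \<open>auto simp: dist_real_def less_imp_le\<close>)
  qed
  have x0h: "0 < x0 / 2" "x0 / 2 < x0" using x0 by auto
  have ev0: "\<forall>\<^sub>F m in sequentially. \<bar>weight_spmf (p m) - h\<bar> \<le> e" if e: "e > 0" for e
  proof -
    have "\<forall>\<^sub>F m in sequentially. \<forall>T. T = {} \<longrightarrow> \<bar>(\<integral>M. (\<Prod>i\<in>T. (x0 / 2) ^ B_count (u m) M i) \<partial>measure_spmf (p m)) -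
        h * exp (2 * a / (a - b) * 0 * bd_I a (a - b) (1 - x0 / 2) 0)\<bar> \<le> e"
      by (rule key[OF x0h, of 0 "\<lambda>m T. T = {}", THEN spec, THEN mp, OF _ _ _ e]) auto
    then show ?thesis by eventually_elim (simp add: weight_spmf_def)
  qed
  have ev1: "\<forall>\<^sub>F m in sequentially. \<forall>j\<in>J. \<forall>i\<in>Spart m j. \<bar>(\<integral>M. x ^ B_count (u m) M i \<partial>measure_spmf (p m)) - h * G x j\<bar> \<le> e"
    if x: "0 < x" "x < x0" and e: "e > 0" for x e
  proof (intro eventually_ball_finite J_fin ballI)
    fix j assume j: "j \<in> J"
    let ?PT = "\<lambda>m T. \<exists>i\<in>Spart m j. T = {i}"
    have "\<forall>\<^sub>F m in sequentially. \<forall>T. ?PT m T \<longrightarrow> \<bar>(\<integral>M. (\<Prod>i\<in>T. x ^ B_count (u m) M i) \<partial>measure_spmf (p m)) -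
        h * exp (2 * a / (a - b) * \<nu> j * bd_I a (a - b) (1 - x) 0)\<bar> \<le> e"
    proof (rule key[OF x nu0[OF j], of ?PT, THEN spec, THEN mp, OF _ _ e])
      fix d :: real assume "d > 0"
      from outJ[OF j this] show "\<forall>\<^sub>F m in sequentially. \<forall>T. ?PT m T \<longrightarrow> \<bar>real (n m) * (\<Sum>i\<in>T. 1 - pmf (\<mu> m i (u m i)) (u m i)) - \<nu> j\<bar> \<le> d"
        by eventually_elim auto
    qed (use sub[OF j] in auto)
    then show "\<forall>\<^sub>F m in sequentially. \<forall>i\<in>Spart m j. \<bar>(\<integral>M. x ^ B_count (u m) M i \<partial>measure_spmf (p m)) - h * G x j\<bar> \<le> e"
      unfolding G_def
    proof eventually_elim
      case (elim m)
      show ?case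
      proof
        fix i assume "i \<in> Spart m j"
        then show "\<bar>(\<integral>M. x ^ B_count (u m) M i \<partial>measure_spmf (p m)) -
            h * exp (2 * a / (a - b) * \<nu> j * bd_I a (a - b) (1 - x) 0)\<bar> \<le> e"
          using elim[rule_format, of "{i}"] by simp
      qed
    qed
  qed
  have ev2: "\<forall>\<^sub>F m in sequentially. \<forall>j\<in>J. \<forall>j'\<in>J. \<forall>i\<in>Spart m j. \<forall>i'\<in>Spart m j'. i \<noteq> i' \<longrightarrow>
      \<bar>(\<integral>M. x ^ B_count (u m) M i * x ^ B_count (u m) M i' \<partial>measure_spmf (p m)) - h * (G x j * G x j')\<bar> \<le> e"
    if x: "0 < x" "x < x0" and e: "e > 0" for x e
  proof (intro eventually_ball_finite J_fin ballI)
    fix j j' assume j: "j \<in> J" and j': "j' \<in> J"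
    let ?PT = "\<lambda>m T. \<exists>i\<in>Spart m j. \<exists>i'\<in>Spart m j'. i \<noteq> i' \<and> T = {i, i'}"
    have pair: "\<forall>\<^sub>F m in sequentially. \<forall>T. ?PT m T \<longrightarrow> \<bar>(\<integral>M. (\<Prod>i\<in>T. x ^ B_count (u m) M i) \<partial>measure_spmf (p m)) -
        h * exp (2 * a / (a - b) * (\<nu> j + \<nu> j') * bd_I a (a - b) (1 - x) 0)\<bar> \<le> e"
    proof (rule key[OF x, of _ ?PT, THEN spec, THEN mp, OF _ _ _ e])
      show "0 \<le> \<nu> j + \<nu> j'" using nu0 j j' by auto
      show "T \<subseteq> Sneut m \<and> card T \<le> 2" if "?PT m T" for m T
        using that sub[OF j, of m] sub[OF j', of m] by auto
      fix d :: real assume d: "d > 0"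
      have d2: "d / 2 > 0" using d by simp
      from outJ[OF j d2] outJ[OF j' d2]
      show "\<forall>\<^sub>F m in sequentially. \<forall>T. ?PT m T \<longrightarrow> \<bar>real (n m) * (\<Sum>i\<in>T. 1 - pmf (\<mu> m i (u m i)) (u m i)) - (\<nu> j + \<nu> j')\<bar> \<le> d"
      proof eventually_elim
        case (elim m)
        show ?case
        proof (intro allI impI)
          fix T assume "?PT m T"
          then obtain i i' where i: "i \<in> Spart m j" "i' \<in> Spart m j'" "i \<noteq> i'" "T = {i, i'}" by auto
          have "real (n m) * (\<Sum>i\<in>T. 1 - pmf (\<mu> m i (u m i)) (u m i)) =
            real (n m) * (1 - pmf (\<mu> m i (u m i)) (u m i)) + real (n m) * (1 - pmf (\<mu> m i' (u m i')) (u m i'))"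
            using i by (simp add: algebra_simps)
          moreover have "\<bar>real (n m) * (1 - pmf (\<mu> m i (u m i)) (u m i)) - \<nu> j\<bar> \<le> d / 2" using elim(1) i by auto
          moreover have "\<bar>real (n m) * (1 - pmf (\<mu> m i' (u m i')) (u m i')) - \<nu> j'\<bar> \<le> d / 2" using elim(2) i by auto
          ultimately show "\<bar>real (n m) * (\<Sum>i\<in>T. 1 - pmf (\<mu> m i (u m i)) (u m i)) - (\<nu> j + \<nu> j')\<bar> \<le> d" by linarith
        qed
      qed
    qed
    have exp_eq: "exp (2 * a / (a - b) * (\<nu> j + \<nu> j') * bd_I a (a - b) (1 - x) 0) = G x j * G x j'"
      unfolding G_def exp_add[symmetric] by (simp add: distrib_left distrib_right)
    from pair[unfolded exp_eq] show "\<forall>\<^sub>F m in sequentially. \<forall>i\<in>Spart m j. \<forall>i'\<in>Spart m j'. i \<noteq> i' \<longrightarrow>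
      \<bar>(\<integral>M. x ^ B_count (u m) M i * x ^ B_count (u m) M i' \<partial>measure_spmf (p m)) - h * (G x j * G x j')\<bar> \<le> e"
    proof eventually_elim
      case (elim m)
      show ?case
      proof (intro ballI impI)
        fix i i' assume i: "i \<in> Spart m j" "i' \<in> Spart m j'" "i \<noteq> i'"
        then have "\<bar>(\<integral>M. (\<Prod>i\<in>{i, i'}. x ^ B_count (u m) M i) \<partial>measure_spmf (p m)) - h * (G x j * G x j')\<bar> \<le> e"
          using elim[rule_format, of "{i, i'}"] by blast
        then show "\<bar>(\<integral>M. x ^ B_count (u m) M i * x ^ B_count (u m) M i' \<partial>measure_spmf (p m)) - h * (G x j * G x j')\<bar> \<le> e"
          using i(3) by simp
      qed
    qed
  qed
  define Ph where "Ph x m M = (\<Sum>i\<in>S m. x ^ B_count (u m) M i) / real (card (S m))" for x m M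
  have ratio: "(\<lambda>m. real (card (Spart m j)) / real (card (S m))) \<longlonglongrightarrow> q j" if j: "j \<in> J" for j
  proof -
    have "(\<lambda>m. real (card Ssel) / real (card (Sneut m))) \<longlonglongrightarrow> 0"
      by (rule tendsto_divide_0[OF tendsto_const filterlim_at_top_imp_at_infinity[OF Nlim]])
    then have "(\<lambda>m. (real (card (Spart m j)) / real (card (Sneut m))) / (1 + real (card Ssel) / real (card (Sneut m)))) \<longlonglongrightarrow> q j / (1 + 0)"
      by (intro tendsto_divide q_lim[OF j] tendsto_add tendsto_const) auto
    moreover have "\<forall>\<^sub>F m in sequentially. (real (card (Spart m j)) / real (card (Sneut m))) / (1 + real (card Ssel) / real (card (Sneut m)))
       = real (card (Spart m j)) / real (card (S m))"
      using filterlim_at_top_dense[THEN iffD1, OF Nlim, rule_format, of 0]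
      by eventually_elim (simp add: cardS field_simps)
    ultimately show ?thesis using Lim_transform_eventually by fastforce
  qed
  have conv: "(\<lambda>m. measure (measure_spmf (p m)) {M. t \<le> \<bar>Ph x m M - (\<Sum>j\<in>J. q j * G x j)\<bar>}) \<longlonglongrightarrow> 0"
    if x: "0 < x" "x < x0" and t: "t > 0" for x t
  proof -
    define det where "det m = real (card Ssel) / real (card (S m)) + (\<Sum>j\<in>J. \<bar>real (card (Spart m j)) / real (card (S m)) - q j\<bar>)" for m
    have "det \<longlonglongrightarrow> 0 + (\<Sum>j\<in>J. \<bar>q j - q j\<bar>)"
      unfolding det_def
      by (intro tendsto_add tendsto_sum tendsto_rabs tendsto_diff ratio tendsto_const
          tendsto_divide_0[OF tendsto_const filterlim_at_top_imp_at_infinity[OF Slim]])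
    then have det0: "det \<longlonglongrightarrow> 0" by simp
    have "\<forall>\<^sub>F m in sequentially. measure (measure_spmf (p m)) {M. t \<le> \<bar>Ph x m M - (\<Sum>j\<in>J. q j * G x j)\<bar>} \<le> r"
      if r: "r > 0" for r
    proof -
      define e where "e = r * t\<^sup>2 / 32"
      have e: "e > 0" using r t by (simp add: e_def)
      have "(\<lambda>m. 4 / t\<^sup>2 / real (card (S m))) \<longlonglongrightarrow> 0"
        by (rule tendsto_divide_0[OF tendsto_const filterlim_at_top_imp_at_infinity[OF Slim]])
      then have "\<forall>\<^sub>F m in sequentially. 4 / t\<^sup>2 / real (card (S m)) < r / 2"
        by (rule order_tendstoD(2)) (use r in simp)
      moreover have "\<forall>\<^sub>F m in sequentially. det m < t / 2"
        by (rule order_tendstoD(2)[OF det0]) (use t in simp)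
      ultimately show ?thesis using ev0[OF e] ev1[OF x e] ev2[OF x e]
      proof eventually_elim
        case (elim m)
        define jj where "jj i = (SOME j. j \<in> J \<and> i \<in> Spart m j)" for i
        have jj: "jj i \<in> J" "i \<in> Spart m (jj i)" if "i \<in> Sneut m" for i
        proof -
          have "\<exists>j. j \<in> J \<and> i \<in> Spart m j" using that part_cover[of m] by auto
          from someI_ex[OF this] show "jj i \<in> J" "i \<in> Spart m (jj i)" by (auto simp: jj_def)
        qed
        have jj_eq: "jj i = j" if "j \<in> J" "i \<in> Spart m j" for i j
        proof -
          have "i \<in> Sneut m" using sub[OF that(1)] that(2) by auto
          then show ?thesis using jj[of i] part_disj[of "jj i" j m] that by auto
        qed
        define X where "X i M = x ^ B_count (u m) M i" for i M
        define l where "l i = G x (jj i)" for i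
        have x1: "0 \<le> x" "x \<le> 1" using x x0 by auto
        have X01: "0 \<le> X i M \<and> X i M \<le> 1" for i M using x1 by (simp add: X_def power_le_one)
        let ?c = "real (card (S m))" and ?N = "Sneut m"
        have cheb: "measure (measure_spmf (p m)) {M. ?c * (t / 2) \<le> \<bar>\<Sum>i\<in>?N. X i M - l i\<bar>} \<le>
           (real (card ?N) + 4 * e * (real (card ?N))\<^sup>2) / (?c * (t / 2))\<^sup>2"
        proof (rule spmf_chebyshev_pairwise[where h = h])
          show "finite ?N" by (rule Sneut_fin)
          show "0 \<le> X i M \<and> X i M \<le> 1" for i M by (rule X01)
          show "0 \<le> l i \<and> l i \<le> 1" if "i \<in> ?N" for i unfolding l_def by (rule G01[OF x jj(1)[OF that]])
          show "\<bar>weight_spmf (p m) - h\<bar> \<le> e" by (rule elim(3))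
          show "\<bar>(\<integral>M. X i M \<partial>measure_spmf (p m)) - h * l i\<bar> \<le> e" if "i \<in> ?N" for i
            unfolding X_def l_def using elim(4) jj[OF that] by auto
          show "\<bar>(\<integral>M. X i M * X i' M \<partial>measure_spmf (p m)) - h * (l i * l i')\<bar> \<le> e" if "i \<in> ?N" "i' \<in> ?N" "i \<noteq> i'" for i i'
            unfolding X_def l_def using elim(5) jj[OF that(1)] jj[OF that(2)] that(3) by auto
          show "0 < ?c * (t / 2)" using cS0 t by simp
        qed
        have "{M. t \<le> \<bar>Ph x m M - (\<Sum>j\<in>J. q j * G x j)\<bar>} \<subseteq> {M. ?c * (t / 2) \<le> \<bar>\<Sum>i\<in>?N. X i M - l i\<bar>}"
        proof
          fix M assume "M \<in> {M. t \<le> \<bar>Ph x m M - (\<Sum>j\<in>J. q j * G x j)\<bar>}"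
          then have tM: "t \<le> \<bar>Ph x m M - (\<Sum>j\<in>J. q j * G x j)\<bar>" by simp
          have sl: "(\<Sum>i\<in>?N. l i) = (\<Sum>j\<in>J. real (card (Spart m j)) * G x j)"
          proof -
            have "(\<Sum>i\<in>?N. l i) = (\<Sum>j\<in>J. \<Sum>i\<in>Spart m j. l i)"
              unfolding part_cover[of m, symmetric] using J_fin finPart part_disj
              by (intro sum.UNION_disjoint) auto
            also have "\<dots> = (\<Sum>j\<in>J. \<Sum>i\<in>Spart m j. G x j)"
              by (intro sum.cong refl) (simp add: l_def jj_eq)
            finally show ?thesis by simp
          qed
          have "(\<Sum>i\<in>S m. X i M) = (\<Sum>i\<in>Ssel. X i M) + (\<Sum>i\<in>?N. X i M)"
            unfolding S_def using Ssel_fin Sneut_fin Sneut_disj[of m] by (intro sum.union_disjoint) auto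
          also have "(\<Sum>i\<in>?N. X i M) = (\<Sum>i\<in>?N. X i M - l i) + (\<Sum>j\<in>J. real (card (Spart m j)) * G x j)"
            unfolding sl[symmetric] by (simp add: sum_subtractf)
          finally have "Ph x m M = (\<Sum>i\<in>Ssel. X i M) / ?c + (\<Sum>i\<in>?N. X i M - l i) / ?c + (\<Sum>j\<in>J. real (card (Spart m j)) / ?c * G x j)"
            unfolding Ph_def X_def[symmetric] by (simp add: add_divide_distrib sum_divide_distrib)
          then have eq: "Ph x m M - (\<Sum>j\<in>J. q j * G x j) = (\<Sum>i\<in>?N. X i M - l i) / ?c + ((\<Sum>i\<in>Ssel. X i M) / ?c
             + (\<Sum>j\<in>J. (real (card (Spart m j)) / ?c - q j) * G x j))"
            by (simp add: sum_subtractf left_diff_distrib)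
          have "\<bar>(\<Sum>i\<in>Ssel. X i M) / ?c\<bar> \<le> real (card Ssel) / ?c"
          proof -
            have "(\<Sum>i\<in>Ssel. X i M) \<le> (\<Sum>i\<in>Ssel. 1)" using X01 by (intro sum_mono) auto
            moreover have "(\<Sum>i\<in>Ssel. X i M) \<ge> 0" using X01 by (intro sum_nonneg) auto
            ultimately show ?thesis using cS0[of m] by (simp add: divide_right_mono)
          qed
          moreover have "\<bar>\<Sum>j\<in>J. (real (card (Spart m j)) / ?c - q j) * G x j\<bar> \<le> (\<Sum>j\<in>J. \<bar>real (card (Spart m j)) / ?c - q j\<bar>)"
          proof -
            have "\<bar>\<Sum>j\<in>J. (real (card (Spart m j)) / ?c - q j) * G x j\<bar> \<le> (\<Sum>j\<in>J. \<bar>(real (card (Spart m j)) / ?c - q j) * G x j\<bar>)"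
              by (rule sum_abs)
            also have "\<dots> \<le> (\<Sum>j\<in>J. \<bar>real (card (Spart m j)) / ?c - q j\<bar>)"
            proof (rule sum_mono)
              fix j assume "j \<in> J"
              then have "\<bar>G x j\<bar> \<le> 1" using G01[OF x] by auto
              then show "\<bar>(real (card (Spart m j)) / ?c - q j) * G x j\<bar> \<le> \<bar>real (card (Spart m j)) / ?c - q j\<bar>"
                by (simp add: abs_mult mult_left_le)
            qed
            finally show ?thesis .
          qed
          ultimately have "t / 2 \<le> \<bar>(\<Sum>i\<in>?N. X i M - l i) / ?c\<bar>" using tM elim(2) unfolding eq det_def by linarith
          then have "?c * (t / 2) \<le> \<bar>\<Sum>i\<in>?N. X i M - l i\<bar>"
            unfolding abs_divide using cS0[of m] by (simp add: pos_le_divide_eq mult.commute)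
          then show "M \<in> {M. ?c * (t / 2) \<le> \<bar>\<Sum>i\<in>?N. X i M - l i\<bar>}" by simp
        qed
        then have "measure (measure_spmf (p m)) {M. t \<le> \<bar>Ph x m M - (\<Sum>j\<in>J. q j * G x j)\<bar>} \<le>
            measure (measure_spmf (p m)) {M. ?c * (t / 2) \<le> \<bar>\<Sum>i\<in>?N. X i M - l i\<bar>}"
          by (intro measure_spmf.finite_measure_mono) auto
        also note cheb
        also have "(real (card ?N) + 4 * e * (real (card ?N))\<^sup>2) / (?c * (t / 2))\<^sup>2 \<le> (?c + 4 * e * ?c\<^sup>2) / (?c * (t / 2))\<^sup>2"
          using e by (intro divide_right_mono add_mono mult_left_mono power_mono) (auto simp: cardS)
        also have "\<dots> = 4 / t\<^sup>2 / ?c + 16 * e / t\<^sup>2"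
        proof -
          have "(c + 4 * e * c\<^sup>2) / (c * (t / 2))\<^sup>2 = 4 / t\<^sup>2 / c + 16 * e / t\<^sup>2" if "c > 0" for c :: real
            using that t by (simp add: power2_eq_square field_simps)
          then show ?thesis using cS0 by blast
        qed
        also have "16 * e / t\<^sup>2 = r / 2" using t by (simp add: e_def)
        finally show ?case using elim(1) by linarith
      qed
    qed
    note bound = this
    show ?thesis
    proof (rule tendstoI)
      fix r :: real assume r: "r > 0"
      then have "r / 2 > 0" by simp
      from bound[OF this] show "\<forall>\<^sub>F m in sequentially. dist (measure (measure_spmf (p m)) {M. t \<le> \<bar>Ph x m M - (\<Sum>j\<in>J. q j * G x j)\<bar>}) 0 < r"
        by eventually_elim (use r in \<open>simp add: dist_real_def\<close>)
    qed
  qed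
  obtain Xs t where Xs: "finite Xs" "Xs \<subseteq> {0<..<x0}" and t: "t > 0"
    and close: "\<forall>p. (\<forall>k. p k \<ge> 0) \<and> p sums 1 \<and> (\<forall>x\<in>Xs. \<bar>(\<Sum>k. p k * x ^ k) - (\<Sum>k. L k * x ^ k)\<bar> < t) \<longrightarrow> (\<Sum>k. \<bar>p k - L k\<bar>) \<le> \<epsilon>"
    using pgf_close_imp_l1_close[OF L0 L1 x0 eps] by (elim exE conjE)
  define Bad where "Bad m = {M. (\<Sum>k. \<bar>emp_meas (S m) (u m) M k - L k\<bar>) > \<epsilon>}" for m
  have "(\<lambda>m. \<Sum>x\<in>Xs. measure (measure_spmf (p m)) {M. t \<le> \<bar>Ph x m M - (\<Sum>j\<in>J. q j * G x j)\<bar>}) \<longlonglongrightarrow> (\<Sum>x\<in>Xs. 0)"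
    using Xs t by (intro tendsto_sum conv) auto
  then have up: "(\<lambda>m. \<Sum>x\<in>Xs. measure (measure_spmf (p m)) {M. t \<le> \<bar>Ph x m M - (\<Sum>j\<in>J. q j * G x j)\<bar>}) \<longlonglongrightarrow> 0" by simp
  have le: "measure (measure_spmf (p m)) (Bad m) \<le> (\<Sum>x\<in>Xs. measure (measure_spmf (p m)) {M. t \<le> \<bar>Ph x m M - (\<Sum>j\<in>J. q j * G x j)\<bar>})" for m
  proof -
    have "Bad m \<subseteq> (\<Union>x\<in>Xs. {M. t \<le> \<bar>Ph x m M - (\<Sum>j\<in>J. q j * G x j)\<bar>})"
    proof
      fix M assume M: "M \<in> Bad m"
      let ?p = "emp_meas (S m) (u m) M"
      have s: "(\<lambda>k. ?p k * x ^ k) sums Ph x m M" for x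
        unfolding Ph_def by (rule emp_meas_pgf[OF finS])
      have "?p sums 1" using s[of 1] cS0[of m] by (simp add: Ph_def)
      moreover have "\<forall>k. ?p k \<ge> 0" by (simp add: emp_meas_def)
      ultimately have "\<not> (\<forall>x\<in>Xs. \<bar>(\<Sum>k. ?p k * x ^ k) - (\<Sum>k. L k * x ^ k)\<bar> < t)"
        using close[THEN spec, of ?p] M by (auto simp: Bad_def)
      then obtain x where x: "x \<in> Xs" "t \<le> \<bar>(\<Sum>k. ?p k * x ^ k) - (\<Sum>k. L k * x ^ k)\<bar>" by auto
      have "(\<Sum>k. ?p k * x ^ k) = Ph x m M" using s[of x] by (simp add: sums_iff)
      moreover have "(\<Sum>k. L k * x ^ k) = (\<Sum>j\<in>J. q j * G x j)" using L_pgf x(1) Xs(2) by auto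
      ultimately show "M \<in> (\<Union>x\<in>Xs. {M. t \<le> \<bar>Ph x m M - (\<Sum>j\<in>J. q j * G x j)\<bar>})" using x by auto
    qed
    then have "measure (measure_spmf (p m)) (Bad m) \<le> measure (measure_spmf (p m)) (\<Union>x\<in>Xs. {M. t \<le> \<bar>Ph x m M - (\<Sum>j\<in>J. q j * G x j)\<bar>})"
      by (intro measure_spmf.finite_measure_mono) auto
    also have "\<dots> \<le> (\<Sum>x\<in>Xs. measure (measure_spmf (p m)) {M. t \<le> \<bar>Ph x m M - (\<Sum>j\<in>J. q j * G x j)\<bar>})"
      using Xs by (intro measure_spmf.finite_measure_subadditive_finite) auto
    finally show ?thesis .
  qed
  have num: "(\<lambda>m. measure (measure_spmf (p m)) (Bad m)) \<longlonglongrightarrow> 0"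
    by (rule tendsto_sandwich[OF _ _ tendsto_const up]) (use le in auto)
  have den: "(\<lambda>m. weight_spmf (p m)) \<longlonglongrightarrow> h"
  proof (rule tendstoI)
    fix r :: real assume r: "r > 0"
    then have "r / 2 > 0" by simp
    from ev0[OF this] show "\<forall>\<^sub>F m in sequentially. dist (weight_spmf (p m)) h < r"
      by eventually_elim (use r in \<open>simp add: dist_real_def\<close>)
  qed
  have "(\<lambda>m. measure (measure_spmf (p m)) (Bad m) / weight_spmf (p m)) \<longlonglongrightarrow> 0 / h"
    using h by (intro tendsto_divide num den) auto
  then show "(\<lambda>m. bp_cond_prob \<alpha> \<beta> Ssel (Ssel \<union> Sneut m) (\<mu> m) (n m) (u m)
            {M. (\<Sum>k. \<bar>emp_meas (Ssel \<union> Sneut m) (u m) M k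
                     - (\<Sum>j\<in>J. q j * gen_LD
                          (\<alpha> (sel_part Ssel u0) - \<beta> (sel_part Ssel u0))
                          (\<alpha> (sel_part Ssel u0)) (\<beta> (sel_part Ssel u0))
                          (2 * \<alpha> (sel_part Ssel u0) / (\<alpha> (sel_part Ssel u0) - \<beta> (sel_part Ssel u0))
                             * (\<Sum>psi\<in>UNIV - {uJ j}. \<theta> j (uJ j) psi)) k)\<bar>) > \<epsilon>})
          \<longlonglongrightarrow> 0"
    unfolding bp_cond_prob_def Bad_def p_def S_def L_def Lam_def \<nu>_def a_def b_def by simp
qed

end
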